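(* Let $q$ be a prime power, $n\ge1$, and let $M$ be chosen uniformly at random from $\mathrm{U}(n,q)$. Then for every integer $0\le h<n-1$ and every monic $f\in\mathbb{F}_{q^2}[T]$ of degree $n$, $$\left|\mathbb{P}_{M\in\mathrm{U}(n,q)}\big(\det(T-M)\in I(f;h)\big)-\frac{q^{2(h+1)}}{q^{2n}}\right|\le q^{-\frac{n^2}{4(n-h-1)}}\,q^{\frac n2}\Big(1+\frac1{q-1}\Big)^n\binom{3n-2h-3}{n}.$$
   Context: $\mathrm{U}(n,q)=\{M\in\mathrm{GL}(n,\mathbb{F}_{q^2}):M\overline{M}^t=I_n\}$, where $\overline{M}$ raises every entry of $M$ to the $q$-th power; it carries the uniform probability measure. For a monic $f\in\mathbb{F}_{q^2}[T]$ of degree $n$ and $0\le h\le n-1$, $I(f;h)=\{g\in\mathbb{F}_{q^2}[T]\text{ monic}:\deg(f-g)\le h\}$ (with $\deg0=-\infty$). *)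

theory Defs
  imports Complex_Main "Jordan_Normal_Form.Char_Poly"
begin

text \<open>Unitary group U(n,q) inside GL(n, F_{q^2}); conjugation raises entries to the q-th power.\<close>
definition unitary_group :: "nat \<Rightarrow> nat \<Rightarrow> ('a::{field,finite}) mat set" where
  "unitary_group n q = {M \<in> carrier_mat n n.
      M * transpose_mat (map_mat (\<lambda>x. x ^ q) M) = 1\<^sub>m n}"

text \<open>I(f;h): monic g with deg(f-g) <= h (deg 0 = -infinity, so g = f is included).\<close>
definition short_interval :: "('a::field) poly \<Rightarrow> nat \<Rightarrow> 'a poly set" where
  "short_interval f h = {g. monic g \<and> (f - g = 0 \<or> degree (f - g) \<le> h)}"

end

theory Submission
  imports Defs "HOL-Computational_Algebra.Polynomial_FPS"
begin

text \<open>Let $w(f)$ be the probability that a random $M$ in $U(n,q)$ has characteristic polynomial $f$.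
For a vector $v$ the sequence $c_k = \langle v, M^k v\rangle$ is Hermitian ($c_{-k} = \overline{c_k}$) and
satisfies a linear recurrence whose minimal polynomial $r$ is self-dual. Splitting off the cyclic
subspace generated by $v$ matches the pairs $(M,v)$ with a given sequence $c$ and characteristic
polynomial $f$, up to orders of unitary groups, with the pairs $(D,u)$ in dimension $n - \deg r$ whose
sequence vanishes and for which $r$ times the characteristic polynomial of $D$ is $f$. Counting all $v$, and counting the
$v$ of norm 0 minus those of norm 1, expresses $q^{2n} w(f)$ and $(-q)^n w(f)$ as convolutions over
self-dual divisors with the same unknown function; eliminating that function gives
\[ q^n w(f) = \sum_{K \mid f \textrm{ self-dual}} (-1)^{\deg (f/K)}\, w(f/K). \]
Put $l = n - h - 1$, and consider the deviation from uniformity of the $l$ coefficients below the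
leading one. In the recursion the self-dual $K$ of degree above $2l$ are equidistributed and
contribute nothing, so by induction the deviation is at most the $n$-th coefficient of $E^{2l}$ with
$E = \sum_n q^n u^n / \prod_{i=1}^n (q^i - 1)$, and convexity bounds that coefficient.\<close>

section \<open>Quadratic extensions of finite fields\<close>

text \<open>The minimal recurrence r of the moments may be shorter than the cyclic space of v: r(M)v
  need not vanish. Its products with all M^i v are values of r applied to c, hence zero. So r(M)v is
  isotropic and lies in the orthogonal complement of the first deg r Krylov vectors; it is the
  vector u of the pair (D,u), and its sequence vanishes for the same reason. How often vanishing
  sequences occur is the unknown function, and the two weights on v serve to eliminate it. Summed
  over the sequences killed by a self-dual K, weight 1 gives q^(deg K), while the signed weight
  gives 0 unless K = 1 and so inverts the constant function 1.

  For the bound, E(qu) = (1+qu) E(u) makes the coefficients of E^(2l) satisfy the recursion exactly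
  when the number q^m + q^(m-1) of self-dual polynomials of degree m is replaced by the coefficient
  binom(2l,m) q^m of (1+qu)^(2l). For 0 < m < 2l this binomial coefficient is at least 2, which is
  enough. At m = 2l it is 1 and the plain count is too large; there the nearly uniform distribution
  of the classes gives the missing cancellation.\<close>

lemma card_fibres_tight:
  assumes fA: "finite A" and fB: "finite B" and img: "f ` A \<subseteq> B"
    and fib: "\<And>b. b \<in> B \<Longrightarrow> card {a\<in>A. f a = b} \<le> k"
    and B: "card B \<le> m" and A: "card A = m * k" and k: "k > 0"
  shows "card B = m" and "b \<in> B \<Longrightarrow> card {a\<in>A. f a = b} = k"
proof -
  have eq: "card A = (\<Sum>b\<in>B. card {a\<in>A. f a = b})"
    using sum.group[OF fA fB img, of "\<lambda>_. 1::nat"] by simp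
  have le: "(\<Sum>b\<in>B. card {a\<in>A. f a = b}) \<le> card B * k"
    using sum_bounded_above[of B "\<lambda>b. card {a\<in>A. f a = b}" k] fib by simp
  have "m * k \<le> card B * k" using eq le A by simp
  then have "m \<le> card B" using k by simp
  then show cB: "card B = m" using B by simp
  show "card {a\<in>A. f a = b} = k" if b: "b \<in> B"
  proof (rule ccontr)
    assume "card {a\<in>A. f a = b} \<noteq> k"
    then have "card {a\<in>A. f a = b} < k" using fib[OF b] by simp
    then have "(\<Sum>b\<in>B. card {a\<in>A. f a = b}) < (\<Sum>b\<in>B. k)"
      using fib b fB by (intro sum_strict_mono_ex1) auto
    then show False using eq A cB by simp
  qed
qed

locale quadratic_extension =
  fixes q :: nat and F :: "'a::{field,finite} itself"
  assumes prime_power: "\<exists>p k. prime p \<and> k > 0 \<and> q = p ^ k"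
    and card_F: "card (UNIV :: 'a set) = q ^ 2"
begin

definition cj :: "'a \<Rightarrow> 'a" where "cj x = x ^ q"

lemma CHAR_pow: "prime CHAR('a)" "\<exists>k>0. q = CHAR('a) ^ k"
proof -
  show pr: "prime CHAR('a)"
    using finite_imp_CHAR_pos[where ?'a='a] prime_CHAR_semidom[where ?'a='a] by simp
  obtain p k where p: "prime p" "k > 0" "q = p ^ k" using prime_power by auto
  \<comment> \<open>Translation by 1 permutes the field, so the number of its elements is zero in
    it.\<close>
  have "(\<Sum>y\<in>UNIV. y + (1::'a)) = (\<Sum>y\<in>UNIV. y)"
    by (rule sum.reindex_bij_witness[of _ "\<lambda>y. y - 1" "\<lambda>y. y + 1"]) auto
  then have "of_nat (card (UNIV :: 'a set)) = (0::'a)" by (simp add: sum.distrib)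
  then have "CHAR('a) dvd q ^ 2" using of_nat_eq_0_iff_char_dvd card_F by metis
  then have "CHAR('a) dvd p" using p pr by (metis prime_dvd_power)
  then have "CHAR('a) = p" using p pr by (metis primes_dvd_imp_eq)
  then show "\<exists>k>0. q = CHAR('a) ^ k" using p by auto
qed

lemma q_ge_2: "q \<ge> 2"
proof -
  obtain k where k: "k > 0" "q = CHAR('a) ^ k" using CHAR_pow by auto
  have "CHAR('a) \<ge> 2" using CHAR_pow(1) prime_ge_2_nat by blast
  moreover have "CHAR('a) \<le> CHAR('a) ^ k" using k CHAR_pow(1) self_le_power prime_ge_1_nat by metis
  ultimately show ?thesis using k by linarith
qed

lemma cj_add: "cj (x + y) = cj x + cj y"
  unfolding cj_def using CHAR_pow freshmans_dream' by metis

lemma cj_mult: "cj (x * y) = cj x * cj y"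
  by (simp add: cj_def power_mult_distrib)

lemma cj_0 [simp]: "cj 0 = 0" using q_ge_2 by (simp add: cj_def)

lemma cj_1 [simp]: "cj 1 = 1" by (simp add: cj_def)

lemma cj_minus: "cj (- x) = - cj x"
  by (metis cj_0 cj_add add_eq_0_iff add.right_inverse)

lemma cj_diff: "cj (x - y) = cj x - cj y"
  by (metis cj_add cj_minus diff_conv_add_uminus)

lemma cj_sum: "cj (sum f A) = (\<Sum>x\<in>A. cj (f x))"
  by (induction A rule: infinite_finite_induct) (auto simp: cj_add)

lemma cj_cj [simp]: "cj (cj x) = x"
proof (cases "x = 0")
  case False
  \<comment> \<open>Multiplication by x permutes the nonzero elements; comparing the products gives
    x^(q^2 - 1) = 1.\<close>
  have "(\<Prod>y\<in>UNIV-{0}. x * y) = x ^ (card (UNIV :: 'a set) - 1) * \<Prod>(UNIV-{0})"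
    by (simp add: prod.distrib)
  moreover have "(\<Prod>y\<in>UNIV-{0}. x * y) = (\<Prod>y\<in>UNIV-{0}. y)"
    by (rule prod.reindex_bij_witness[of _ "\<lambda>y. y / x" "\<lambda>y. x * y"]) (use False in auto)
  ultimately have "x ^ (card (UNIV :: 'a set) - 1) = 1" by simp
  then have "x ^ card (UNIV :: 'a set) = x"
    by (metis finite_UNIV_card_ge_0 finite mult_1 power_minus_mult)
  then show ?thesis by (simp add: cj_def card_F power2_eq_square flip: power_mult)
qed simp

lemma cj_eq_0_iff [simp]: "cj x = 0 \<longleftrightarrow> x = 0"
  by (metis cj_cj cj_0)

lemma cj_inverse: "cj (inverse x) = inverse (cj x)"
  by (simp add: cj_def power_inverse)

lemma cj_divide: "cj (x / y) = cj x / cj y"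
  by (simp add: cj_def power_divide)

text \<open>The subfield over which \<open>cj\<close> is the nontrivial automorphism;
  \<open>card_Fix\<close> shows that it has q elements.\<close>

definition Fix :: "'a set" where "Fix = {x. cj x = x}"

lemma card_roots:
  fixes P :: "'a poly"
  assumes "degree P = d" "d > 0"
  shows "card {x. poly P x = 0} \<le> d"
proof -
  have "P \<noteq> 0" using assms by auto
  then show ?thesis using card_poly_roots_bound[of P] assms by simp
qed

lemma card_Fix_le: "card Fix \<le> q"
proof -
  have "degree (Polynomial.monom 1 q - Polynomial.monom (1::'a) 1) = q"
    unfolding diff_conv_add_uminus using q_ge_2
    by (subst degree_add_eq_left) (simp_all add: degree_monom_eq)
  from card_roots[OF this] q_ge_2 show ?thesis
    by (simp add: Fix_def cj_def poly_monom)
qed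

lemma trace_fibre_le: "card {x. x + cj x = t} \<le> q"
proof -
  have "degree (Polynomial.monom (1::'a) q + (Polynomial.monom 1 1 - [:t:])) = q"
  proof (subst degree_add_eq_left)
    have "degree (Polynomial.monom 1 1 - [:t:]) \<le> 1" by (rule degree_diff_le) (auto simp: degree_monom_le)
    then show "degree (Polynomial.monom 1 1 - [:t:]) < degree (Polynomial.monom (1::'a) q)" using q_ge_2 by (simp add: degree_monom_eq)
  qed (simp add: degree_monom_eq)
  from card_roots[OF this] q_ge_2 show ?thesis
    by (simp add: cj_def poly_monom algebra_simps)
qed

lemma norm_fibre_le: "card {x. x * cj x = t} \<le> q + 1"
proof -
  have "degree (Polynomial.monom (1::'a) (q + 1) - [:t:]) = q + 1"
    unfolding diff_conv_add_uminus by (subst degree_add_eq_left) (simp_all add: degree_monom_eq)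
  from card_roots[OF this] show ?thesis
    by (simp add: cj_def poly_monom algebra_simps)
qed

lemma trace_in_Fix: "x + cj x \<in> Fix" by (simp add: Fix_def cj_add add.commute)

lemma norm_in_Fix: "x * cj x \<in> Fix" by (simp add: Fix_def cj_mult mult.commute)

text \<open>The trace maps q*q elements into \<open>Fix\<close>. Its fibres and \<open>Fix\<close>
  itself are zero sets of polynomials of degree q, so each has at most q elements, and the total
  leaves no slack: \<open>card_fibres_tight\<close> turns both bounds into equalities.
  \<open>norm_fibre\<close> repeats this for the norm on the (q-1)(q+1) nonzero elements.\<close>

lemma card_Fix: "card Fix = q" and trace_fibre: "t \<in> Fix \<Longrightarrow> card {x. x + cj x = t} = q"
proof -
  have a: "finite (UNIV::'a set)" "finite Fix" "(\<lambda>x. x + cj x) ` UNIV \<subseteq> Fix" "card (UNIV::'a set) = q * q" "q > 0"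
    using trace_in_Fix card_F q_ge_2 by (auto simp: power2_eq_square)
  have b: "card {a \<in> UNIV. a + cj a = t} \<le> q" for t using trace_fibre_le by simp
  show "card Fix = q" by (rule card_fibres_tight(1)[OF a(1-3) b card_Fix_le a(4,5)])
  show "t \<in> Fix \<Longrightarrow> card {x. x + cj x = t} = q"
    using card_fibres_tight(2)[OF a(1-3) b card_Fix_le a(4,5)] by simp
qed

lemma trace_surj: "t \<in> Fix \<Longrightarrow> \<exists>x. x + cj x = t"
  using trace_fibre[of t] q_ge_2 by (metis (mono_tags, lifting) card.empty empty_Collect_eq not_numeral_le_zero)

lemma Fix_0 [simp]: "0 \<in> Fix" and Fix_1 [simp]: "1 \<in> Fix" by (auto simp: Fix_def)

lemma norm_fibre: 
  assumes "t \<in> Fix" "t \<noteq> 0" shows "card {x. x * cj x = t} = q + 1"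
proof -
  have c: "card (UNIV - {0::'a}) = (q - 1) * (q + 1)"
  proof -
    have "card (UNIV - {0::'a}) = q ^ 2 - 1" by (simp add: card_Diff_singleton card_F)
    also have "q ^ 2 - 1 = (q - 1) * (q + 1)" using q_ge_2
      by (cases q) (auto simp: power2_eq_square)
    finally show ?thesis .
  qed
  have a: "finite (UNIV - {0::'a})" "finite (Fix - {0})" "(\<lambda>x. x * cj x) ` (UNIV - {0}) \<subseteq> Fix - {0}" "q + 1 > 0"
    "card (Fix - {0}) \<le> q - 1"
    using norm_in_Fix by (auto simp: card_Fix)
  have b: "card {a \<in> UNIV - {0}. a * cj a = t} \<le> q + 1" for t
    by (rule order.trans[OF card_mono norm_fibre_le[of t]]) auto
  have "card {a \<in> UNIV - {0}. a * cj a = t} = q + 1"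
    using card_fibres_tight(2)[OF a(1-3) b a(5) c a(4)] assms by simp
  moreover have "{a \<in> UNIV - {0}. a * cj a = t} = {x. x * cj x = t}" using assms by auto
  ultimately show ?thesis by simp
qed

lemma norm_surj: "t \<in> Fix \<Longrightarrow> \<exists>x. x * cj x = t"
proof (cases "t = 0")
  case False assume "t \<in> Fix"
  from norm_fibre[OF this False] have "card {x. x * cj x = t} \<noteq> 0" by simp
  then show ?thesis by (metis (mono_tags, lifting) card.empty empty_Collect_eq)
qed (auto intro: exI[of _ 0])

lemma ex_not_Fix: "\<exists>\<theta>. cj \<theta> \<noteq> \<theta>"
proof (rule ccontr)
  assume "\<not> ?thesis" then have "Fix = UNIV" by (auto simp: Fix_def)
  then have "q = q ^ 2" using card_Fix card_F by simp
  then show False using q_ge_2 by (simp add: power2_eq_square)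
qed

lemma Fix_add: "x \<in> Fix \<Longrightarrow> y \<in> Fix \<Longrightarrow> x + y \<in> Fix"
  and Fix_mult: "x \<in> Fix \<Longrightarrow> y \<in> Fix \<Longrightarrow> x * y \<in> Fix"
  and Fix_diff: "x \<in> Fix \<Longrightarrow> y \<in> Fix \<Longrightarrow> x - y \<in> Fix"
  and Fix_inverse: "x \<in> Fix \<Longrightarrow> inverse x \<in> Fix"
  by (simp_all add: Fix_def cj_add cj_mult cj_diff cj_inverse)

text \<open>Used to combine two isotropic vectors with nonzero product into an anisotropic one.
  Working with the trace instead of halving covers characteristic 2.\<close>

lemma trace_nonzero:
  assumes "x \<noteq> 0" shows "\<exists>l. l * x + cj (l * x) \<noteq> 0"
proof -
  obtain y where "y + cj y = 1" using trace_surj[of 1] by auto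
  then show ?thesis using assms by (intro exI[of _ "y / x"]) simp
qed

end

section \<open>Hermitian forms\<close>

lemma mult_assoc_dim:
  fixes A B C :: "'b::semiring_0 mat"
  assumes "dim_col A = dim_row B" "dim_col B = dim_row C" shows "A * B * C = A * (B * C)"
  by (rule assoc_mult_mat[of _ "dim_row A" "dim_row B" _ "dim_row C" _ "dim_col C"]) (use assms in auto)

lemma mult_add_dim:
  fixes A B C :: "'b::semiring_0 mat"
  assumes "dim_col A = dim_row B" "dim_row B = dim_row C" "dim_col B = dim_col C" shows "A * (B + C) = A * B + A * C"
  by (rule mult_add_distrib_mat[of _ "dim_row A" "dim_row B" _ "dim_col C"]) (use assms in auto)

lemma add_mult_dim:
  fixes A B C :: "'b::semiring_0 mat"
  assumes "dim_row A = dim_row B" "dim_col A = dim_col B" "dim_col B = dim_row C" shows "(A + B) * C = A * C + B * C"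
  by (rule add_mult_distrib_mat[of _ "dim_row A" "dim_row C" _ _ "dim_col C"]) (use assms in auto)

lemma mult_minus_dim:
  fixes A B C :: "'b::ring mat"
  assumes "dim_col A = dim_row B" "dim_row B = dim_row C" "dim_col B = dim_col C" shows "A * (B - C) = A * B - A * C"
  by (rule mult_minus_distrib_mat[of _ "dim_row A" "dim_row B" _ "dim_col C"]) (use assms in auto)

lemma minus_mult_dim:
  fixes A B C :: "'b::ring mat"
  assumes "dim_row A = dim_row B" "dim_col A = dim_col B" "dim_col B = dim_row C" shows "(A - B) * C = A * C - B * C"
  by (rule minus_mult_distrib_mat[of _ "dim_row A" "dim_row C" _ _ "dim_col C"]) (use assms in auto)

lemma one_mult_dim: "n = dim_row A \<Longrightarrow> 1\<^sub>m n * (A::'b::semiring_1 mat) = A"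
  and mult_one_dim: "n = dim_col A \<Longrightarrow> A * 1\<^sub>m n = (A::'b::semiring_1 mat)"
  using left_mult_one_mat[of A "dim_row A" "dim_col A"] right_mult_one_mat[of A "dim_row A" "dim_col A"] by auto

lemma zero_mult_dim: "n = dim_row A \<Longrightarrow> 0\<^sub>m k n * (A::'b::semiring_0 mat) = 0\<^sub>m k (dim_col A)"
  and mult_zero_dim: "n = dim_col A \<Longrightarrow> A * 0\<^sub>m n k = (0\<^sub>m (dim_row A) k :: 'b mat)"
  by (auto intro!: eq_matI simp: scalar_prod_def)

lemma add_zero_dim: "k = dim_row A \<Longrightarrow> n = dim_col A \<Longrightarrow> A + 0\<^sub>m k n = (A::'b::monoid_add mat)"
  and zero_add_dim: "k = dim_row A \<Longrightarrow> n = dim_col A \<Longrightarrow> 0\<^sub>m k n + A = (A::'b::monoid_add mat)"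
  by (auto intro!: eq_matI)

lemma minus_zero_dim: "k = dim_row A \<Longrightarrow> n = dim_col A \<Longrightarrow> A - 0\<^sub>m k n = (A::'b::group_add mat)"
  by (auto intro!: eq_matI)

lemma smult_mult_dim:
  fixes A B :: "'b::comm_semiring_0 mat"
  assumes "dim_col A = dim_row B"
  shows "(c \<cdot>\<^sub>m A) * B = c \<cdot>\<^sub>m (A * B)"
  by (rule mult_smult_assoc_mat[of _ "dim_row A" "dim_col A" _ "dim_col B"]) (use assms in auto)

lemma mult_smult_dim:
  fixes A B :: "'b::comm_semiring_0 mat"
  assumes "dim_col A = dim_row B"
  shows "A * (c \<cdot>\<^sub>m B) = c \<cdot>\<^sub>m (A * B)"
  by (rule mult_smult_distrib[of _ "dim_row A" "dim_col A" _ "dim_col B"]) (use assms in auto)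

lemma mult_uminus_dim: "dim_col A = dim_row B \<Longrightarrow> A * (- B) = - (A * (B::'b::ring mat))"
  and uminus_mult_dim: "dim_col A = dim_row B \<Longrightarrow> (- A) * B = - (A * B)"
  by (auto intro!: eq_matI simp: scalar_prod_def sum_negf)

text \<open>The side conditions mention only \<open>dim_row\<close> and \<open>dim_col\<close> of
  the given matrices and leave no sizes to guess, so products can be multiplied out by
  rewriting.\<close>

lemmas mat_dist = mult_assoc_dim mult_add_dim add_mult_dim mult_minus_dim minus_mult_dim
  one_mult_dim mult_one_dim zero_mult_dim mult_zero_dim add_zero_dim zero_add_dim minus_zero_dim
  smult_mult_dim mult_smult_dim mult_uminus_dim uminus_mult_dim

lemma mat_1x1_eq_iff:
  assumes "dim_row A = 1" "dim_col A = 1" "dim_row B = 1" "dim_col B = 1"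
  shows "A = B \<longleftrightarrow> A $$ (0,0) = B $$ (0,0)"
  using assms by (auto intro!: eq_matI)

lemma mat_1x1_smult: "dim_row A = 1 \<Longrightarrow> dim_col A = 1 \<Longrightarrow> A = (A $$ (0,0) :: 'b::semiring_1) \<cdot>\<^sub>m 1\<^sub>m 1"
  by (auto intro!: eq_matI)

lemma card_carrier_mat:
  "finite (carrier_mat n m :: 'b::finite mat set) \<and> card (carrier_mat n m :: 'b mat set) = card (UNIV :: 'b set) ^ (n * m)"
proof -
  let ?X = "({..<n} \<times> {..<m}) \<rightarrow>\<^sub>E (UNIV :: 'b set)"
  have b: "bij_betw (\<lambda>f. mat n m f) ?X (carrier_mat n m)"
  proof (rule bij_betwI[where g = "\<lambda>A. restrict (\<lambda>ij. A $$ ij) ({..<n} \<times> {..<m})"])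
    fix f :: "nat \<times> nat \<Rightarrow> 'b" assume "f \<in> ?X"
    then show "restrict (\<lambda>ij. mat n m f $$ ij) ({..<n} \<times> {..<m}) = f"
      by (intro ext) (auto simp: PiE_def extensional_def restrict_def; metis)
  qed (auto intro!: eq_matI)
  have "finite ?X" by (rule finite_PiE) auto
  moreover have "card ?X = card (UNIV :: 'b set) ^ (n * m)" by (subst card_PiE) auto
  ultimately show ?thesis using bij_betw_finite[OF b] bij_betw_same_card[OF b] by auto
qed

lemma inverse_mat_commute:
  fixes A :: "'b::field mat"
  assumes "A \<in> carrier_mat n n" "B \<in> carrier_mat n n" "A * B = 1\<^sub>m n" shows "B * A = 1\<^sub>m n"
  using mat_mult_left_right_inverse[OF assms] .

definition hcat :: "'b mat \<Rightarrow> 'b mat \<Rightarrow> 'b mat" where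
  "hcat A B = mat (dim_row A) (dim_col A + dim_col B)
     (\<lambda>(i,j). if j < dim_col A then A $$ (i,j) else B $$ (i, j - dim_col A))"

lemma dim_hcat [simp]: "dim_row (hcat A B) = dim_row A" "dim_col (hcat A B) = dim_col A + dim_col B"
  by (auto simp: hcat_def)

lemma mult_hcat:
  fixes X :: "'b::semiring_0 mat"
  assumes "dim_col X = dim_row A" "dim_row A = dim_row B"
  shows "X * hcat A B = hcat (X * A) (X * B)"
  using assms by (intro eq_matI) (auto simp: hcat_def scalar_prod_def)

section \<open>Adjoints, hermitian products and Gram-Schmidt\<close>

context quadratic_extension begin

text \<open>The adjoint A^* for matrices of every shape. Column vectors are n by 1 matrices
  throughout, so hermitian products and Gram matrices arise from the same operation.\<close>

definition st :: "'a mat \<Rightarrow> 'a mat" where "st A = transpose_mat (map_mat cj A)"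

lemma dim_st [simp]: "dim_row (st A) = dim_col A" "dim_col (st A) = dim_row A"
  by (auto simp: st_def)

lemma st_carrier [simp]: "st A \<in> carrier_mat n m \<longleftrightarrow> A \<in> carrier_mat m n"
  using dim_st by (metis carrier_matD carrier_matI)

lemma st_index: "i < dim_col A \<Longrightarrow> j < dim_row A \<Longrightarrow> st A $$ (i,j) = cj (A $$ (j,i))"
  by (simp add: st_def)

lemma st_st [simp]: "st (st A) = A"
  by (intro eq_matI) (auto simp: st_index)

lemma st_mult: "dim_col A = dim_row B \<Longrightarrow> st (A * B) = st B * st A"
  by (intro eq_matI) (auto simp: st_index scalar_prod_def cj_sum cj_mult mult.commute)

lemma st_add: "dim_row A = dim_row B \<Longrightarrow> dim_col A = dim_col B \<Longrightarrow> st (A + B) = st A + st B"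
  by (intro eq_matI) (auto simp: st_index cj_add)

lemma st_minus: "dim_row A = dim_row B \<Longrightarrow> dim_col A = dim_col B \<Longrightarrow> st (A - B) = st A - st B"
  by (intro eq_matI) (auto simp: st_index cj_diff)

lemma st_uminus: "st (- A) = - st A"
  by (intro eq_matI) (auto simp: st_index cj_minus)

lemma st_smult: "st (c \<cdot>\<^sub>m A) = cj c \<cdot>\<^sub>m st A"
  by (intro eq_matI) (auto simp: st_index cj_mult)

lemma st_one [simp]: "st (1\<^sub>m n) = 1\<^sub>m n"
  by (intro eq_matI) (auto simp: st_index)

lemma st_zero [simp]: "st (0\<^sub>m n m) = 0\<^sub>m m n"
  by (intro eq_matI) (auto simp: st_index)

lemma st_four_block:
  assumes "A \<in> carrier_mat n n" "B \<in> carrier_mat n m" "C \<in> carrier_mat m n" "D \<in> carrier_mat m m"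
  shows "st (four_block_mat A B C D) = four_block_mat (st A) (st C) (st B) (st D)"
  using assms by (intro eq_matI) (auto simp: st_index)

lemma st_hcat_mult:
  assumes "dim_row A = dim_row C" "dim_row B = dim_row A" "dim_row D = dim_row A"
  shows "st (hcat A B) * hcat C D = four_block_mat (st A * C) (st A * D) (st B * C) (st B * D)"
  using assms by (intro eq_matI) (auto simp: hcat_def scalar_prod_def st_index)

definition hf :: "'a mat \<Rightarrow> 'a mat \<Rightarrow> 'a mat \<Rightarrow> 'a" where
  "hf H v w = (st v * (H * w)) $$ (0,0)"

lemma hf_cj:
  assumes "st H = H" "H \<in> carrier_mat n n" "v \<in> carrier_mat n 1" "w \<in> carrier_mat n 1"
  shows "cj (hf H v w) = hf H w v"
proof -
  have [simp]: "dim_row H = n" "dim_col H = n" "dim_row v = n" "dim_row w = n" "dim_col v = 1" "dim_col w = 1" using assms by auto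
  have "st (st v * (H * w)) = st w * (H * v)" using assms(1) by (simp add: st_mult mat_dist)
  then show ?thesis unfolding hf_def
    using st_index[of 0 "st v * (H * w)" 0] by (simp del: index_mult_mat(1))
qed

text \<open>There is a nonzero y orthogonal to W, and a z' orthogonal to W whose product with y is
  nonzero. One of y, z' and a combination y + l z' is anisotropic, and it can be scaled to norm 1
  because norms fill \<open>Fix\<close>.\<close>

lemma gram_schmidt_step:
  assumes H: "H \<in> carrier_mat n n" "st H = H" "Hi \<in> carrier_mat n n" "H * Hi = 1\<^sub>m n"
    and W: "W \<in> carrier_mat n j" and G: "Gi \<in> carrier_mat j j" "st W * (H * W) * Gi = 1\<^sub>m j" and j: "j < n"
  shows "\<exists>y \<in> carrier_mat n 1. st W * (H * y) = 0\<^sub>m j 1 \<and> st y * (H * y) = 1\<^sub>m 1"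
proof -
  have [simp]: "dim_row H = n" "dim_col H = n" "dim_row Hi = n" "dim_col Hi = n" "dim_row W = n" "dim_col W = j"
    "dim_row Gi = j" "dim_col Gi = j" using H W G by auto
  let ?f = "\<lambda>y. st W * (H * y)"
  have fin: "finite (carrier_mat a b :: 'a mat set)" for a b using card_carrier_mat by blast
  \<comment> \<open>A map from n to j < n coordinates cannot be injective; the difference of two
    vectors with equal images is orthogonal to W.\<close>
  have "\<not> inj_on ?f (carrier_mat n 1)"
  proof
    assume "inj_on ?f (carrier_mat n 1)"
    then have "card (carrier_mat n 1 :: 'a mat set) \<le> card (carrier_mat j 1 :: 'a mat set)"
      by (rule card_inj_on_le) (auto simp: fin)
    moreover have "card (UNIV :: 'a set) > 1" using q_ge_2 one_less_power[of q 2] by (simp add: card_F)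
    ultimately have "n \<le> j" by (simp add: card_carrier_mat)
    then show False using j by simp
  qed
  then obtain y1 y2 where y12: "y1 \<in> carrier_mat n 1" "y2 \<in> carrier_mat n 1" "?f y1 = ?f y2" "y1 \<noteq> y2"
    by (auto simp: inj_on_def)
  define y where "y = y1 - y2"
  have [simp]: "dim_row y1 = n" "dim_col y1 = 1" "dim_row y2 = n" "dim_col y2 = 1" using y12 by auto
  have [simp]: "dim_row y = n" "dim_col y = 1" by (simp_all add: y_def)
  have fy: "?f y = 0\<^sub>m j 1"
  proof -
    have "?f y = ?f y1 - ?f y2" unfolding y_def by (simp add: mat_dist)
    also have "\<dots> = 0\<^sub>m j 1" unfolding y12(3) by (intro eq_matI) auto
    finally show ?thesis .
  qed
  have "\<exists>i<n. y $$ (i,0) \<noteq> 0"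
  proof (rule ccontr)
    assume "\<not> ?thesis"
    then have "y1 = y2" by (intro eq_matI) (auto simp: y_def)
    then show False using y12 by simp
  qed
  then obtain i where i: "i < n" "y $$ (i,0) \<noteq> 0" by auto
  \<comment> \<open>The i-th coordinate of y is nonzero, so a z with H z = e has nonzero product
    with y.\<close>
  define e :: "'a mat" where "e = mat n 1 (\<lambda>(l,_). if l = i then 1 else 0)"
  have [simp]: "dim_row e = n" "dim_col e = 1" by (simp_all add: e_def)
  have ye: "(st y * e) $$ (0,0) = cj (y $$ (i,0))"
    using i by (simp add: scalar_prod_def e_def st_index if_distrib[of "\<lambda>x. _ * x"] cong: if_cong)
  define z where "z = Hi * e"
  have [simp]: "dim_row z = n" "dim_col z = 1" by (simp_all add: z_def)
  have Hz: "H * z = e" unfolding z_def using H(4) by (simp flip: mult_assoc_dim add: one_mult_dim)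
  \<comment> \<open>This is z minus its orthogonal projection to the span of W, \<open>Gi\<close>
    being the inverse Gram matrix. As y is orthogonal to W, the product with y is unchanged.\<close>
  define z' where "z' = z - W * (Gi * ?f z)"
  have [simp]: "dim_row z' = n" "dim_col z' = 1" by (simp_all add: z'_def)
  have "?f z' = ?f z - st W * (H * W) * Gi * ?f z" unfolding z'_def by (simp add: mat_dist)
  also have "\<dots> = 0\<^sub>m j 1" unfolding G(2) by (intro eq_matI) (auto simp: mat_dist one_mult_dim[of k "1\<^sub>m k"] zero_add_dim[of k "1\<^sub>m k"])
  finally have fz': "?f z' = 0\<^sub>m j 1" .
  have yW: "st y * (H * W) = 0\<^sub>m 1 j"
    using arg_cong[OF fy, of st] H(2) by (simp add: st_mult mat_dist)
  have "st y * (H * z') = st y * e - st y * (H * W) * (Gi * ?f z)" unfolding z'_def Hz[symmetric] by (simp add: mat_dist)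
  then have "st y * (H * z') = st y * e" unfolding yW by (simp add: mat_dist)
  then have h: "hf H y z' \<noteq> 0" unfolding hf_def using ye i by simp
  have yc: "y \<in> carrier_mat n 1" "z' \<in> carrier_mat n 1" by (auto simp: carrier_matI)
  have "\<exists>x \<in> carrier_mat n 1. ?f x = 0\<^sub>m j 1 \<and> hf H x x \<noteq> 0"
  proof (cases "hf H y y = 0 \<and> hf H z' z' = 0")
    case False
    then show ?thesis using fy fz' yc by blast
  next
    case True
    \<comment> \<open>When both norms are 0, the norm of y + l z' is the trace of l times the
      product of y and z'.\<close>
    obtain l where l: "l * hf H y z' + cj (l * hf H y z') \<noteq> 0" using trace_nonzero[OF h] by blast
    let ?x = "y + l \<cdot>\<^sub>m z'"
    have "st ?x * (H * ?x) = (st y * (H * y) + l \<cdot>\<^sub>m (st y * (H * z'))) + ((cj l \<cdot>\<^sub>m (st z' * (H * y))) + (l * cj l) \<cdot>\<^sub>m (st z' * (H * z')))"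
      by (simp add: mat_dist st_add st_smult add_smult_distrib_left_mat) (intro eq_matI, auto simp: algebra_simps)
    then have "hf H ?x ?x = (hf H y y + l * hf H y z') + (cj l * hf H z' y + l * cj l * hf H z' z')"
      by (simp add: hf_def)
    also have "hf H z' y = cj (hf H y z')" using hf_cj[OF H(2,1), of y z'] by (simp add: carrier_matI)
    finally have "hf H ?x ?x \<noteq> 0" using l True by (simp add: cj_mult)
    moreover have "?f ?x = 0\<^sub>m j 1" using fy fz' by (simp add: mat_dist)
    moreover have "?x \<in> carrier_mat n 1" using yc by simp
    ultimately show ?thesis by blast
  qed
  then obtain x where x: "x \<in> carrier_mat n 1" "?f x = 0\<^sub>m j 1" "hf H x x \<noteq> 0" by auto
  have "hf H x x \<in> Fix" using hf_cj[OF H(2,1) x(1) x(1)] by (simp add: Fix_def)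
  then obtain m where m: "m * cj m = inverse (hf H x x)" using norm_surj Fix_inverse by metis
  have [simp]: "dim_row x = n" "dim_col x = 1" using x by auto
  have "st (m \<cdot>\<^sub>m x) * (H * (m \<cdot>\<^sub>m x)) = (m * cj m) \<cdot>\<^sub>m (st x * (H * x))"
    by (simp add: mat_dist st_smult) (intro eq_matI, auto simp: algebra_simps)
  also have "\<dots> = 1\<^sub>m 1" unfolding m using x(3) by (intro eq_matI) (auto simp: hf_def)
  finally have "st (m \<cdot>\<^sub>m x) * (H * (m \<cdot>\<^sub>m x)) = 1\<^sub>m 1" .
  moreover have "?f (m \<cdot>\<^sub>m x) = m \<cdot>\<^sub>m ?f x" by (simp add: mat_dist)
  then have "?f (m \<cdot>\<^sub>m x) = 0\<^sub>m j 1" unfolding x(2) by (intro eq_matI) auto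
  moreover have "m \<cdot>\<^sub>m x \<in> carrier_mat n 1" using x(1) by simp
  ultimately show ?thesis by (intro bexI[of _ "m \<cdot>\<^sub>m x"] conjI)
qed

lemma four_block_inverse:
  fixes A Ai :: "'a mat"
  assumes A: "A \<in> carrier_mat n n" and Ai: "Ai \<in> carrier_mat n n" and e: "A * Ai = 1\<^sub>m n"
  shows "four_block_mat A (0\<^sub>m n k) (0\<^sub>m k n) (1\<^sub>m k) * four_block_mat Ai (0\<^sub>m n k) (0\<^sub>m k n) (1\<^sub>m k) = 1\<^sub>m (n + k)"
proof -
  have [simp]: "dim_row A = n" "dim_col A = n" "dim_row Ai = n" "dim_col Ai = n" using A Ai by auto
  have "A * Ai + 0\<^sub>m n k * 0\<^sub>m k n = 1\<^sub>m n" "A * 0\<^sub>m n k + 0\<^sub>m n k * 1\<^sub>m k = 0\<^sub>m n k"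
    "0\<^sub>m k n * Ai + 1\<^sub>m k * 0\<^sub>m k n = 0\<^sub>m k n" "0\<^sub>m k n * 0\<^sub>m n k + 1\<^sub>m k * 1\<^sub>m k = (1\<^sub>m k :: 'a mat)"
    unfolding e by (simp_all only: mult_zero_dim zero_mult_dim one_mult_dim mult_one_dim zero_add_dim add_zero_dim
      index_zero_mat index_one_mat \<open>dim_row A = n\<close> \<open>dim_col A = n\<close> \<open>dim_row Ai = n\<close> \<open>dim_col Ai = n\<close>)
  then show ?thesis
    by (simp only: mult_four_block_mat[OF A zero_carrier_mat zero_carrier_mat one_carrier_mat Ai zero_carrier_mat zero_carrier_mat one_carrier_mat] four_block_one_mat)
qed

text \<open>The columns of W keep an arbitrary invertible Gram matrix because W will consist of
  Krylov vectors; only the added columns Y are orthonormal. Each step appends one vector to W, and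
  the Gram matrix grows by a diagonal entry 1.\<close>

lemma gram_schmidt:
  assumes H: "H \<in> carrier_mat n n" "st H = H" "Hi \<in> carrier_mat n n" "H * Hi = 1\<^sub>m n"
  shows "W \<in> carrier_mat n j \<Longrightarrow> Gi \<in> carrier_mat j j \<Longrightarrow> st W * (H * W) * Gi = 1\<^sub>m j \<Longrightarrow> j + k = n \<Longrightarrow>
   \<exists>Y \<in> carrier_mat n k. st W * (H * Y) = 0\<^sub>m j k \<and> st Y * (H * Y) = 1\<^sub>m k"
proof (induction k arbitrary: j W Gi)
  case 0
  have [simp]: "dim_row W = n" "dim_col W = j" using carrier_matD[OF "0.prems"(1)] by auto
  show ?case by (intro bexI[of _ "0\<^sub>m n 0"] conjI eq_matI) simp_all
next
  case (Suc k)
  obtain y where y: "y \<in> carrier_mat n 1" "st W * (H * y) = 0\<^sub>m j 1" "st y * (H * y) = 1\<^sub>m 1"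
    using gram_schmidt_step[OF H Suc.prems(1-3)] Suc.prems by auto
  have [simp]: "dim_row H = n" "dim_col H = n" "dim_row W = n" "dim_col W = j"
    "dim_row Gi = j" "dim_col Gi = j" "dim_row y = n" "dim_col y = 1"
    by (rule carrier_matD[OF H(1)] carrier_matD[OF Suc.prems(1)] carrier_matD[OF Suc.prems(2)] carrier_matD[OF y(1)])+
  have yW: "st y * (H * W) = 0\<^sub>m 1 j"
    using arg_cong[OF y(2), of st] H(2) by (simp add: st_mult mat_dist)
  let ?W = "hcat W y" and ?G = "four_block_mat Gi (0\<^sub>m j 1) (0\<^sub>m 1 j) (1\<^sub>m 1)"
  have g: "st ?W * (H * ?W) = four_block_mat (st W * (H * W)) (0\<^sub>m j 1) (0\<^sub>m 1 j) (1\<^sub>m 1)"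
    using y yW by (simp add: mult_hcat[of H W y] st_hcat_mult)
  have "st ?W * (H * ?W) * ?G = 1\<^sub>m (j + 1)"
    unfolding g by (rule four_block_inverse[OF _ Suc.prems(2,3)]) (simp add: carrier_matI)
  moreover have "?W \<in> carrier_mat n (j+1)" "?G \<in> carrier_mat (j+1) (j+1)" by (simp_all add: carrier_matI)
  moreover have "j + 1 + k = n" using Suc.prems(4) by simp
  ultimately obtain Y where Y: "Y \<in> carrier_mat n k" "st ?W * (H * Y) = 0\<^sub>m (j+1) k" "st Y * (H * Y) = 1\<^sub>m k"
    using Suc.IH[of ?W "j+1" ?G] by blast
  have [simp]: "dim_row Y = n" "dim_col Y = k" using carrier_matD[OF Y(1)] by auto
  have idx: "(st ?W * (H * Y)) $$ (a,b) = 0" if "a < j + 1" "b < k" for a b using Y(2) that by simp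
  have WY: "st W * (H * Y) = 0\<^sub>m j k"
  proof (intro eq_matI)
    fix a b assume "a < dim_row (0\<^sub>m j k :: 'a mat)" "b < dim_col (0\<^sub>m j k :: 'a mat)"
    then have ab: "a < j" "b < k" by auto
    have "(st ?W * (H * Y)) $$ (a,b) = (st W * (H * Y)) $$ (a,b)"
      using ab by (simp add: scalar_prod_def st_index hcat_def)
    with idx[of a b] show "(st W * (H * Y)) $$ (a,b) = 0\<^sub>m j k $$ (a,b)" using ab by simp
  qed auto
  have yY: "st y * (H * Y) = 0\<^sub>m 1 k"
  proof (intro eq_matI)
    fix a b assume "a < dim_row (0\<^sub>m 1 k :: 'a mat)" "b < dim_col (0\<^sub>m 1 k :: 'a mat)"
    then have ab: "a = 0" "b < k" by auto
    have "(st ?W * (H * Y)) $$ (j,b) = (st y * (H * Y)) $$ (0,b)"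
      using ab by (simp add: scalar_prod_def st_index hcat_def)
    then show "(st y * (H * Y)) $$ (a,b) = 0\<^sub>m 1 k $$ (a,b)" using idx[of j b] ab by simp
  qed auto
  have Yy: "st Y * (H * y) = 0\<^sub>m k 1"
    using arg_cong[OF yY, of st] H(2) by (simp add: st_mult mat_dist)
  have "st W * (H * hcat y Y) = 0\<^sub>m j (Suc k)"
    using y(2) WY by (simp add: mult_hcat[of H] mult_hcat[of "st W"]) (auto intro!: eq_matI simp: hcat_def)
  moreover have "st (hcat y Y) * (H * hcat y Y) = 1\<^sub>m (Suc k)"
    using y yY Yy Y by (simp add: mult_hcat[of H y Y] st_hcat_mult)
  moreover have "hcat y Y \<in> carrier_mat n (Suc k)" by (simp add: carrier_matI)
  ultimately show ?case by (intro bexI[of _ "hcat y Y"] conjI)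
qed

end

section \<open>Pairs with a nondegenerate Gram matrix\<close>

lemma pow_mat_dims [simp]:
  "dim_col A = dim_row A \<Longrightarrow> dim_row (A ^\<^sub>m j) = dim_row A"
  "dim_col A = dim_row A \<Longrightarrow> dim_col (A ^\<^sub>m j) = dim_row A"
  using pow_carrier_mat[of A "dim_row A" j] by (metis carrier_matD carrier_matI)+

lemma pow_mat_Suc_left:
  fixes A :: "'b::semiring_1 mat"
  assumes "dim_col A = dim_row A"
  shows "A ^\<^sub>m Suc j = A * A ^\<^sub>m j"
proof (induction j)
  case 0
  show ?case using assms by (simp add: one_mult_dim mult_one_dim)
next
  case (Suc j)
  have "A ^\<^sub>m Suc (Suc j) = (A * A ^\<^sub>m j) * A" using Suc by simp
  then show ?case using assms by (simp add: mult_assoc_dim)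
qed

lemma pow_mat_add_dim:
  fixes A :: "'b::semiring_1 mat"
  assumes "dim_col A = dim_row A"
  shows "A ^\<^sub>m (i + j) = A ^\<^sub>m i * A ^\<^sub>m j"
proof (induction i)
  case 0
  show ?case using assms by (simp add: one_mult_dim)
next
  case (Suc i)
  have "A ^\<^sub>m (Suc i + j) = A * A ^\<^sub>m (i + j)" using pow_mat_Suc_left[OF assms, of "i + j"] by simp
  also have "\<dots> = A ^\<^sub>m Suc i * A ^\<^sub>m j"
    unfolding Suc using assms by (simp add: mult_assoc_dim pow_mat_Suc_left[OF assms, of i] del: pow_mat.simps)
  finally show ?case .
qed

lemma pow_mat_conj:
  fixes M P Pi :: "'b::semiring_1 mat"
  assumes "M \<in> carrier_mat n n" "P \<in> carrier_mat n n" "Pi \<in> carrier_mat n n" "P * Pi = 1\<^sub>m n" "Pi * P = 1\<^sub>m n"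
  shows "(Pi * (M * P)) ^\<^sub>m j = Pi * (M ^\<^sub>m j * P)"
proof (induction j)
  case 0
  show ?case using assms by (simp add: one_mult_dim)
next
  case (Suc j)
  have [simp]: "dim_row M = n" "dim_col M = n" "dim_row P = n" "dim_col P = n" "dim_row Pi = n" "dim_col Pi = n"
    using assms by auto
  have "(Pi * (M * P)) ^\<^sub>m Suc j = Pi * (M ^\<^sub>m j * ((P * Pi) * (M * P)))"
    by (simp add: Suc mult_assoc_dim)
  then show ?case by (simp add: assms one_mult_dim mult_assoc_dim)
qed

text \<open>The Krylov matrix with columns v, M v, ..., M^(m-1) v.\<close>

definition frame :: "'b::semiring_1 mat \<Rightarrow> 'b mat \<Rightarrow> nat \<Rightarrow> 'b mat" where
  "frame M v m = mat (dim_row v) m (\<lambda>(i,j). (M ^\<^sub>m j * v) $$ (i,0))"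

lemma dim_frame [simp]: "dim_row (frame M v m) = dim_row v" "dim_col (frame M v m) = m"
  by (auto simp: frame_def)

definition first_cols :: "nat \<Rightarrow> nat \<Rightarrow> 'b::semiring_1 mat" where
  "first_cols n m = mat n m (\<lambda>(i,j). if i = j then 1 else 0)"

lemma dim_first_cols [simp]: "dim_row (first_cols n m) = n" "dim_col (first_cols n m) = m"
  by (auto simp: first_cols_def)

lemma mult_first_cols_index:
  assumes "i < dim_row P" "j < m" "m \<le> dim_col P"
  shows "(P * first_cols (dim_col P) m) $$ (i,j) = P $$ (i,j)"
  using assms by (simp add: scalar_prod_def first_cols_def if_distrib[of "\<lambda>x. _ * x"] cong: if_cong)

lemma mult_index_1: "i < dim_row A \<Longrightarrow> j < dim_col B \<Longrightarrow> (A * B) $$ (i,j) = (\<Sum>l<dim_row B. A $$ (i,l) * B $$ (l,j))"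
  if "dim_col A = dim_row B"
  using that by (simp add: scalar_prod_def atLeast0LessThan)

lemma mult_frame:
  fixes M P Pi :: "'b::semiring_1 mat"
  assumes "M \<in> carrier_mat n n" "P \<in> carrier_mat n n" "Pi \<in> carrier_mat n n" "P * Pi = 1\<^sub>m n" "Pi * P = 1\<^sub>m n"
    "v \<in> carrier_mat n 1"
  shows "Pi * frame M v m = frame (Pi * (M * P)) (Pi * v) m"
proof (intro eq_matI)
  have [simp]: "dim_row M = n" "dim_col M = n" "dim_row P = n" "dim_col P = n" "dim_row Pi = n" "dim_col Pi = n"
    "dim_row v = n" "dim_col v = 1" using assms by auto
  fix i j assume "i < dim_row (frame (Pi * (M * P)) (Pi * v) m)" "j < dim_col (frame (Pi * (M * P)) (Pi * v) m)"
  then have ij: "i < n" "j < m" by auto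
  have "(Pi * (M * P)) ^\<^sub>m j * (Pi * v) = Pi * (M ^\<^sub>m j * ((P * Pi) * v))"
    unfolding pow_mat_conj[OF assms(1-5)] by (simp add: mult_assoc_dim)
  then have "(Pi * (M * P)) ^\<^sub>m j * (Pi * v) = Pi * (M ^\<^sub>m j * v)" by (simp add: assms one_mult_dim)
  moreover have "(Pi * frame M v m) $$ (i,j) = (Pi * (M ^\<^sub>m j * v)) $$ (i,0)"
    using ij by (simp add: mult_index_1 frame_def del: index_mult_mat(1))
  ultimately show "(Pi * frame M v m) $$ (i,j) = frame (Pi * (M * P)) (Pi * v) m $$ (i,j)"
    using ij by (simp add: frame_def del: index_mult_mat(1))
qed (use carrier_matD[OF assms(3)] carrier_matD[OF assms(6)] in simp_all)

context quadratic_extension begin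

definition UH :: "'a mat \<Rightarrow> nat \<Rightarrow> 'a mat set" where
  "UH H n = {M \<in> carrier_mat n n. st M * (H * M) = H}"

abbreviation U :: "nat \<Rightarrow> 'a mat set" where "U n \<equiv> UH (1\<^sub>m n) n"

lemma U_iff: "M \<in> U n \<longleftrightarrow> M \<in> carrier_mat n n \<and> st M * M = 1\<^sub>m n"
  by (auto simp: UH_def one_mult_dim)

text \<open>A one-sided inverse of a square matrix is two-sided, so the conditions with the adjoint
  on the left and on the right agree.\<close>

lemma U_eq_unitary_group: "U n = unitary_group n q"
proof -
  have "st M = transpose_mat (map_mat (\<lambda>x. x ^ q) M)" for M
    by (simp add: st_def cj_def[abs_def])
  then show ?thesis unfolding unitary_group_def U_iff[abs_def] set_eq_iff mem_Collect_eq
    by (metis U_iff inverse_mat_commute st_carrier)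
qed

lemma finite_UH: "finite (UH H n)"
  by (rule finite_subset[of _ "carrier_mat n n"]) (auto simp: UH_def card_carrier_mat)

lemma U_I: "dim_row M = n \<Longrightarrow> dim_col M = n \<Longrightarrow> st M * M = 1\<^sub>m n \<Longrightarrow> M \<in> U n"
  and U_D: "M \<in> U n \<Longrightarrow> dim_row M = n" "M \<in> U n \<Longrightarrow> dim_col M = n" "M \<in> U n \<Longrightarrow> st M * M = 1\<^sub>m n"
  unfolding U_iff carrier_mat_def by simp_all

lemma UH_I: "dim_row M = n \<Longrightarrow> dim_col M = n \<Longrightarrow> st M * (H * M) = H \<Longrightarrow> M \<in> UH H n"
  and UH_D: "M \<in> UH H n \<Longrightarrow> dim_row M = n" "M \<in> UH H n \<Longrightarrow> dim_col M = n" "M \<in> UH H n \<Longrightarrow> st M * (H * M) = H"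
  unfolding UH_def carrier_mat_def by simp_all

lemma one_in_U: "1\<^sub>m n \<in> U n" by (simp add: U_iff one_mult_dim)

lemma card_U_pos: "card (U n) > 0"
  using one_in_U finite_UH card_gt_0_iff by blast

text \<open>An isometry cancels from both arguments, so the product depends only on j - i; negative
  differences come from the hermitian symmetry of the form and of c.\<close>

lemma hf_pow:
  assumes M: "M \<in> UH H n" and H: "H \<in> carrier_mat n n" "st H = H" and v: "v \<in> carrier_mat n 1"
    and c: "\<And>j. hf H v (M ^\<^sub>m j * v) = c (int j)" and herm: "\<And>k. c (- k) = cj (c k)"
  shows "hf H (M ^\<^sub>m i * v) (M ^\<^sub>m j * v) = c (int j - int i)"
proof -
  have [simp]: "dim_row M = n" "dim_col M = n" "dim_row H = n" "dim_col H = n" "dim_row v = n" "dim_col v = 1"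
    using M H v by (auto simp: UH_def)
  have iso: "st (M ^\<^sub>m l) * (H * M ^\<^sub>m l) = H" for l
  proof (induction l)
    case 0
    show ?case by (simp add: one_mult_dim mult_one_dim)
  next
    case (Suc l)
    have "st (M ^\<^sub>m Suc l) * (H * M ^\<^sub>m Suc l) = st M * ((st (M ^\<^sub>m l) * (H * M ^\<^sub>m l)) * M)"
      by (simp add: st_mult mult_assoc_dim)
    then show ?case unfolding Suc using M by (simp add: UH_def)
  qed
  have key: "hf H (M ^\<^sub>m a * v) (M ^\<^sub>m (a + b) * v) = c (int b)" for a b
  proof -
    have "st (M ^\<^sub>m a * v) * (H * (M ^\<^sub>m (a + b) * v)) = st v * ((st (M ^\<^sub>m a) * (H * M ^\<^sub>m a)) * (M ^\<^sub>m b * v))"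
      by (simp add: st_mult mult_assoc_dim pow_mat_add_dim)
    then show ?thesis using c[of b] unfolding iso hf_def by simp
  qed
  show ?thesis
  proof (cases "i \<le> j")
    case True
    then show ?thesis using key[of i "j - i"] by (simp add: of_nat_diff)
  next
    case False
    have "hf H (M ^\<^sub>m i * v) (M ^\<^sub>m j * v) = cj (hf H (M ^\<^sub>m j * v) (M ^\<^sub>m i * v))"
      by (rule hf_cj[symmetric, OF H(2,1)]) (simp_all add: carrier_matI)
    also have "\<dots> = c (int j - int i)" using key[of j "i - j"] False herm[of "int i - int j"] by (simp add: of_nat_diff)
    finally show ?thesis .
  qed
qed

definition toeplitz :: "(int \<Rightarrow> 'a) \<Rightarrow> nat \<Rightarrow> 'a mat" where
  "toeplitz c m = mat m m (\<lambda>(i,j). c (int j - int i))"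

lemma dim_toeplitz [simp]: "dim_row (toeplitz c m) = m" "dim_col (toeplitz c m) = m"
  by (auto simp: toeplitz_def)

lemma frame_gram:
  assumes M: "M \<in> UH H n" and H: "H \<in> carrier_mat n n" "st H = H" and v: "v \<in> carrier_mat n 1"
    and c: "\<And>j. hf H v (M ^\<^sub>m j * v) = c (int j)" and herm: "\<And>k. c (- k) = cj (c k)"
  shows "st (frame M v m) * (H * frame M v m) = toeplitz c m"
proof (intro eq_matI)
  have [simp]: "dim_row M = n" "dim_col M = n" "dim_row H = n" "dim_col H = n" "dim_row v = n" "dim_col v = 1"
    using M H v by (auto simp: UH_def)
  fix i j assume "i < dim_row (toeplitz c m)" "j < dim_col (toeplitz c m)"
  then have ij: "i < m" "j < m" by auto
  have "(st (frame M v m) * (H * frame M v m)) $$ (i,j) = hf H (M ^\<^sub>m i * v) (M ^\<^sub>m j * v)"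
    using ij unfolding hf_def
    by (simp add: mult_index_1 frame_def st_index del: index_mult_mat(1))
  then show "(st (frame M v m) * (H * frame M v m)) $$ (i,j) = toeplitz c m $$ (i,j)"
    using hf_pow[OF assms] ij by (simp add: toeplitz_def)
qed simp_all

text \<open>Only moments of nonnegative index are prescribed; for a hermitian c the others are their
  conjugates.\<close>

definition moment_pairs :: "(int \<Rightarrow> 'a) \<Rightarrow> nat \<Rightarrow> 'a poly \<Rightarrow> ('a mat \<times> 'a mat) set" where
  "moment_pairs c n f = {(M,v). M \<in> U n \<and> v \<in> carrier_mat n 1 \<and> (\<forall>j. hf (1\<^sub>m n) v (M ^\<^sub>m j * v) = c (int j)) \<and> char_poly M = f}"

text \<open>These are the matrices of M in a basis that begins with the Krylov vectors of v: v
  becomes the first basis vector, and the condition on \<open>frame\<close> says that each of the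
  first m - 1 basis vectors is mapped to the next one.\<close>

definition normal_forms :: "'a mat \<Rightarrow> (int \<Rightarrow> 'a) \<Rightarrow> nat \<Rightarrow> nat \<Rightarrow> 'a poly \<Rightarrow> 'a mat set" where
  "normal_forms H c m n f = {M \<in> UH H n. (\<forall>j. hf H (first_cols n 1) (M ^\<^sub>m j * first_cols n 1) = c (int j)) \<and>
     frame M (first_cols n 1) m = first_cols n m \<and> char_poly M = f}"

lemma finite_moment_pairs: "finite (moment_pairs c n f)"
  by (rule finite_subset[of _ "carrier_mat n n \<times> carrier_mat n 1"]) (auto simp: moment_pairs_def UH_def card_carrier_mat)

end

section \<open>Double counting through bases adapted to a nondegenerate Krylov frame\<close>

locale gram_block = quadratic_extension q F for q :: nat and F :: "'a::{field,finite} itself" +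
  fixes c :: "int \<Rightarrow> 'a" and m k n :: nat and Ci :: "'a mat"
  assumes m_pos: "m > 0" and n_def: "n = m + k" and herm: "c (- i) = cj (c i)"
    and Ci: "Ci \<in> carrier_mat m m" "toeplitz c m * Ci = 1\<^sub>m m"
begin

abbreviation "C \<equiv> toeplitz c m"

text \<open>The standard form written in a basis made of m Krylov vectors and an orthonormal basis
  of their orthogonal complement.\<close>

definition H :: "'a mat" where "H = four_block_mat C (0\<^sub>m m k) (0\<^sub>m k m) (1\<^sub>m k)"
definition Hi :: "'a mat" where "Hi = four_block_mat Ci (0\<^sub>m m k) (0\<^sub>m k m) (1\<^sub>m k)"

lemma dims [simp]: "dim_row H = n" "dim_col H = n" "dim_row Hi = n" "dim_col Hi = n" "dim_row Ci = m" "dim_col Ci = m"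
  using Ci by (auto simp: H_def Hi_def n_def)

lemma st_C [simp]: "st C = C"
  by (intro eq_matI) (auto simp: st_index toeplitz_def simp flip: herm)

lemma H_carrier: "H \<in> carrier_mat n n" "Hi \<in> carrier_mat n n" by (simp_all add: carrier_matI)

lemma st_H [simp]: "st H = H" unfolding H_def
  by (subst st_four_block[of _ m _ k]) (simp_all add: carrier_matI)

lemma H_Hi: "H * Hi = 1\<^sub>m n"
  unfolding H_def Hi_def n_def by (rule four_block_inverse) (simp_all add: Ci carrier_matI)

lemma Hi_H: "Hi * H = 1\<^sub>m n" by (rule inverse_mat_commute[OF H_carrier H_Hi])

lemma Ci_C: "Ci * C = 1\<^sub>m m" by (rule inverse_mat_commute[OF _ Ci]) (simp add: carrier_matI)

text \<open>The columns of P form a basis of the standard hermitian space with Gram matrix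
  H.\<close>

definition Ps :: "'a mat set" where "Ps = {P \<in> carrier_mat n n. st P * P = H}"

lemma Ps_I: "dim_row P = n \<Longrightarrow> dim_col P = n \<Longrightarrow> st P * P = H \<Longrightarrow> P \<in> Ps"
  and Ps_D: "P \<in> Ps \<Longrightarrow> dim_row P = n" "P \<in> Ps \<Longrightarrow> dim_col P = n" "P \<in> Ps \<Longrightarrow> st P * P = H"
  unfolding Ps_def carrier_mat_def by simp_all

lemma finite_Ps: "finite Ps"
  by (rule finite_subset[of _ "carrier_mat n n"]) (auto simp: Ps_def card_carrier_mat)

lemma Ps_inverse:
  assumes "P \<in> Ps" shows "Hi * st P * P = 1\<^sub>m n" "P * (Hi * st P) = 1\<^sub>m n"
proof -
  have P: "P \<in> carrier_mat n n" "st P * P = H" using assms by (auto simp: Ps_def)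
  have [simp]: "dim_row P = n" "dim_col P = n" using P by auto
  show "Hi * st P * P = 1\<^sub>m n" by (simp add: mult_assoc_dim P Hi_H)
  from inverse_mat_commute[OF _ _ this] show "P * (Hi * st P) = 1\<^sub>m n" by (simp add: carrier_matI)
qed

text \<open>\<open>U n\<close> acts simply transitively on these bases by left multiplication.
  Gram-Schmidt started from the empty frame shows that there is one.\<close>

lemma card_Ps: "card Ps = card (U n)"
proof -
  have "\<exists>Y \<in> carrier_mat n n. st (0\<^sub>m n 0) * (H * Y) = 0\<^sub>m 0 n \<and> st Y * (H * Y) = 1\<^sub>m n"
    by (rule gram_schmidt[OF H_carrier(1) st_H H_carrier(2) H_Hi, of "0\<^sub>m n 0" 0 "0\<^sub>m 0 0"]) (auto intro!: eq_matI)
  then obtain Y where Y: "Y \<in> carrier_mat n n" "st Y * (H * Y) = 1\<^sub>m n" by blast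
  have [simp]: "dim_row Y = n" "dim_col Y = n" using Y by auto
  define P where "P = st Y * H"
  have [simp]: "dim_row P = n" "dim_col P = n" by (simp_all add: P_def)
  have PY: "P * Y = 1\<^sub>m n" using Y(2) by (simp add: P_def mult_assoc_dim)
  have YP: "Y * P = 1\<^sub>m n" by (rule inverse_mat_commute[OF _ _ PY]) (simp_all add: carrier_matI)
  have "st P * P = H * (Y * P)" by (simp add: P_def st_mult mult_assoc_dim)
  then have PP: "st P * P = H" by (simp add: YP mult_one_dim)
  have "bij_betw (\<lambda>A. A * P) (U n) Ps"
  proof (rule bij_betwI[where g = "\<lambda>Q. Q * Y"])
    show "(\<lambda>A. A * P) \<in> U n \<rightarrow> Ps"
    proof
      fix A assume A: "A \<in> U n"
      then have [simp]: "dim_row A = n" "dim_col A = n" using U_D by auto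
      have "st (A * P) * (A * P) = st P * ((st A * A) * P)" by (simp add: st_mult mult_assoc_dim)
      also have "\<dots> = H" by (simp add: U_D(3)[OF A] PP one_mult_dim)
      finally show "A * P \<in> Ps" by (intro Ps_I) simp_all
    qed
    show "(\<lambda>Q. Q * Y) \<in> Ps \<rightarrow> U n"
    proof
      fix Q assume Q: "Q \<in> Ps"
      then have [simp]: "dim_row Q = n" "dim_col Q = n" by (simp_all add: Ps_D)
      have "st (Q * Y) * (Q * Y) = st Y * ((st Q * Q) * Y)" by (simp add: st_mult mult_assoc_dim)
      also have "\<dots> = 1\<^sub>m n" by (simp add: Ps_D(3)[OF Q] Y(2))
      finally show "Q * Y \<in> U n" by (intro U_I) simp_all
    qed
    show "A * P * Y = A" if "A \<in> U n" for A
    proof -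
      have [simp]: "dim_row A = n" "dim_col A = n" using that by (simp_all add: U_D)
      show ?thesis by (simp add: mult_assoc_dim PY mult_one_dim)
    qed
    show "Q * Y * P = Q" if "Q \<in> Ps" for Q
    proof -
      have [simp]: "dim_row Q = n" "dim_col Q = n" using that by (simp_all add: Ps_D)
      show ?thesis by (simp add: mult_assoc_dim YP mult_one_dim)
    qed
  qed
  then show ?thesis by (simp add: bij_betw_same_card)
qed

lemma four_block_gram:
  assumes "A \<in> carrier_mat m m" "B \<in> carrier_mat m k" "N \<in> carrier_mat k m" "E \<in> carrier_mat k k"
  shows "st (four_block_mat A B N E) * (H * four_block_mat A B N E) =
    four_block_mat (st A * (C * A) + st N * N) (st A * (C * B) + st N * E)
      (st B * (C * A) + st E * N) (st B * (C * B) + st E * E)"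
proof -
  have [simp]: "dim_row A = m" "dim_col A = m" "dim_row B = m" "dim_col B = k"
    "dim_row N = k" "dim_col N = m" "dim_row E = k" "dim_col E = k" using assms by auto
  have "H * four_block_mat A B N E = four_block_mat (C * A) (C * B) N E"
    unfolding H_def
    by (subst mult_four_block_mat[of _ m m _ k _ k _ _ m _ k])
      (simp_all add: assms carrier_matI mat_dist del: carrier_mat_triv)
  moreover have "st (four_block_mat A B N E) * four_block_mat (C * A) (C * B) N E =
     four_block_mat (st A * (C * A) + st N * N) (st A * (C * B) + st N * E)
      (st B * (C * A) + st E * N) (st B * (C * B) + st E * E)"
    unfolding st_four_block[OF assms]
    by (subst mult_four_block_mat[of _ m m _ k _ k _ _ m _ k])
      (simp_all add: assms carrier_matI)
  ultimately show ?thesis by simp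
qed

text \<open>The lower left block of the isometry equation is the adjoint of the upper right one, so
  three block equations suffice.\<close>

lemma UH_block_iff:
  assumes "A \<in> carrier_mat m m" "B \<in> carrier_mat m k" "N \<in> carrier_mat k m" "E \<in> carrier_mat k k"
  shows "four_block_mat A B N E \<in> UH H n \<longleftrightarrow>
    st A * (C * A) + st N * N = C \<and> st A * (C * B) + st N * E = 0\<^sub>m m k \<and> st B * (C * B) + st E * E = 1\<^sub>m k"
   (is "?L \<longleftrightarrow> ?R")
proof -
  have [simp]: "dim_row A = m" "dim_col A = m" "dim_row B = m" "dim_col B = k"
    "dim_row N = k" "dim_col N = m" "dim_row E = k" "dim_col E = k" using assms by auto
  have car: "four_block_mat A B N E \<in> carrier_mat n n" by (simp add: n_def carrier_matI)
  have "st (st A * (C * B) + st N * E) = st B * (C * A) + st E * N"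
    by (simp add: st_add st_mult mult_assoc_dim)
  then have z: "st B * (C * A) + st E * N = 0\<^sub>m k m" if "st A * (C * B) + st N * E = 0\<^sub>m m k"
    using that by (metis st_zero)
  show ?thesis
  proof
    assume ?L
    have eq: "four_block_mat (st A * (C * A) + st N * N) (st A * (C * B) + st N * E)
      (st B * (C * A) + st E * N) (st B * (C * B) + st E * E) = four_block_mat C (0\<^sub>m m k) (0\<^sub>m k m) (1\<^sub>m k)"
      using UH_D(3)[OF \<open>?L\<close>] unfolding four_block_gram[OF assms] unfolding H_def by assumption
    have "st A * (C * A) + st N * N = C"
    proof (intro eq_matI)
      fix i j assume "i < dim_row C" "j < dim_col C"
      then show "(st A * (C * A) + st N * N) $$ (i,j) = C $$ (i,j)"
        using arg_cong[OF eq, of "\<lambda>X. X $$ (i,j)"] by (simp del: index_mult_mat(1) index_add_mat(1))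
    qed auto
    moreover have "st A * (C * B) + st N * E = 0\<^sub>m m k"
    proof (intro eq_matI)
      fix i j assume "i < dim_row (0\<^sub>m m k :: 'a mat)" "j < dim_col (0\<^sub>m m k :: 'a mat)"
      then show "(st A * (C * B) + st N * E) $$ (i,j) = 0\<^sub>m m k $$ (i,j)"
        using arg_cong[OF eq, of "\<lambda>X. X $$ (i,m + j)"] by (simp del: index_mult_mat(1) index_add_mat(1))
    qed auto
    moreover have "st B * (C * B) + st E * E = 1\<^sub>m k"
    proof (intro eq_matI)
      fix i j assume "i < dim_row (1\<^sub>m k :: 'a mat)" "j < dim_col (1\<^sub>m k :: 'a mat)"
      then show "(st B * (C * B) + st E * E) $$ (i,j) = 1\<^sub>m k $$ (i,j)"
        using arg_cong[OF eq, of "\<lambda>X. X $$ (m + i,m + j)"] by (simp del: index_mult_mat(1) index_add_mat(1) index_one_mat(1))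
    qed auto
    ultimately show ?R by blast
  next
    assume ?R
    then have "st (four_block_mat A B N E) * (H * four_block_mat A B N E) = H"
      unfolding four_block_gram[OF assms] using z unfolding H_def by simp
    then show ?L unfolding UH_def using car by blast
  qed
qed

lemma block_cases:
  assumes "X \<in> carrier_mat n n"
  obtains A B N E where "A \<in> carrier_mat m m" "B \<in> carrier_mat m k" "N \<in> carrier_mat k m" "E \<in> carrier_mat k k"
    "X = four_block_mat A B N E"
proof -
  obtain A B N E where s: "split_block X m m = (A,B,N,E)" by (metis prod_cases4)
  from split_block[OF s, of k k] assms show ?thesis using that by (simp add: n_def)
qed

text \<open>V extends to an adapted basis, and two extensions differ by an isometry of H that fixes
  the first m basis vectors. It preserves their orthogonal complement, so it is block diagonal with
  an element of \<open>U k\<close> as second block.\<close>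

lemma card_Ps_fibre:
  assumes V: "V \<in> carrier_mat n m" "st V * V = C"
  shows "card {P \<in> Ps. P * first_cols n m = V} = card (U k)"
proof -
  have [simp]: "dim_row V = n" "dim_col V = m" using V by auto
  have "\<exists>Y \<in> carrier_mat n k. st V * (1\<^sub>m n * Y) = 0\<^sub>m m k \<and> st Y * (1\<^sub>m n * Y) = 1\<^sub>m k"
    by (rule gram_schmidt[OF one_carrier_mat st_one one_carrier_mat _ V(1) Ci(1)])
      (simp_all add: one_mult_dim V Ci n_def)
  then obtain Y where Y: "Y \<in> carrier_mat n k" "st V * Y = 0\<^sub>m m k" "st Y * Y = 1\<^sub>m k"
    by (auto simp: one_mult_dim)
  have [simp]: "dim_row Y = n" "dim_col Y = k" using Y by auto
  define P where "P = hcat V Y"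
  have [simp]: "dim_row P = n" "dim_col P = n" by (simp_all add: P_def n_def)
  have YV: "st Y * V = 0\<^sub>m k m" using arg_cong[OF Y(2), of st] by (simp add: st_mult)
  have "st P * P = H" by (simp add: P_def st_hcat_mult H_def V Y YV)
  then have P: "P \<in> Ps" by (intro Ps_I) simp_all
  have PJ: "P * first_cols n m = V"
  proof (intro eq_matI)
    fix i j assume "i < dim_row V" "j < dim_col V"
    then show "(P * first_cols n m) $$ (i,j) = V $$ (i,j)"
      using mult_first_cols_index[of i P j m] by (simp add: n_def P_def hcat_def del: index_mult_mat(1))
  qed auto
  define Pi where "Pi = Hi * st P"
  have [simp]: "dim_row Pi = n" "dim_col Pi = n" by (simp_all add: Pi_def)
  have PiP: "Pi * P = 1\<^sub>m n" "P * Pi = 1\<^sub>m n" using Ps_inverse[OF P] by (simp_all add: Pi_def mult_assoc_dim)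
  let ?d = "\<lambda>D. four_block_mat (1\<^sub>m m) (0\<^sub>m m k) (0\<^sub>m k m) D :: 'a mat"
  have d_J: "?d D * first_cols n m = first_cols n m" if "D \<in> carrier_mat k k" for D
  proof (intro eq_matI)
    have [simp]: "dim_row D = k" "dim_col D = k" using that by auto
    fix i j assume "i < dim_row (first_cols n m :: 'a mat)" "j < dim_col (first_cols n m :: 'a mat)"
    then show "(?d D * first_cols n m) $$ (i,j) = first_cols n m $$ (i,j)"
      using mult_first_cols_index[of i "?d D" j m] by (simp add: n_def first_cols_def del: index_mult_mat(1))
  qed (use that in \<open>simp_all add: n_def\<close>)
  have d_UH: "?d D \<in> UH H n" if "D \<in> U k" for D
  proof -
    have [simp]: "dim_row D = k" "dim_col D = k" using that by (simp_all add: U_D)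
    have "D \<in> carrier_mat k k" by (rule carrier_matI) simp_all
    then show ?thesis using U_D(3)[OF that] by (subst UH_block_iff) (simp_all add: mat_dist)
  qed
  have conv: "\<exists>D \<in> U k. X = ?d D" if X: "X \<in> UH H n" "X * first_cols n m = first_cols n m" for X
  proof -
    obtain A B N E where b: "A \<in> carrier_mat m m" "B \<in> carrier_mat m k" "N \<in> carrier_mat k m" "E \<in> carrier_mat k k"
      "X = four_block_mat A B N E" using block_cases X(1) unfolding UH_def by blast
    have [simp]: "dim_row A = m" "dim_col A = m" "dim_row B = m" "dim_col B = k"
      "dim_row N = k" "dim_col N = m" "dim_row E = k" "dim_col E = k" using b by auto
    have XJ: "X $$ (i,j) = (if i = j then 1 else 0)" if "i < n" "j < m" for i j
      using mult_first_cols_index[of i X j m] arg_cong[OF X(2), of "\<lambda>X. X $$ (i,j)"] that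
      by (simp add: b(5) first_cols_def n_def del: index_mult_mat(1))
    have A: "A = 1\<^sub>m m"
    proof (intro eq_matI)
      fix i j assume "i < dim_row (1\<^sub>m m :: 'a mat)" "j < dim_col (1\<^sub>m m :: 'a mat)"
      then show "A $$ (i,j) = 1\<^sub>m m $$ (i,j)" using XJ[of i j] by (simp add: b(5) n_def)
    qed auto
    have N: "N = 0\<^sub>m k m"
    proof (intro eq_matI)
      fix i j assume "i < dim_row (0\<^sub>m k m :: 'a mat)" "j < dim_col (0\<^sub>m k m :: 'a mat)"
      then show "N $$ (i,j) = 0\<^sub>m k m $$ (i,j)" using XJ[of "m + i" j] by (simp add: b(5) n_def)
    qed auto
    have e: "st A * (C * B) + st N * E = 0\<^sub>m m k" "st B * (C * B) + st E * E = 1\<^sub>m k"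
      using X(1) UH_block_iff[OF b(1-4)] b(5) by auto
    \<comment> \<open>Orthogonality to the fixed vectors and invertibility of C force the upper
      right block to vanish.\<close>
    have "C * B = 0\<^sub>m m k" using e(1) unfolding A N by (simp add: mat_dist)
    then have "Ci * C * B = 0\<^sub>m m k" by (simp add: mult_assoc_dim mult_zero_dim)
    then have B: "B = 0\<^sub>m m k" unfolding Ci_C by (simp add: one_mult_dim)
    then have "st E * E = 1\<^sub>m k" using e(2) by (simp add: mat_dist)
    then have "E \<in> U k" by (intro U_I) simp_all
    then show ?thesis unfolding b(5) A N B by blast
  qed
  have "bij_betw (\<lambda>D. P * ?d D) (U k) {P \<in> Ps. P * first_cols n m = V}"
  proof (rule bij_betw_imageI)
    have inv: "?d D = Pi * (P * ?d D)" if "D \<in> carrier_mat k k" for D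
    proof -
      have [simp]: "dim_row D = k" "dim_col D = k" using that by auto
      have "Pi * (P * ?d D) = (Pi * P) * ?d D" by (simp add: mult_assoc_dim n_def)
      then show ?thesis by (simp add: PiP one_mult_dim n_def)
    qed
    show "inj_on (\<lambda>D. P * ?d D) (U k)"
    proof (rule inj_onI)
      fix D D' assume D: "D \<in> U k" "D' \<in> U k" "P * ?d D = P * ?d D'"
      then have "?d D = ?d D'" using inv by (metis U_iff)
      have [simp]: "dim_row D = k" "dim_col D = k" "dim_row D' = k" "dim_col D' = k" using D by (simp_all add: U_D)
      show "D = D'"
      proof (intro eq_matI)
        fix i j assume "i < dim_row D'" "j < dim_col D'"
        then show "D $$ (i,j) = D' $$ (i,j)" using arg_cong[OF \<open>?d D = ?d D'\<close>, of "\<lambda>X. X $$ (m+i,m+j)"] by simp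
      qed auto
    qed
    show "(\<lambda>D. P * ?d D) ` U k = {P \<in> Ps. P * first_cols n m = V}"
    proof (intro equalityI subsetI)
      fix Q assume "Q \<in> (\<lambda>D. P * ?d D) ` U k"
      then obtain D where D: "D \<in> U k" "Q = P * ?d D" by auto
      have [simp]: "dim_row D = k" "dim_col D = k" using D by (simp_all add: U_D)
      have "st Q * Q = st (?d D) * ((st P * P) * ?d D)" unfolding D(2) by (simp add: st_mult mult_assoc_dim n_def)
      also have "\<dots> = H" using Ps_D(3)[OF P] UH_D(3)[OF d_UH[OF D(1)]] by simp
      finally have "Q \<in> Ps" by (intro Ps_I) (simp_all add: D(2), simp_all add: n_def)
      moreover have "Q * first_cols n m = P * (?d D * first_cols n m)" unfolding D(2) by (simp add: mult_assoc_dim n_def)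
      moreover have "D \<in> carrier_mat k k" by (rule carrier_matI) simp_all
      ultimately show "Q \<in> {P \<in> Ps. P * first_cols n m = V}" using d_J[of D] PJ by simp
    next
      fix Q assume Q: "Q \<in> {P \<in> Ps. P * first_cols n m = V}"
      then have [simp]: "dim_row Q = n" "dim_col Q = n" by (simp_all add: Ps_D)
      have stPi: "st Pi * (H * Pi) = 1\<^sub>m n"
      proof -
        have "st Pi * (H * Pi) = st Pi * ((st P * P) * Pi)" using Ps_D(3)[OF P] by simp
        also have "\<dots> = st (P * Pi) * (P * Pi)" by (simp add: st_mult mult_assoc_dim)
        finally show ?thesis by (simp add: PiP one_mult_dim)
      qed
      have "st (Pi * Q) * (H * (Pi * Q)) = st Q * ((st Pi * (H * Pi)) * Q)" by (simp add: st_mult mult_assoc_dim)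
      also have "\<dots> = H" using Q Ps_D(3)[of Q] by (simp add: stPi one_mult_dim)
      finally have "Pi * Q \<in> UH H n" by (intro UH_I) simp_all
      moreover have "Pi * Q * first_cols n m = Pi * (P * first_cols n m)" using Q PJ by (simp add: mult_assoc_dim)
      then have "Pi * Q * first_cols n m = (Pi * P) * first_cols n m" by (simp add: mult_assoc_dim)
      then have "Pi * Q * first_cols n m = first_cols n m" by (simp add: PiP one_mult_dim)
      ultimately obtain D where D: "D \<in> U k" "Pi * Q = ?d D" using conv by blast
      have "P * (Pi * Q) = (P * Pi) * Q" by (simp add: mult_assoc_dim)
      then have "Q = P * ?d D" using D(2) by (simp add: PiP one_mult_dim)
      then show "Q \<in> (\<lambda>D. P * ?d D) ` U k" using D by blast
    qed
  qed
  then show ?thesis by (simp add: bij_betw_same_card)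
qed

lemma Ps_form:
  assumes "P \<in> Ps" shows "st (Hi * st P) * (H * (Hi * st P)) = 1\<^sub>m n"
proof -
  have [simp]: "dim_row P = n" "dim_col P = n" using assms by (simp_all add: Ps_D)
  have "st (Hi * st P) * (H * (Hi * st P)) = st (Hi * st P) * ((st P * P) * (Hi * st P))"
    using Ps_D(3)[OF assms] by simp
  also have "\<dots> = st (P * (Hi * st P)) * (P * (Hi * st P))" by (simp add: st_mult mult_assoc_dim)
  finally show ?thesis by (simp add: Ps_inverse[OF assms] one_mult_dim)
qed

lemma frame_col_0:
  assumes "P \<in> Ps" "v \<in> carrier_mat n 1" "M \<in> carrier_mat n n" "P * first_cols n m = frame M v m"
  shows "P * first_cols n 1 = v"
proof (intro eq_matI)
  have [simp]: "dim_row P = n" "dim_col P = n" "dim_row v = n" "dim_col v = 1" "dim_row M = n" "dim_col M = n"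
    using assms by (simp_all add: Ps_D)
  fix i j assume "i < dim_row v" "j < dim_col v"
  then have ij: "i < n" "j = 0" by auto
  have n1: "1 \<le> n" using n_def m_pos by simp
  have "(P * first_cols n 1) $$ (i,0) = P $$ (i,0)"
    using mult_first_cols_index[of i P 0 1] ij n1 by (simp del: index_mult_mat(1))
  also have "\<dots> = (P * first_cols n m) $$ (i,0)"
    using mult_first_cols_index[of i P 0 m] ij m_pos by (simp add: n_def del: index_mult_mat(1))
  also have "\<dots> = v $$ (i,0)" unfolding assms(4) using ij m_pos
    by (simp add: frame_def one_mult_dim del: index_mult_mat(1))
  finally show "(P * first_cols n 1) $$ (i,j) = v $$ (i,j)" using ij by simp
qed (use assms in \<open>simp_all add: Ps_D\<close>)

text \<open>Count in two ways the triples (M,v,P) in which P is an adapted basis beginning with the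
  Krylov vectors of v. Every pair (M,v) admits \<open>card (U k)\<close> bases P. On the other hand,
  replacing M by its matrix in the basis P turns the triples into all pairs of a basis in
  \<open>Ps\<close> and a normal form.\<close>

lemma card_moment_pairs_normal_forms: "card (moment_pairs c n f) * card (U k) = card (U n) * card (normal_forms H c m n f)"
proof -
  let ?J = "first_cols n m :: 'a mat" and ?e = "first_cols n 1 :: 'a mat"
  define Z where "Z = (SIGMA x:moment_pairs c n f. {P \<in> Ps. P * ?J = frame (fst x) (snd x) m})"
  have "card Z = (\<Sum>x\<in>moment_pairs c n f. card {P \<in> Ps. P * ?J = frame (fst x) (snd x) m})"
    unfolding Z_def by (rule card_SigmaI) (auto simp: finite_moment_pairs finite_Ps)
  also have "\<dots> = (\<Sum>x\<in>moment_pairs c n f. card (U k))"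
  proof (rule sum.cong[OF refl])
    fix x assume "x \<in> moment_pairs c n f"
    then obtain M v where x: "x = (M,v)" "M \<in> U n" "v \<in> carrier_mat n 1" "\<And>j. hf (1\<^sub>m n) v (M ^\<^sub>m j * v) = c (int j)"
      by (auto simp: moment_pairs_def)
    have [simp]: "dim_row v = n" using x(3) by auto
    have "st (frame M v m) * (1\<^sub>m n * frame M v m) = C"
      by (rule frame_gram[OF x(2) one_carrier_mat st_one x(3,4) herm])
    then have "st (frame M v m) * frame M v m = C" by (simp add: one_mult_dim)
    moreover have "frame M v m \<in> carrier_mat n m" by (rule carrier_matI) simp_all
    ultimately show "card {P \<in> Ps. P * ?J = frame (fst x) (snd x) m} = card (U k)"
      using card_Ps_fibre x(1) by simp
  qed
  finally have cZ: "card Z = card (moment_pairs c n f) * card (U k)" by simp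
  have Ecar: "?e \<in> carrier_mat n 1" by (rule carrier_matI) simp_all
  have "bij_betw (\<lambda>((M,v),P). (P, (Hi * st P) * (M * P))) Z (Ps \<times> normal_forms H c m n f)"
  proof (rule bij_betwI[where g = "\<lambda>(P,N). ((P * (N * (Hi * st P)), P * ?e), P)"])
    show "(\<lambda>((M,v),P). (P, (Hi * st P) * (M * P))) \<in> Z \<rightarrow> Ps \<times> normal_forms H c m n f"
    proof
      fix z assume "z \<in> Z"
      then obtain M v P where z: "z = ((M,v),P)" "P \<in> Ps" "P * ?J = frame M v m"
        and M: "M \<in> U n" "v \<in> carrier_mat n 1" "\<And>j. hf (1\<^sub>m n) v (M ^\<^sub>m j * v) = c (int j)" "char_poly M = f"
        by (auto simp: Z_def moment_pairs_def)
      define Q where "Q = Hi * st P"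
      have [simp]: "dim_row P = n" "dim_col P = n" "dim_row v = n" "dim_col v = 1" "dim_row M = n" "dim_col M = n"
        using z M by (simp_all add: Ps_D U_D)
      have [simp]: "dim_row Q = n" "dim_col Q = n" by (simp_all add: Q_def)
      have car: "M \<in> carrier_mat n n" "P \<in> carrier_mat n n" "Q \<in> carrier_mat n n" by (simp_all add: carrier_matI)
      have QP: "Q * P = 1\<^sub>m n" "P * Q = 1\<^sub>m n" using Ps_inverse[OF z(2)] by (simp_all add: Q_def)
      have Pe: "P * ?e = v" by (rule frame_col_0[OF z(2) M(2) car(1) z(3)])
      have HQ: "H * Q = st P" by (simp add: Q_def H_Hi one_mult_dim flip: mult_assoc_dim)
      have Qv: "Q * v = ?e" unfolding Pe[symmetric] by (simp add: QP one_mult_dim flip: mult_assoc_dim)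
      have "st (Q * (M * P)) * (H * (Q * (M * P))) = st P * (st M * ((st Q * (H * Q)) * (M * P)))"
        by (simp add: st_mult mult_assoc_dim)
      also have "\<dots> = st P * ((st M * M) * P)" unfolding Q_def Ps_form[OF z(2)] by (simp add: one_mult_dim mult_assoc_dim)
      also have "\<dots> = H" by (simp add: U_D(3)[OF M(1)] one_mult_dim Ps_D(3)[OF z(2)])
      finally have 1: "Q * (M * P) \<in> UH H n" by (intro UH_I) simp_all
      have 2: "hf H ?e ((Q * (M * P)) ^\<^sub>m j * ?e) = c (int j)" for j
      proof -
        have "st ?e * (H * ((Q * (M * P)) ^\<^sub>m j * ?e)) = st ?e * ((H * Q) * (M ^\<^sub>m j * (P * ?e)))"
          unfolding pow_mat_conj[OF car QP(2,1)] by (simp add: mult_assoc_dim)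
        also have "\<dots> = st (P * ?e) * (1\<^sub>m n * (M ^\<^sub>m j * v))"
          unfolding HQ Pe by (simp add: st_mult mult_assoc_dim one_mult_dim flip: Pe)
        finally show ?thesis using M(3)[of j] unfolding hf_def Pe by simp
      qed
      have "frame (Q * (M * P)) ?e m = Q * frame M v m"
        using mult_frame[OF car QP(2,1) M(2), of m] unfolding Qv by simp
      also have "\<dots> = ?J" unfolding z(3)[symmetric] by (simp add: QP one_mult_dim flip: mult_assoc_dim)
      finally have 3: "frame (Q * (M * P)) ?e m = ?J" .
      have "similar_mat (Q * (M * P)) M"
        by (rule similar_matI[of _ _ Q P n]) (use car QP in \<open>auto simp: mult_assoc_dim\<close>)
      then have 4: "char_poly (Q * (M * P)) = f" using M(4) char_poly_similar by metis
      show "(\<lambda>((M,v),P). (P, (Hi * st P) * (M * P))) z \<in> Ps \<times> normal_forms H c m n f"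
        using z(2) 1 2 3 4 unfolding z(1) normal_forms_def Q_def by simp
    qed
    show "(\<lambda>(P,N). ((P * (N * (Hi * st P)), P * ?e), P)) \<in> Ps \<times> normal_forms H c m n f \<rightarrow> Z"
    proof
      fix z assume "z \<in> Ps \<times> normal_forms H c m n f"
      then obtain P N where z: "z = (P,N)" "P \<in> Ps"
        and N: "N \<in> UH H n" "\<And>j. hf H ?e (N ^\<^sub>m j * ?e) = c (int j)" "frame N ?e m = ?J" "char_poly N = f"
        by (auto simp: normal_forms_def)
      define Q where "Q = Hi * st P"
      have [simp]: "dim_row P = n" "dim_col P = n" "dim_row N = n" "dim_col N = n"
        using z N by (simp_all add: Ps_D UH_D)
      have [simp]: "dim_row Q = n" "dim_col Q = n" by (simp_all add: Q_def)
      have car: "N \<in> carrier_mat n n" "Q \<in> carrier_mat n n" "P \<in> carrier_mat n n" by (simp_all add: carrier_matI)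
      have QP: "Q * P = 1\<^sub>m n" "P * Q = 1\<^sub>m n" using Ps_inverse[OF z(2)] by (simp_all add: Q_def)
      have "st (P * (N * Q)) * (P * (N * Q)) = st Q * ((st N * ((st P * P) * N)) * Q)"
        by (simp add: st_mult mult_assoc_dim)
      also have "\<dots> = 1\<^sub>m n" using Ps_form[OF z(2)] unfolding Ps_D(3)[OF z(2)] UH_D(3)[OF N(1)] Q_def .
      finally have 1: "P * (N * Q) \<in> U n" by (intro U_I) simp_all
      have 2: "hf (1\<^sub>m n) (P * ?e) ((P * (N * Q)) ^\<^sub>m j * (P * ?e)) = c (int j)" for j
      proof -
        have "st (P * ?e) * (1\<^sub>m n * ((P * (N * Q)) ^\<^sub>m j * (P * ?e))) = st ?e * ((st P * P) * (N ^\<^sub>m j * ((Q * P) * ?e)))"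
          unfolding pow_mat_conj[OF car QP(1,2)] by (simp add: mult_assoc_dim st_mult one_mult_dim)
        then show ?thesis using N(2)[of j] unfolding hf_def by (simp add: QP Ps_D(3)[OF z(2)] one_mult_dim)
      qed
      have 3: "P * ?J = frame (P * (N * Q)) (P * ?e) m"
        using mult_frame[OF car QP(1,2) Ecar, of m] unfolding N(3) .
      have "similar_mat (P * (N * Q)) N"
        by (rule similar_matI[of _ _ P Q n]) (use car QP in \<open>auto simp: mult_assoc_dim\<close>)
      then have 4: "char_poly (P * (N * Q)) = f" using N(4) char_poly_similar by metis
      have 5: "P * ?e \<in> carrier_mat n 1" by (rule carrier_matI) simp_all
      show "(\<lambda>(P,N). ((P * (N * (Hi * st P)), P * ?e), P)) z \<in> Z"
        using z(2) 1 2 3 4 5 unfolding z(1) Z_def moment_pairs_def Q_def by simp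
    qed
    show "(\<lambda>(P,N). ((P * (N * (Hi * st P)), P * ?e), P)) ((\<lambda>((M,v),P). (P, (Hi * st P) * (M * P))) z) = z" if "z \<in> Z" for z
    proof -
      obtain M v P where z1: "z = ((M,v),P)" by (metis prod.collapse)
      have z: "z = ((M,v),P)" "P \<in> Ps" "P * ?J = frame M v m" and M: "M \<in> U n" "v \<in> carrier_mat n 1"
        using that unfolding z1 Z_def moment_pairs_def by simp_all
      define Q where "Q = Hi * st P"
      have [simp]: "dim_row P = n" "dim_col P = n" "dim_row v = n" "dim_col v = 1" "dim_row M = n" "dim_col M = n"
        using z M by (simp_all add: Ps_D U_D)
      have [simp]: "dim_row Q = n" "dim_col Q = n" by (simp_all add: Q_def)
      have car: "M \<in> carrier_mat n n" by (simp add: carrier_matI)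
      have QP: "P * Q = 1\<^sub>m n" using Ps_inverse[OF z(2)] by (simp_all add: Q_def)
      have "P * (Q * (M * P) * Q) = (P * Q) * (M * (P * Q))" by (simp add: mult_assoc_dim)
      also have "\<dots> = M" by (simp add: QP one_mult_dim mult_one_dim)
      finally show ?thesis using frame_col_0[OF z(2) M(2) car z(3)] unfolding z(1) Q_def by simp
    qed
    show "(\<lambda>((M,v),P). (P, (Hi * st P) * (M * P))) ((\<lambda>(P,N). ((P * (N * (Hi * st P)), P * ?e), P)) z) = z"
      if zz: "z \<in> Ps \<times> normal_forms H c m n f" for z
    proof -
      obtain P N where z: "z = (P,N)" "P \<in> Ps" and N: "N \<in> UH H n" using zz by (auto simp: normal_forms_def)
      define Q where "Q = Hi * st P"
      have [simp]: "dim_row P = n" "dim_col P = n" "dim_row N = n" "dim_col N = n"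
        using z N by (simp_all add: Ps_D UH_D)
      have [simp]: "dim_row Q = n" "dim_col Q = n" by (simp_all add: Q_def)
      have QP: "Q * P = 1\<^sub>m n" using Ps_inverse[OF z(2)] by (simp_all add: Q_def)
      have "Q * (P * (N * Q) * P) = (Q * P) * (N * (Q * P))" by (simp add: mult_assoc_dim)
      also have "\<dots> = N" by (simp add: QP one_mult_dim mult_one_dim)
      finally show ?thesis unfolding z(1) Q_def by simp
    qed
  qed
  then have "card Z = card (Ps \<times> normal_forms H c m n f)" by (rule bij_betw_same_card)
  then show ?thesis using cZ by (simp add: card_cartesian_product card_Ps)
qed

end

section \<open>Rank-one perturbations of the characteristic polynomial\<close>

definition const_mat :: "'b::comm_ring_1 mat \<Rightarrow> 'b poly mat" where
  "const_mat A = map_mat (\<lambda>a. [:a:]) A"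

lemma dim_const_mat [simp]: "dim_row (const_mat A) = dim_row A" "dim_col (const_mat A) = dim_col A"
  by (auto simp: const_mat_def)

lemma sum_const_poly: "(\<Sum>i\<in>A. [:f i:]) = [:\<Sum>i\<in>A. f i:]"
  by (induction A rule: infinite_finite_induct) auto

lemma const_mat_mult: "dim_col A = dim_row B \<Longrightarrow> const_mat (A * B) = const_mat A * const_mat B"
  by (intro eq_matI) (auto simp: const_mat_def scalar_prod_def sum_const_poly mult.commute)

lemma const_mat_add: "dim_row A = dim_row B \<Longrightarrow> dim_col A = dim_col B \<Longrightarrow> const_mat (A + B) = const_mat A + const_mat B"
  by (intro eq_matI) (auto simp: const_mat_def)

lemma char_poly_matrix_const: "dim_row A = n \<Longrightarrow> dim_col A = n \<Longrightarrow> char_poly_matrix A = [:0,1:] \<cdot>\<^sub>m 1\<^sub>m n - const_mat A"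
  by (intro eq_matI) (auto simp: char_poly_matrix_def const_mat_def)

lemma det_power:
  fixes A :: "'b::comm_ring_1 mat"
  assumes "A \<in> carrier_mat n n" shows "det (A ^\<^sub>m j) = det A ^ j"
  by (induction j) (use assms in \<open>auto simp: det_mult[of _ n] mult.commute\<close>)

text \<open>In prime characteristic $p$ the identity $(\kappa - N)^p = \kappa^p$ for $N^2 = 0$ replaces any
  computation of a determinant.\<close>
lemma det_scalar_minus_nilpotent:
  fixes N :: "'b::idom mat"
  assumes N: "N \<in> carrier_mat n n" "N * N = 0\<^sub>m n n" and pr: "prime CHAR('b)"
  shows "det (\<kappa> \<cdot>\<^sub>m 1\<^sub>m n - N) = \<kappa> ^ n"
proof -
  let ?p = "CHAR('b)" and ?A = "\<kappa> \<cdot>\<^sub>m 1\<^sub>m n - N"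
  have [simp]: "dim_row N = n" "dim_col N = n" using N by auto
  have A: "?A \<in> carrier_mat n n" by (rule carrier_matI) simp_all
  have pw: "?A ^\<^sub>m j = \<kappa> ^ j \<cdot>\<^sub>m 1\<^sub>m n - (of_nat j * \<kappa> ^ (j - 1)) \<cdot>\<^sub>m N" for j
  proof (induction j)
    case 0
    show ?case by (intro eq_matI) auto
  next
    case (Suc j)
    have e: "of_nat j * \<kappa> ^ (j - Suc 0) * \<kappa> = of_nat j * \<kappa> ^ j" by (cases j) auto
    have "?A ^\<^sub>m Suc j = (\<kappa> ^ j \<cdot>\<^sub>m 1\<^sub>m n - (of_nat j * \<kappa> ^ (j - 1)) \<cdot>\<^sub>m N) * ?A"
      using Suc by simp
    also have "\<dots> = \<kappa> ^ j \<cdot>\<^sub>m (\<kappa> \<cdot>\<^sub>m 1\<^sub>m n - N) - (of_nat j * \<kappa> ^ (j - 1)) \<cdot>\<^sub>m (\<kappa> \<cdot>\<^sub>m N)"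
      by (simp add: minus_mult_dim mult_minus_dim smult_mult_dim mult_smult_dim one_mult_dim mult_one_dim N(2))
        (intro eq_matI, auto simp: algebra_simps)
    also have "\<dots> = \<kappa> ^ Suc j \<cdot>\<^sub>m 1\<^sub>m n - (of_nat (Suc j) * \<kappa> ^ (Suc j - 1)) \<cdot>\<^sub>m N"
      using e by (intro eq_matI) (auto simp: algebra_simps)
    finally show ?case .
  qed
  have "?A ^\<^sub>m ?p = \<kappa> ^ ?p \<cdot>\<^sub>m 1\<^sub>m n" unfolding pw by (intro eq_matI) auto
  then have "det ?A ^ ?p = (\<kappa> ^ ?p) ^ n" using det_power[OF A, of ?p] by simp
  then have "det ?A ^ ?p = (\<kappa> ^ n) ^ ?p" by (simp flip: power_mult add: mult.commute)
  then have "(det ?A + (- (\<kappa> ^ n))) ^ ?p = 0"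
    using freshmans_dream[OF pr refl, of "det ?A" "- (\<kappa> ^ n)"] minus_power_prime_CHAR[OF refl pr, of "\<kappa> ^ n"] by simp
  then have "det ?A + (- (\<kappa> ^ n)) = 0" by (metis power_eq_0_iff)
  then show ?thesis by simp
qed

text \<open>Here L is an inverse of K up to the scalar \<kappa>. Multiplying by L turns K - x b into
  \<kappa> minus x b L, which squares to zero because b L x = 0. So both determinants become
  \<kappa>^n after multiplication by det L, which is nonzero.\<close>

lemma det_minus_rank_one:
  fixes K L x b :: "'b::idom mat"
  assumes K: "K \<in> carrier_mat n n" and L: "L \<in> carrier_mat n n" and x: "x \<in> carrier_mat n 1" and b: "b \<in> carrier_mat 1 n"
    and KL: "K * L = \<kappa> \<cdot>\<^sub>m 1\<^sub>m n" and k0: "\<kappa> \<noteq> 0" and z: "b * (L * x) = 0\<^sub>m 1 1" and pr: "prime CHAR('b)"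
  shows "det (K - x * b) = det K"
proof -
  have [simp]: "dim_row K = n" "dim_col K = n" "dim_row L = n" "dim_col L = n" "dim_row x = n" "dim_col x = 1"
    "dim_row b = 1" "dim_col b = n" using K L x b by auto
  let ?N = "x * (b * L)"
  have N: "?N \<in> carrier_mat n n" by (rule carrier_matI) simp_all
  have "?N * ?N = x * ((b * (L * x)) * (b * L))" by (simp add: mult_assoc_dim)
  then have NN: "?N * ?N = 0\<^sub>m n n" unfolding z by (simp add: zero_mult_dim mult_zero_dim)
  have eq: "(K - x * b) * L = \<kappa> \<cdot>\<^sub>m 1\<^sub>m n - ?N" by (simp add: minus_mult_dim mult_assoc_dim KL)
  have car: "K - x * b \<in> carrier_mat n n" by (rule carrier_matI) simp_all
  have "det (K - x * b) * det L = \<kappa> ^ n"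
    using det_mult[OF car L] det_scalar_minus_nilpotent[OF N NN pr, of \<kappa>] unfolding eq by simp
  moreover have "det K * det L = \<kappa> ^ n" using det_mult[OF K L] unfolding KL by simp
  moreover have "\<kappa> ^ n \<noteq> 0" using k0 by simp
  ultimately show ?thesis by (metis mult_cancel_right mult_zero_right)
qed

text \<open>The one-term rule is applied to x a and then to y b. The vanishing conditions are
  triangular: a L y may be arbitrary, and the application has a nontrivial pairing there.\<close>

lemma det_minus_two_rank_one:
  fixes K L x y a b :: "'b::idom mat"
  assumes K: "K \<in> carrier_mat n n" and L: "L \<in> carrier_mat n n" and x: "x \<in> carrier_mat n 1" and y: "y \<in> carrier_mat n 1"
    and a: "a \<in> carrier_mat 1 n" and b: "b \<in> carrier_mat 1 n"
    and KL: "K * L = \<kappa> \<cdot>\<^sub>m 1\<^sub>m n" and k0: "\<kappa> \<noteq> 0" and z: "a * (L * x) = 0\<^sub>m 1 1" "b * (L * x) = 0\<^sub>m 1 1" "b * (L * y) = 0\<^sub>m 1 1"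
    and pr: "prime CHAR('b)"
  shows "det (K - x * a - y * b) = det K"
proof -
  have [simp]: "dim_row K = n" "dim_col K = n" "dim_row L = n" "dim_col L = n" "dim_row x = n" "dim_col x = 1"
    "dim_row y = n" "dim_col y = 1" "dim_row a = 1" "dim_col a = n" "dim_row b = 1" "dim_col b = n" using assms by auto
  define N where "N = x * (a * L)"
  have [simp]: "dim_row N = n" "dim_col N = n" by (simp_all add: N_def)
  \<comment> \<open>Since N squares to zero, (\<kappa> - N)(\<kappa> + N) = \<kappa>^2, so this is
    an inverse of K - x a up to the scalar \<kappa>^2.\<close>
  let ?L = "L * (\<kappa> \<cdot>\<^sub>m 1\<^sub>m n + N)"
  have "N * N = x * ((a * (L * x)) * (a * L))" by (simp add: N_def mult_assoc_dim)
  then have NN: "N * N = 0\<^sub>m n n" unfolding z by (simp add: zero_mult_dim mult_zero_dim)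
  have "(K - x * a) * ?L = ((K - x * a) * L) * (\<kappa> \<cdot>\<^sub>m 1\<^sub>m n + N)" by (simp add: mult_assoc_dim)
  also have "(K - x * a) * L = \<kappa> \<cdot>\<^sub>m 1\<^sub>m n - N" by (simp add: minus_mult_dim mult_assoc_dim KL N_def)
  also have "(\<kappa> \<cdot>\<^sub>m 1\<^sub>m n - N) * (\<kappa> \<cdot>\<^sub>m 1\<^sub>m n + N) = (\<kappa> * \<kappa>) \<cdot>\<^sub>m 1\<^sub>m n"
    by (simp add: minus_mult_dim mult_add_dim smult_mult_dim mult_smult_dim one_mult_dim mult_one_dim NN) (intro eq_matI, auto simp: algebra_simps)
  finally have KL2: "(K - x * a) * ?L = (\<kappa> * \<kappa>) \<cdot>\<^sub>m 1\<^sub>m n" .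
  have "b * (?L * y) = \<kappa> \<cdot>\<^sub>m (b * (L * y)) + (b * (L * x)) * (a * (L * y))"
    by (simp add: N_def mult_assoc_dim mult_add_dim add_mult_dim smult_mult_dim mult_smult_dim one_mult_dim mult_one_dim)
  then have z2: "b * (?L * y) = 0\<^sub>m 1 1" unfolding z by (simp add: zero_mult_dim)
  have "det (K - x * a - y * b) = det (K - x * a)"
    by (rule det_minus_rank_one[OF _ _ y b KL2 _ z2 pr]) (use k0 in \<open>simp_all add: carrier_matI\<close>)
  also have "\<dots> = det K" by (rule det_minus_rank_one[OF K L x a KL k0 z(1) pr])
  finally show ?thesis .
qed

text \<open>Put w j = \<beta> M^j adj(X - M) \<xi>. Since (X - M) adj(X - M) is scalar and all
  moments vanish, w (j+1) = X w j, hence w j = X^j w 0. But \<beta> M^j has constant entries, so the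
  degree of w j is bounded independently of j, and w 0 must be 0.\<close>

lemma adj_char_poly_zero:
  fixes M \<beta> \<xi> :: "'b::idom mat"
  assumes M: "M \<in> carrier_mat n n" and \<beta>: "\<beta> \<in> carrier_mat 1 n" and \<xi>: "\<xi> \<in> carrier_mat n 1"
    and z: "\<And>j. \<beta> * (M ^\<^sub>m j * \<xi>) = 0\<^sub>m 1 1"
  shows "const_mat \<beta> * (adj_mat (char_poly_matrix M) * const_mat \<xi>) = 0\<^sub>m 1 1"
proof -
  have [simp]: "dim_row M = n" "dim_col M = n" "dim_row \<beta> = 1" "dim_col \<beta> = n" "dim_row \<xi> = n" "dim_col \<xi> = 1" using assms by auto
  define Q where "Q = adj_mat (char_poly_matrix M) * const_mat \<xi>"
  have cm: "char_poly_matrix M = [:0,1:] \<cdot>\<^sub>m 1\<^sub>m n - const_mat M" by (rule char_poly_matrix_const) simp_all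
  have [simp]: "dim_row (char_poly_matrix M) = n" "dim_col (char_poly_matrix M) = n" by (simp_all add: cm)
  have adj: "char_poly_matrix M * adj_mat (char_poly_matrix M) = char_poly M \<cdot>\<^sub>m 1\<^sub>m n"
    using adj_mat(2)[of "char_poly_matrix M" n] M by (simp add: char_poly_def)
  have [simp]: "dim_row (adj_mat (char_poly_matrix M)) = n" "dim_col (adj_mat (char_poly_matrix M)) = n"
    by (simp_all add: adj_mat_def)
  have [simp]: "dim_row Q = n" "dim_col Q = 1" by (simp_all add: Q_def)
  define w where "w j = const_mat (\<beta> * M ^\<^sub>m j) * Q" for j
  have [simp]: "dim_row (w j) = 1" "dim_col (w j) = 1" for j by (simp_all add: w_def)
  have rec: "w (Suc j) = [:0,1:] \<cdot>\<^sub>m w j" for j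
  proof -
    have "[:0,1:] \<cdot>\<^sub>m w j - w (Suc j) = const_mat (\<beta> * M ^\<^sub>m j) * (char_poly_matrix M * Q)"
      unfolding w_def cm by (simp add: minus_mult_dim mult_minus_dim smult_mult_dim mult_smult_dim one_mult_dim
          const_mat_mult mult_assoc_dim)
    also have "char_poly_matrix M * Q = (char_poly_matrix M * adj_mat (char_poly_matrix M)) * const_mat \<xi>"
      unfolding Q_def by (simp add: mult_assoc_dim)
    also have "\<dots> = char_poly M \<cdot>\<^sub>m const_mat \<xi>" unfolding adj by (simp add: smult_mult_dim one_mult_dim)
    also have "const_mat (\<beta> * M ^\<^sub>m j) * (char_poly M \<cdot>\<^sub>m const_mat \<xi>) = char_poly M \<cdot>\<^sub>m const_mat (\<beta> * (M ^\<^sub>m j * \<xi>))"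
      by (simp add: const_mat_mult mult_smult_dim mult_assoc_dim)
    also have "\<dots> = 0\<^sub>m 1 1" unfolding z by (intro eq_matI) (auto simp: const_mat_def)
    finally have e: "[:0,1:] \<cdot>\<^sub>m w j - w (Suc j) = 0\<^sub>m 1 1" .
    show ?thesis
    proof (intro eq_matI)
      fix i l assume "i < dim_row ([:0,1:] \<cdot>\<^sub>m w j)" "l < dim_col ([:0,1:] \<cdot>\<^sub>m w j)"
      then show "w (Suc j) $$ (i,l) = ([:0,1:] \<cdot>\<^sub>m w j) $$ (i,l)"
        using arg_cong[OF e, of "\<lambda>X. X $$ (i,l)"] by simp
    qed simp_all
  qed
  have pw: "w j $$ (0,0) = monom 1 j * w 0 $$ (0,0)" for j
  proof (induction j)
    case (Suc j)
    then show ?case using rec[of j] by (simp add: monom_Suc)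
  qed simp
  define B where "B = Max (insert 0 ((\<lambda>i. degree (Q $$ (i,0))) ` {..<n}))"
  have B: "degree (Q $$ (i,0)) \<le> B" if "i < n" for i unfolding B_def using that by (intro Max_ge) auto
  have deg: "degree (w j $$ (0,0)) \<le> B" for j
  proof -
    have "w j $$ (0,0) = (\<Sum>l<n. [:(\<beta> * M ^\<^sub>m j) $$ (0,l):] * Q $$ (l,0))"
      unfolding w_def by (subst mult_index_1) (simp_all add: const_mat_def del: index_mult_mat(1))
    also have "degree \<dots> \<le> B"
      by (rule degree_sum_le) (auto intro!: order.trans[OF degree_smult_le] B simp del: index_mult_mat(1))
    finally show ?thesis .
  qed
  have "w 0 $$ (0,0) = 0"
  proof (rule ccontr)
    assume n0: "w 0 $$ (0,0) \<noteq> 0"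
    have "degree (monom 1 (Suc B) * w 0 $$ (0,0)) = Suc B + degree (w 0 $$ (0,0))"
      using n0 by (subst degree_mult_eq) (auto simp: degree_monom_eq)
    then show False using deg[of "Suc B"] pw[of "Suc B"] by simp
  qed
  then have "w 0 = 0\<^sub>m 1 1" by (intro eq_matI) auto
  then show ?thesis unfolding w_def Q_def by (simp add: mult_one_dim)
qed

lemma char_poly_plus_two_rank_one:
  fixes M x y a b :: "'b::idom mat"
  assumes M: "M \<in> carrier_mat n n" and x: "x \<in> carrier_mat n 1" and y: "y \<in> carrier_mat n 1"
    and a: "a \<in> carrier_mat 1 n" and b: "b \<in> carrier_mat 1 n" and pr: "prime CHAR('b)"
    and z: "\<And>j. a * (M ^\<^sub>m j * x) = 0\<^sub>m 1 1" "\<And>j. b * (M ^\<^sub>m j * x) = 0\<^sub>m 1 1" "\<And>j. b * (M ^\<^sub>m j * y) = 0\<^sub>m 1 1"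
  shows "char_poly (M + x * a + y * b) = char_poly M"
proof -
  have [simp]: "dim_row M = n" "dim_col M = n" "dim_row x = n" "dim_col x = 1"
    "dim_row y = n" "dim_col y = 1" "dim_row a = 1" "dim_col a = n" "dim_row b = 1" "dim_col b = n" using assms by auto
  have K: "char_poly_matrix M \<in> carrier_mat n n" using M by simp
  have "char_poly_matrix (M + x * a + y * b) = char_poly_matrix M - const_mat x * const_mat a - const_mat y * const_mat b"
    by (subst (1 2) char_poly_matrix_const[of _ n]) (simp_all add: const_mat_add const_mat_mult, intro eq_matI, auto)
  moreover have "det (char_poly_matrix M - const_mat x * const_mat a - const_mat y * const_mat b) = det (char_poly_matrix M)"
  proof (rule det_minus_two_rank_one[OF K adj_mat(1)[OF K] _ _ _ _ adj_mat(2)[OF K]])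
    show "det (char_poly_matrix M) \<noteq> 0"
      using degree_monic_char_poly[OF M] unfolding char_poly_def by auto
    show "prime CHAR('b poly)" using pr by simp
  qed (use adj_char_poly_zero[OF M a x z(1)] adj_char_poly_zero[OF M b x z(2)] adj_char_poly_zero[OF M b y z(3)]
       in \<open>simp_all add: carrier_matI\<close>)
  ultimately show ?thesis by (simp add: char_poly_def)
qed

lemma char_poly_block_diag:
  fixes A D :: "'b::idom mat"
  assumes A: "A \<in> carrier_mat m m" and D: "D \<in> carrier_mat k k"
  shows "char_poly (four_block_mat A (0\<^sub>m m k) (0\<^sub>m k m) D) = char_poly A * char_poly D"
proof -
  have [simp]: "dim_row A = m" "dim_col A = m" "dim_row D = k" "dim_col D = k" using assms by auto
  have "char_poly_matrix (four_block_mat A (0\<^sub>m m k) (0\<^sub>m k m) D) =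
    four_block_mat (char_poly_matrix A) (0\<^sub>m m k) (0\<^sub>m k m) (char_poly_matrix D)"
    by (intro eq_matI) (auto simp: char_poly_matrix_def)
  then show ?thesis unfolding char_poly_def
    using A D by (subst det_four_block_mat_lower_left_zero[of _ m _ k, symmetric]) simp_all
qed

section \<open>Splitting off a cyclic subspace\<close>

definition vcat :: "'b mat \<Rightarrow> 'b mat \<Rightarrow> 'b mat" where
  "vcat a b = mat (dim_row a + dim_row b) (dim_col a) (\<lambda>(i,j). if i < dim_row a then a $$ (i,j) else b $$ (i - dim_row a, j))"

lemma dim_vcat [simp]: "dim_row (vcat a b) = dim_row a + dim_row b" "dim_col (vcat a b) = dim_col a"
  by (auto simp: vcat_def)

lemma sum_lessThan_add: "(\<Sum>i<m + k. f i) = (\<Sum>i<m. f i) + (\<Sum>i<k. f (m + i))" for f :: "nat \<Rightarrow> 'b::comm_monoid_add"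
  by (induction k) (auto simp: add_ac)

lemma four_block_mult_vcat:
  fixes A B N E a b :: "'b::semiring_0 mat"
  assumes "A \<in> carrier_mat m m" "B \<in> carrier_mat m k" "N \<in> carrier_mat k m" "E \<in> carrier_mat k k"
    "dim_row a = m" "dim_row b = k" "dim_col a = dim_col b"
  shows "four_block_mat A B N E * vcat a b = vcat (A * a + B * b) (N * a + E * b)"
proof (intro eq_matI)
  have [simp]: "dim_row A = m" "dim_col A = m" "dim_row B = m" "dim_col B = k"
    "dim_row N = k" "dim_col N = m" "dim_row E = k" "dim_col E = k" using assms by auto
  fix i j assume "i < dim_row (vcat (A * a + B * b) (N * a + E * b))" "j < dim_col (vcat (A * a + B * b) (N * a + E * b))"
  then have ij: "i < m + k" "j < dim_col b" using assms by auto
  then show "(four_block_mat A B N E * vcat a b) $$ (i,j) = vcat (A * a + B * b) (N * a + E * b) $$ (i,j)"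
    using assms(5-7) by (auto simp: mult_index_1 sum_lessThan_add vcat_def simp del: index_mult_mat(1))
qed (use assms in auto)

lemma hcat_mult_vcat:
  fixes a b x y :: "'b::semiring_0 mat"
  assumes "dim_col a = dim_row x" "dim_col b = dim_row y" "dim_row a = dim_row b" "dim_col x = dim_col y"
  shows "hcat a b * vcat x y = a * x + b * y"
  using assms by (intro eq_matI) (auto simp: mult_index_1 sum_lessThan_add vcat_def hcat_def simp del: index_mult_mat(1))

lemma vcat_mult_hcat:
  fixes a b x y :: "'b::semiring_0 mat"
  assumes "dim_col a = 1" "dim_col b = 1" "dim_row x = 1" "dim_row y = 1"
  shows "vcat a b * hcat x y = four_block_mat (a * x) (a * y) (b * x) (b * y)"
  using assms by (intro eq_matI) (auto simp: mult_index_1 vcat_def hcat_def simp del: index_mult_mat(1))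

lemma monic_dvd_eq:
  fixes p s :: "'b::idom poly"
  assumes "monic p" "monic s" "degree p = degree s" "p dvd s" shows "p = s"
proof -
  obtain t where t: "s = p * t" using assms(4) by (elim dvdE)
  have "p \<noteq> 0" "t \<noteq> 0" using assms t by auto
  then have "degree t = 0" using assms(3) t by (simp add: degree_mult_eq)
  moreover have "lead_coeff t = 1" using assms(1,2) t by (simp add: lead_coeff_mult)
  ultimately have "t = 1" by (metis degree_0_id one_pCons degree_eq_zeroE coeff_pCons_0)
  then show ?thesis using t by simp
qed

section \<open>The companion matrix of the recurrence and the isometries lifted from the
  complement\<close>

locale gram_rec = gram_block q F c m k n Ci
  for q :: nat and F :: "'a::{field,finite} itself" and c :: "int \<Rightarrow> 'a" and m k n :: nat and Ci :: "'a mat" +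
  fixes r :: "'a poly"
  assumes monic_r: "monic r" and deg_r: "degree r = m" and kill: "(\<Sum>i\<le>m. coeff r i * c (l + int i)) = 0"
begin

text \<open>The companion matrix of r. It will be the block of M on the Krylov vectors, because the
  recurrence prescribes the orthogonal projection of M^m v to their span.\<close>

definition T :: "'a mat" where
  "T = mat m m (\<lambda>(i,j). if Suc j = m then - coeff r i else if i = Suc j then 1 else 0)"

text \<open>The products of the Krylov vectors with their images under the a-th power of M.\<close>

definition Dm :: "nat \<Rightarrow> 'a mat" where
  "Dm a = mat m m (\<lambda>(i,j). c (int a + int j - int i))"

definition eps :: "'a mat" where "eps = mat m 1 (\<lambda>(i,_). if Suc i = m then 1 else 0)"

lemma dims2 [simp]: "dim_row T = m" "dim_col T = m" "dim_row (Dm a) = m" "dim_col (Dm a) = m"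
  "dim_row eps = m" "dim_col eps = 1"
  by (auto simp: T_def Dm_def eps_def)

lemma Dm_0: "Dm 0 = C" by (simp add: Dm_def toeplitz_def)

lemma kill': "(\<Sum>i<m. coeff r i * c (l + int i)) = - c (l + int m)"
proof -
  have "coeff r m = 1" using monic_r deg_r by simp
  then show ?thesis using kill[of l]
    by (simp add: eq_neg_iff_add_eq_0 flip: lessThan_Suc_atMost)
qed

text \<open>The recurrence read backwards: conjugation together with c (- i) = cj (c i) reverses its
  direction.\<close>

lemma kill_cj: "(\<Sum>i<m. cj (coeff r i) * c (l - int i)) = - c (l - int m)"
proof -
  have "cj (\<Sum>i<m. coeff r i * c (- l + int i)) = cj (- c (- l + int m))" using kill'[of "- l"] by simp
  moreover have "cj (c (- l + int i)) = c (l - int i)" for i using herm[of "- l + int i"] by simp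
  ultimately show ?thesis by (simp add: cj_sum cj_mult cj_minus)
qed

lemma Dm_T: "Dm a * T = Dm (Suc a)"
proof (intro eq_matI)
  fix i j assume "i < dim_row (Dm (Suc a))" "j < dim_col (Dm (Suc a))"
  then have ij: "i < m" "j < m" by auto
  have e: "(Dm a * T) $$ (i,j) = (\<Sum>l<m. c (int a + int l - int i) * (if Suc j = m then - coeff r l else if l = Suc j then 1 else 0))"
    using ij by (simp add: mult_index_1 Dm_def T_def del: index_mult_mat(1))
  show "(Dm a * T) $$ (i,j) = Dm (Suc a) $$ (i,j)"
  proof (cases "Suc j = m")
    case True
    have "(Dm a * T) $$ (i,j) = - (\<Sum>l<m. coeff r l * c (int a - int i + int l))"
      unfolding e sum_negf[symmetric] using True by (intro sum.cong) (auto simp: algebra_simps)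
    also have "\<dots> = c (int a - int i + int m)" unfolding kill' by simp
    finally have "(Dm a * T) $$ (i,j) = c (int a - int i + int (Suc j))" using True by simp
    then show ?thesis using ij by (simp add: Dm_def algebra_simps del: index_mult_mat(1))
  next
    case False
    then have "Suc j < m" using ij by simp
    then have "(Dm a * T) $$ (i,j) = c (int a + int (Suc j) - int i)"
      unfolding e using False by (simp add: if_distrib[of "\<lambda>x. _ * x"] cong: if_cong)
    then show ?thesis using ij by (simp add: Dm_def algebra_simps)
  qed
qed auto

lemma C_T_pow: "C * T ^\<^sub>m a = Dm a"
proof (induction a)
  case 0
  show ?case by (simp add: mult_one_dim Dm_0)
next
  case (Suc a)
  have "C * T ^\<^sub>m Suc a = (C * T ^\<^sub>m a) * T" by (simp add: mult_assoc_dim)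
  then show ?case unfolding Suc Dm_T .
qed

lemma C_T: "C * T = Dm 1" using Dm_T[of 0] by (simp add: Dm_0)

text \<open>Entries of C depend only on j - i, and T shifts both indices by one. The last column and
  the last row, where the shift leaves the matrix, are supplied by the recurrence and by its
  conjugate.\<close>

lemma T_iso: "st T * (C * T) = C"
  unfolding C_T
proof (intro eq_matI)
  fix i j assume "i < dim_row C" "j < dim_col C"
  then have ij: "i < m" "j < m" by auto
  have e: "(st T * Dm 1) $$ (i,j) = (\<Sum>l<m. cj (if Suc i = m then - coeff r l else if l = Suc i then 1 else 0) * c (1 + int j - int l))"
    using ij by (simp add: mult_index_1 Dm_def T_def st_index del: index_mult_mat(1))
  show "(st T * Dm 1) $$ (i,j) = C $$ (i,j)"
  proof (cases "Suc i = m")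
    case True
    have "(st T * Dm 1) $$ (i,j) = - (\<Sum>l<m. cj (coeff r l) * c (1 + int j - int l))"
      unfolding e sum_negf[symmetric] using True by (intro sum.cong) (auto simp: cj_minus)
    also have "\<dots> = c (1 + int j - int m)" unfolding kill_cj by simp
    finally have "(st T * Dm 1) $$ (i,j) = c (1 + int j - int (Suc i))" using True by simp
    then show ?thesis using ij by (simp add: toeplitz_def algebra_simps del: index_mult_mat(1))
  next
    case False
    then have "Suc i < m" using ij by simp
    then have "(st T * Dm 1) $$ (i,j) = c (1 + int j - int (Suc i))"
      unfolding e using False
      by (simp add: if_distrib[of "\<lambda>x. x * _"] if_distrib[of cj] cong: if_cong)
    then show ?thesis using ij by (simp add: toeplitz_def algebra_simps)
  qed
qed auto

text \<open>The row (1, X, ..., X^(m-1)) times X - T is (0, ..., 0, r). Multiplying by the adjugate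
  shows that r divides the characteristic polynomial, which is monic of the same degree.\<close>

lemma char_poly_T: "char_poly T = r"
proof -
  let ?K = "char_poly_matrix T"
  have K: "?K \<in> carrier_mat m m" by (rule char_poly_matrix_closed) (simp add: carrier_matI)
  then have [simp]: "dim_row ?K = m" "dim_col ?K = m" by auto
  have [simp]: "dim_row (adj_mat ?K) = m" "dim_col (adj_mat ?K) = m" using adj_mat(1)[OF K] by auto
  define \<rho> :: "'a poly mat" where "\<rho> = mat 1 m (\<lambda>(_,j). monom 1 j)"
  define R :: "'a poly mat" where "R = mat 1 m (\<lambda>(_,j). if Suc j = m then r else 0)"
  have [simp]: "dim_row \<rho> = 1" "dim_col \<rho> = m" "dim_row R = 1" "dim_col R = m" by (simp_all add: \<rho>_def R_def)
  have "\<rho> * ?K = R"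
  proof (intro eq_matI)
    fix i j assume "i < dim_row R" "j < dim_col R"
    then have ij: "i = 0" "j < m" by auto
    have Kij: "?K $$ (l,j) = (if l = j then [:0,1:] else 0) + [:- T $$ (l,j):]" if "l < m" for l
      using that ij by (simp add: char_poly_matrix_def)
    have "(\<rho> * ?K) $$ (i,j) = (\<Sum>l<m. monom 1 l * ((if l = j then [:0,1:] else 0) + [:- T $$ (l,j):]))"
      using ij Kij by (simp add: mult_index_1 \<rho>_def del: index_mult_mat(1))
    also have "\<dots> = (\<Sum>l<m. monom 1 l * (if l = j then [:0,1:] else 0)) + (\<Sum>l<m. monom 1 l * [:- T $$ (l,j):])"
      unfolding distrib_left sum.distrib ..
    also have "(\<Sum>l<m. monom (1::'a) l * (if l = j then [:0,1:] else 0)) = monom 1 (Suc j)"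
    proof -
      have "[:0,1:] = monom (1::'a) 1" by (simp add: monom_Suc monom_0)
      then have "monom 1 j * [:0,1:] = monom (1::'a) (Suc j)" by (simp only: mult_monom) simp
      moreover have "(\<Sum>l<m. monom 1 l * (if l = j then [:0,1:] else 0)) = (\<Sum>l<m. if l = j then monom 1 j * [:0,1::'a:] else 0)"
        by (intro sum.cong) auto
      ultimately show ?thesis using ij by simp
    qed
    also have "(\<Sum>l<m. monom 1 l * [:- T $$ (l,j):]) = (\<Sum>l<m. monom (- T $$ (l,j)) l)"
      by (intro sum.cong) (auto simp: smult_monom)
    also have "\<dots> = (if Suc j = m then r - monom 1 (Suc j) else - monom 1 (Suc j))"
    proof (cases "Suc j = m")
      case True
      have "r = (\<Sum>l\<le>m. monom (coeff r l) l)" using poly_as_sum_of_monoms[of r] deg_r by simp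
      also have "\<dots> = (\<Sum>l<m. monom (coeff r l) l) + monom 1 m"
        using monic_r deg_r by (simp flip: lessThan_Suc_atMost)
      finally have "r - monom 1 m = (\<Sum>l<m. monom (coeff r l) l)" by (simp add: algebra_simps)
      moreover have "(\<Sum>l<m. monom (- T $$ (l,j)) l) = (\<Sum>l<m. monom (coeff r l) l)"
        using True ij by (intro sum.cong) (auto simp: T_def)
      ultimately show ?thesis using True by simp
    next
      case False
      then have "Suc j < m" using ij by simp
      have "(\<Sum>l<m. monom (- T $$ (l,j)) l) = (\<Sum>l<m. if l = Suc j then - monom 1 (Suc j) else 0)"
        using False ij by (intro sum.cong) (auto simp: T_def minus_monom)
      then show ?thesis using False \<open>Suc j < m\<close> by simp
    qed
    finally show "(\<rho> * ?K) $$ (i,j) = R $$ (i,j)" using ij by (simp add: R_def)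
  qed auto
  then have "R * adj_mat ?K = \<rho> * (?K * adj_mat ?K)" by (simp flip: mult_assoc_dim)
  also have "\<dots> = char_poly T \<cdot>\<^sub>m \<rho>" unfolding adj_mat(2)[OF K] char_poly_def by (simp add: mult_smult_dim mult_one_dim)
  finally have e: "R * adj_mat ?K = char_poly T \<cdot>\<^sub>m \<rho>" .
  have "(R * adj_mat ?K) $$ (0,0) = (\<Sum>l<m. (if Suc l = m then r else 0) * adj_mat ?K $$ (l,0))"
    using m_pos by (simp add: mult_index_1 R_def del: index_mult_mat(1))
  also have "\<dots> = r * adj_mat ?K $$ (m - 1,0)"
  proof -
    have "(\<Sum>l<m. (if Suc l = m then r else 0) * adj_mat ?K $$ (l,0)) = (\<Sum>l<m. if l = m - 1 then r * adj_mat ?K $$ (m - 1,0) else 0)"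
      by (intro sum.cong) auto
    then show ?thesis using m_pos by simp
  qed
  finally have "char_poly T = r * adj_mat ?K $$ (m - 1,0)" unfolding e using m_pos by (simp add: \<rho>_def)
  then have "r dvd char_poly T" by simp
  moreover have "monic (char_poly T)" "degree (char_poly T) = m"
    using degree_monic_char_poly[of T m] by (auto simp: carrier_matI)
  ultimately show ?thesis using monic_dvd_eq[of r "char_poly T"] monic_r deg_r by simp
qed

definition Ti :: "'a mat" where "Ti = Ci * (st T * C)"
text \<open>The solution p of T^* C p = eps. With it the off-diagonal isometry equation reads B = -
  p u^* E.\<close>

definition pp :: "'a mat" where "pp = Ci * (st Ti * eps)"

lemma dims3 [simp]: "dim_row Ti = m" "dim_col Ti = m" "dim_row pp = m" "dim_col pp = 1"
  by (auto simp: Ti_def pp_def)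

lemma Ti_T: "Ti * T = 1\<^sub>m m" "T * Ti = 1\<^sub>m m"
proof -
  show "Ti * T = 1\<^sub>m m" unfolding Ti_def by (simp add: mult_assoc_dim T_iso Ci_C)
  from inverse_mat_commute[OF _ _ this] show "T * Ti = 1\<^sub>m m" by (simp add: carrier_matI)
qed

lemma st_pp: "st T * (C * pp) = eps"
proof -
  have "st T * (C * pp) = st T * ((C * Ci) * (st Ti * eps))" unfolding pp_def by (simp add: mult_assoc_dim)
  also have "\<dots> = st (Ti * T) * eps" unfolding Ci(2) by (simp add: st_mult one_mult_dim mult_assoc_dim)
  finally show ?thesis by (simp add: Ti_T one_mult_dim)
qed

lemma eps_cancel:
  assumes "dim_row x = 1" "eps * x = 0\<^sub>m m (dim_col x)" shows "x = 0\<^sub>m 1 (dim_col x)"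
proof (intro eq_matI)
  fix i j assume "i < dim_row (0\<^sub>m 1 (dim_col x) :: 'a mat)" "j < dim_col (0\<^sub>m 1 (dim_col x) :: 'a mat)"
  then have ij: "i = 0" "j < dim_col x" by auto
  have "(eps * x) $$ (m - 1, j) = x $$ (0,j)"
    using ij assms(1) m_pos by (simp add: mult_index_1 eps_def del: index_mult_mat(1))
  then show "x $$ (i,j) = 0\<^sub>m 1 (dim_col x) $$ (i,j)" using ij m_pos assms(2) by simp
qed (use assms in auto)

lemma pp_cancel:
  assumes "dim_row x = 1" "pp * x = 0\<^sub>m m (dim_col x)" shows "x = 0\<^sub>m 1 (dim_col x)"
proof (rule eps_cancel[OF assms(1)])
  have "eps * x = st T * (C * (pp * x))" unfolding st_pp[symmetric] using assms(1) by (simp add: mult_assoc_dim)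
  then show "eps * x = 0\<^sub>m m (dim_col x)" unfolding assms(2) by (simp add: mult_zero_dim)
qed

text \<open>The norm of \<open>pp\<close> lies in \<open>Fix\<close> and is therefore a trace. In
  this way \<tau> takes the place of half the norm, which makes no sense in characteristic
  2.\<close>

lemma ex_tau: "\<exists>\<tau>. st pp * (C * pp) = (\<tau> + cj \<tau>) \<cdot>\<^sub>m 1\<^sub>m 1"
proof -
  let ?x = "(st pp * (C * pp)) $$ (0,0)"
  have "cj ?x = ?x" using hf_cj[of C m pp pp] unfolding hf_def by (simp add: carrier_matI)
  then obtain \<tau> where "\<tau> + cj \<tau> = ?x" using trace_surj by (auto simp: Fix_def)
  then show ?thesis using mat_1x1_smult[of "st pp * (C * pp)"] by (intro exI[of _ \<tau>]) simp
qed

definition \<tau> :: 'a where "\<tau> = (SOME t. st pp * (C * pp) = (t + cj t) \<cdot>\<^sub>m 1\<^sub>m 1)"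

lemma \<tau>: "st pp * (C * pp) = (\<tau> + cj \<tau>) \<cdot>\<^sub>m 1\<^sub>m 1"
  unfolding \<tau>_def using ex_tau by (rule someI_ex)

text \<open>This is diag(T,D) followed by the Eichler transformation x + u <p,x> - p <u,x> - \<tau>
  u <u,x> of the isotropic vector u and of p = \<open>pp\<close>; the lower left block comes from
  <p,Tx> = eps^* x. Only the last Krylov vector is moved out of the span of these vectors, by
  u.\<close>

definition lift_mat :: "'a mat \<Rightarrow> 'a mat \<Rightarrow> 'a mat" where
  "lift_mat D u = four_block_mat T (- (pp * (st u * D))) (u * st eps) (D - \<tau> \<cdot>\<^sub>m (u * (st u * D)))"

lemma H_mult_vcat:
  assumes "dim_row a = m" "dim_row b = k" "dim_col a = dim_col b"
  shows "H * vcat a b = vcat (C * a) b"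
proof -
  have "C \<in> carrier_mat m m" by (rule carrier_matI) simp_all
  then have "H * vcat a b = vcat (C * a + 0\<^sub>m m k * b) (0\<^sub>m k m * a + 1\<^sub>m k * b)"
    unfolding H_def by (rule four_block_mult_vcat[OF _ zero_carrier_mat zero_carrier_mat one_carrier_mat assms])
  then show ?thesis using assms by (simp add: one_mult_dim zero_mult_dim add_zero_dim zero_add_dim)
qed

lemma st_vcat_mult:
  assumes "dim_row a = dim_row x" "dim_row b = dim_row y" "dim_col a = dim_col b" "dim_col x = dim_col y"
  shows "st (vcat a b) * vcat x y = st a * x + st b * y"
  using assms by (intro eq_matI) (auto simp: mult_index_1 sum_lessThan_add vcat_def st_index simp del: index_mult_mat(1))

lemma first_cols_vcat: "l \<le> m \<Longrightarrow> first_cols n l = vcat (first_cols m l) (0\<^sub>m k l)"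
  by (intro eq_matI) (auto simp: first_cols_def vcat_def n_def)

lemma first_cols_m: "first_cols m m = 1\<^sub>m m"
  by (intro eq_matI) (auto simp: first_cols_def)

lemma pp_form:
  assumes "dim_row w = 1"
  shows "st (pp * w) * (C * (pp * w)) = (\<tau> + cj \<tau>) \<cdot>\<^sub>m (st w * w)"
proof -
  have "st (pp * w) * (C * (pp * w)) = st w * ((st pp * (C * pp)) * w)"
    using assms by (simp add: st_mult mult_assoc_dim)
  then show ?thesis unfolding \<tau> using assms by (simp add: smult_mult_dim mult_smult_dim one_mult_dim)
qed

lemma lift_mat_carriers:
  assumes "dim_row D = k" "dim_col D = k" "dim_row u = k" "dim_col u = 1"
  shows "T \<in> carrier_mat m m" "- (pp * (st u * D)) \<in> carrier_mat m k" "u * st eps \<in> carrier_mat k m"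
    "D - \<tau> \<cdot>\<^sub>m (u * (st u * D)) \<in> carrier_mat k k"
  by (rule carrier_matI; use assms in simp)+

text \<open>As u is isotropic, the first block equation reduces to \<open>T_iso\<close>. In the
  second the two terms are - eps w and eps w by the choice of \<open>pp\<close>, and in the third
  the \<tau> terms cancel the norm of \<open>pp\<close>.\<close>

lemma lift_mat_UH:
  assumes D: "D \<in> U k" and u: "u \<in> carrier_mat k 1" and uu: "st u * u = 0\<^sub>m 1 1"
  shows "lift_mat D u \<in> UH H n"
proof -
  have dd [simp]: "dim_row D = k" "dim_col D = k" "dim_row u = k" "dim_col u = 1" using U_D[OF D] u by auto
  define w where "w = st u * D"
  have [simp]: "dim_row w = 1" "dim_col w = k" by (simp_all add: w_def)
  have stw: "st D * u = st w" by (simp add: w_def st_mult)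
  have "st (u * st eps) * (u * st eps) = eps * ((st u * u) * st eps)" by (simp add: st_mult mult_assoc_dim)
  then have 1: "st T * (C * T) + st (u * st eps) * (u * st eps) = C"
    unfolding uu T_iso by (simp add: zero_mult_dim mult_zero_dim add_zero_dim)
  have "st (u * st eps) * (D - \<tau> \<cdot>\<^sub>m (u * w)) = eps * w - \<tau> \<cdot>\<^sub>m (eps * ((st u * u) * w))"
    by (simp add: st_mult mult_assoc_dim mult_minus_dim mult_smult_dim w_def)
  also have "\<dots> = eps * w" unfolding uu by (simp add: zero_mult_dim mult_zero_dim) (intro eq_matI, auto)
  finally have a: "st (u * st eps) * (D - \<tau> \<cdot>\<^sub>m (u * w)) = eps * w" .
  have "st T * (C * - (pp * w)) = - ((st T * (C * pp)) * w)"
    by (simp add: mult_uminus_dim mult_assoc_dim)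
  then have 2: "st T * (C * - (pp * w)) + st (u * st eps) * (D - \<tau> \<cdot>\<^sub>m (u * w)) = 0\<^sub>m m k"
    unfolding a st_pp by (intro eq_matI) (auto simp del: index_mult_mat(1))
  have b: "st (- (pp * w)) * (C * - (pp * w)) = (\<tau> + cj \<tau>) \<cdot>\<^sub>m (st w * w)"
    using pp_form[of w] by (simp add: st_uminus mult_uminus_dim uminus_mult_dim)
  have "st (D - \<tau> \<cdot>\<^sub>m (u * w)) * (D - \<tau> \<cdot>\<^sub>m (u * w)) =
     (st D * D - \<tau> \<cdot>\<^sub>m ((st D * u) * w)) - cj \<tau> \<cdot>\<^sub>m (st w * (st u * D) - \<tau> \<cdot>\<^sub>m (st w * ((st u * u) * w)))"
    by (simp add: st_minus st_smult st_mult mult_assoc_dim mult_minus_dim minus_mult_dim smult_mult_dim mult_smult_dim)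
      (intro eq_matI, auto simp: algebra_simps simp del: index_mult_mat(1))
  also have "\<dots> = 1\<^sub>m k - (\<tau> + cj \<tau>) \<cdot>\<^sub>m (st w * w)"
    unfolding uu U_D(3)[OF D] stw w_def[symmetric]
    by (simp add: zero_mult_dim mult_zero_dim) (intro eq_matI, auto simp: algebra_simps simp del: index_mult_mat(1))
  finally have c: "st (D - \<tau> \<cdot>\<^sub>m (u * w)) * (D - \<tau> \<cdot>\<^sub>m (u * w)) = 1\<^sub>m k - (\<tau> + cj \<tau>) \<cdot>\<^sub>m (st w * w)" .
  have 3: "st (- (pp * w)) * (C * - (pp * w)) + st (D - \<tau> \<cdot>\<^sub>m (u * w)) * (D - \<tau> \<cdot>\<^sub>m (u * w)) = 1\<^sub>m k"
    unfolding b c by (intro eq_matI) (auto simp del: index_mult_mat(1) index_one_mat(1))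
  note iff = UH_block_iff[OF lift_mat_carriers[OF dd], folded w_def]
  show ?thesis unfolding lift_mat_def w_def[symmetric] iff using 1 2 3 by blast
qed

abbreviation Dg :: "'a mat \<Rightarrow> 'a mat" where "Dg D \<equiv> four_block_mat T (0\<^sub>m m k) (0\<^sub>m k m) D"

lemma Dg_pow_vcat:
  assumes D: "D \<in> carrier_mat k k" and a: "dim_row a = m" "dim_row b = k" "dim_col a = dim_col b"
  shows "Dg D ^\<^sub>m j * vcat a b = vcat (T ^\<^sub>m j * a) (D ^\<^sub>m j * b)"
proof -
  have [simp]: "dim_row D = k" "dim_col D = k" using D by auto
  have "Dg D ^\<^sub>m j * vcat a b = vcat (T ^\<^sub>m j * a) (D ^\<^sub>m j * b)"
  proof (induction j)
    case 0
    show ?case using a by (simp add: one_mult_dim)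
  next
    case (Suc j)
    have "Dg D ^\<^sub>m Suc j * vcat a b = Dg D * (Dg D ^\<^sub>m j * vcat a b)"
      using a by (subst pow_mat_Suc_left) (simp_all add: mult_assoc_dim)
    also have "\<dots> = vcat (T * (T ^\<^sub>m j * a)) (D * (D ^\<^sub>m j * b))"
    proof -
      have "T \<in> carrier_mat m m" by (rule carrier_matI) simp_all
      then have "Dg D * vcat (T ^\<^sub>m j * a) (D ^\<^sub>m j * b) =
        vcat (T * (T ^\<^sub>m j * a) + 0\<^sub>m m k * (D ^\<^sub>m j * b)) (0\<^sub>m k m * (T ^\<^sub>m j * a) + D * (D ^\<^sub>m j * b))"
        by (rule four_block_mult_vcat[OF _ zero_carrier_mat zero_carrier_mat D]) (use a in simp_all)
      then show ?thesis unfolding Suc using a by (simp add: zero_mult_dim add_zero_dim zero_add_dim)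
    qed
    also have "\<dots> = vcat (T ^\<^sub>m Suc j * a) (D ^\<^sub>m Suc j * b)"
      using a by (subst (1 2) pow_mat_Suc_left) (simp_all add: mult_assoc_dim)
    finally show ?case .
  qed
  then show ?thesis .
qed

text \<open>The difference from diag(T,D) is a sum of two rank one matrices with columns (0,u) and
  (pp,0). The required moments are multiples of u^* D^(j+1) u or vanish by the block structure; the
  pairing of \<open>?a\<close> with \<open>?y\<close> is the one that may be nonzero.\<close>

lemma char_poly_lift_mat:
  assumes D: "D \<in> carrier_mat k k" and u: "u \<in> carrier_mat k 1" and iso: "\<And>j. st u * (D ^\<^sub>m j * u) = 0\<^sub>m 1 1"
  shows "char_poly (lift_mat D u) = r * char_poly D"
proof -
  have [simp]: "dim_row D = k" "dim_col D = k" "dim_row u = k" "dim_col u = 1" using D u by auto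
  define w where "w = st u * D"
  have [simp]: "dim_row w = 1" "dim_col w = k" by (simp_all add: w_def)
  have wD: "w * (D ^\<^sub>m j * u) = 0\<^sub>m 1 1" for j
    using iso[of "Suc j"] by (subst (asm) pow_mat_Suc_left) (simp_all add: w_def mult_assoc_dim)
  let ?x = "vcat (0\<^sub>m m 1) u" and ?y = "vcat pp (0\<^sub>m k 1)"
    and ?a = "hcat (st eps) (- (\<tau> \<cdot>\<^sub>m w))" and ?b = "hcat (0\<^sub>m 1 m) (- w)"
  have "lift_mat D u = Dg D + ?x * ?a + ?y * ?b"
    unfolding lift_mat_def w_def[symmetric]
    by (subst (1 2) vcat_mult_hcat)
      (simp_all add: mult_uminus_dim mult_smult_dim zero_mult_dim mult_zero_dim, intro eq_matI, auto simp del: index_mult_mat(1))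
  moreover have "char_poly (Dg D + ?x * ?a + ?y * ?b) = char_poly (Dg D)"
  proof (rule char_poly_plus_two_rank_one[of _ "m + k"])
    have e: "- (\<tau> \<cdot>\<^sub>m w) * (D ^\<^sub>m j * u) = 0\<^sub>m 1 1" "- w * (D ^\<^sub>m j * u) = 0\<^sub>m 1 1" for j
      using wD[of j] by (simp_all add: uminus_mult_dim smult_mult_dim, intro eq_matI, auto intro!: eq_matI)
    show "?a * (Dg D ^\<^sub>m j * ?x) = 0\<^sub>m 1 1" for j
      using e[of j] by (subst Dg_pow_vcat[OF D]) (simp_all add: hcat_mult_vcat mult_zero_dim zero_add_dim)
    show "?b * (Dg D ^\<^sub>m j * ?x) = 0\<^sub>m 1 1" for j
      using e[of j] by (subst Dg_pow_vcat[OF D]) (simp_all add: hcat_mult_vcat mult_zero_dim zero_add_dim)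
    show "?b * (Dg D ^\<^sub>m j * ?y) = 0\<^sub>m 1 1" for j
      by (subst Dg_pow_vcat[OF D]) (simp_all add: hcat_mult_vcat mult_zero_dim zero_mult_dim add_zero_dim)
  qed (rule carrier_matI, simp, simp | rule CHAR_pow)+
  moreover have "char_poly (Dg D) = r * char_poly D"
  proof -
    have "T \<in> carrier_mat m m" by (rule carrier_matI) simp_all
    then show ?thesis using char_poly_block_diag[OF _ D] char_poly_T by simp
  qed
  ultimately show ?thesis by simp
qed

definition E :: "nat \<Rightarrow> 'a mat" where "E j = mat m 1 (\<lambda>(i,_). if i = j then 1 else 0)"

lemma dim_E [simp]: "dim_row (E j) = m" "dim_col (E j) = 1" by (auto simp: E_def)

lemma T_E: "Suc j < m \<Longrightarrow> T * E j = E (Suc j)"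
proof (intro eq_matI)
  fix i l assume j: "Suc j < m" and "i < dim_row (E (Suc j))" "l < dim_col (E (Suc j))"
  then have il: "i < m" "l = 0" by auto
  have "(T * E j) $$ (i,l) = T $$ (i,j)"
    using il j by (simp add: mult_index_1 E_def if_distrib[of "\<lambda>x. _ * x"] del: index_mult_mat(1) cong: if_cong)
  then show "(T * E j) $$ (i,l) = E (Suc j) $$ (i,l)" using il j by (simp add: T_def E_def del: index_mult_mat(1))
qed auto

lemma eps_E: "Suc j < m \<Longrightarrow> st eps * E j = 0\<^sub>m 1 1"
proof (intro eq_matI)
  fix i l assume j: "Suc j < m" and "i < dim_row (0\<^sub>m 1 1 :: 'a mat)" "l < dim_col (0\<^sub>m 1 1 :: 'a mat)"
  then show "(st eps * E j) $$ (i,l) = 0\<^sub>m 1 1 $$ (i,l)"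
    by (simp add: mult_index_1 E_def eps_def st_index if_distrib[of "\<lambda>x. _ * x"] del: index_mult_mat(1) cong: if_cong)
qed auto

lemma T_pow_E: "j < m \<Longrightarrow> T ^\<^sub>m j * E 0 = E j"
proof (induction j)
  case 0
  show ?case by (simp add: one_mult_dim)
next
  case (Suc j)
  have "T ^\<^sub>m Suc j * E 0 = T * (T ^\<^sub>m j * E 0)" by (subst pow_mat_Suc_left) (simp_all add: mult_assoc_dim)
  then show ?case using Suc T_E[of j] by simp
qed

lemma first_col: "first_cols n 1 = vcat (E 0) (0\<^sub>m k 1)"
  using m_pos by (intro eq_matI) (auto simp: first_cols_def vcat_def n_def E_def)

text \<open>The invariant is that all products u^* D^i y of the lower component y stay zero. Hence
  neither the upper right block nor the \<tau> term ever acts on it, and the upper component evolves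
  by T alone.\<close>

lemma lift_mat_pow:
  assumes D: "D \<in> carrier_mat k k" and u: "u \<in> carrier_mat k 1" and iso: "\<And>j. st u * (D ^\<^sub>m j * u) = 0\<^sub>m 1 1"
  shows "\<exists>y \<in> carrier_mat k 1. lift_mat D u ^\<^sub>m j * first_cols n 1 = vcat (T ^\<^sub>m j * E 0) y \<and>
    (\<forall>i. st u * (D ^\<^sub>m i * y) = 0\<^sub>m 1 1) \<and> (j < m \<longrightarrow> y = 0\<^sub>m k 1)"
proof (induction j)
  case 0
  have "D ^\<^sub>m i * 0\<^sub>m k 1 = 0\<^sub>m k 1" for i using D by (simp add: mult_zero_dim)
  moreover have [simp]: "dim_row D = k" "dim_col D = k" "dim_row u = k" "dim_col u = 1" using D u by auto
  have "lift_mat D u ^\<^sub>m 0 * first_cols n 1 = vcat (T ^\<^sub>m 0 * E 0) (0\<^sub>m k 1)"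
    unfolding first_col[symmetric] using first_col by (simp add: lift_mat_def one_mult_dim flip: n_def)
  ultimately show ?case using u
    by (intro bexI[of _ "0\<^sub>m k 1"]) (simp_all add: mult_zero_dim del: pow_mat.simps)
next
  case (Suc j)
  have dd [simp]: "dim_row D = k" "dim_col D = k" "dim_row u = k" "dim_col u = 1" using D u by auto
  obtain y where y: "y \<in> carrier_mat k 1" "lift_mat D u ^\<^sub>m j * first_cols n 1 = vcat (T ^\<^sub>m j * E 0) y"
    "\<And>i. st u * (D ^\<^sub>m i * y) = 0\<^sub>m 1 1" "j < m \<Longrightarrow> y = 0\<^sub>m k 1" using Suc by blast
  have [simp]: "dim_row y = k" "dim_col y = 1" using y(1) by auto
  have [simp]: "dim_row (lift_mat D u) = n" "dim_col (lift_mat D u) = n" by (simp_all add: lift_mat_def n_def)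
  have uDy: "st u * (D * (D ^\<^sub>m i * y)) = 0\<^sub>m 1 1" for i
    using y(3)[of "Suc i"] by (subst (asm) pow_mat_Suc_left) (simp_all add: mult_assoc_dim)
  have uDy0: "st u * (D * y) = 0\<^sub>m 1 1" using uDy[of 0] by (simp add: one_mult_dim)
  define s where "s = st eps * (T ^\<^sub>m j * E 0)"
  have [simp]: "dim_row s = 1" "dim_col s = 1" by (simp_all add: s_def)
  define y' where "y' = u * s + D * y"
  have [simp]: "dim_row y' = k" "dim_col y' = 1" by (simp_all add: y'_def)
  have "lift_mat D u ^\<^sub>m Suc j * first_cols n 1 = lift_mat D u * vcat (T ^\<^sub>m j * E 0) y"
    by (subst pow_mat_Suc_left) (simp_all add: mult_assoc_dim flip: y(2))
  also have "\<dots> = vcat (T * (T ^\<^sub>m j * E 0) + (- (pp * (st u * D))) * y) (u * st eps * (T ^\<^sub>m j * E 0) + (D - \<tau> \<cdot>\<^sub>m (u * (st u * D))) * y)"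
    unfolding lift_mat_def by (rule four_block_mult_vcat[OF lift_mat_carriers[OF dd]]) simp_all
  also have "(- (pp * (st u * D))) * y = 0\<^sub>m m 1"
    by (simp add: uminus_mult_dim mult_assoc_dim uDy0 mult_zero_dim) (intro eq_matI, auto)
  also have "(D - \<tau> \<cdot>\<^sub>m (u * (st u * D))) * y = D * y"
    by (simp add: minus_mult_dim smult_mult_dim mult_assoc_dim uDy0 mult_zero_dim) (intro eq_matI, auto)
  also have "u * st eps * (T ^\<^sub>m j * E 0) = u * s" by (simp add: s_def mult_assoc_dim)
  also have "T * (T ^\<^sub>m j * E 0) + 0\<^sub>m m 1 = T ^\<^sub>m Suc j * E 0"
    by (subst pow_mat_Suc_left) (simp_all add: mult_assoc_dim add_zero_dim)
  finally have 1: "lift_mat D u ^\<^sub>m Suc j * first_cols n 1 = vcat (T ^\<^sub>m Suc j * E 0) y'" by (simp add: y'_def)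
  have 2: "st u * (D ^\<^sub>m i * y') = 0\<^sub>m 1 1" for i
  proof -
    have "st u * (D ^\<^sub>m i * y') = (st u * (D ^\<^sub>m i * u)) * s + st u * (D ^\<^sub>m Suc i * y)"
      unfolding y'_def by (simp add: mult_add_dim mult_assoc_dim)
    then show ?thesis unfolding iso y(3) by (simp add: zero_mult_dim)
  qed
  have 3: "y' = 0\<^sub>m k 1" if "Suc j < m"
    using that y(4) T_pow_E[of j] eps_E[of j] by (simp add: y'_def s_def mult_zero_dim)
  have "y' \<in> carrier_mat k 1" by (rule carrier_matI) simp_all
  then show ?case using 1 2 3 by blast
qed

lemma lift_mat_normal_forms:
  assumes D: "D \<in> U k" and u: "u \<in> carrier_mat k 1" and iso: "\<And>j. st u * (D ^\<^sub>m j * u) = 0\<^sub>m 1 1"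
    and f: "r * char_poly D = f"
  shows "lift_mat D u \<in> normal_forms H c m n f"
proof -
  have Dc: "D \<in> carrier_mat k k" using D by (simp add: U_iff)
  have [simp]: "dim_row D = k" "dim_col D = k" "dim_row u = k" "dim_col u = 1" using Dc u by auto
  have uu: "st u * u = 0\<^sub>m 1 1" using iso[of 0] by (simp add: one_mult_dim)
  have h: "hf H (first_cols n 1) (lift_mat D u ^\<^sub>m j * first_cols n 1) = c (int j)" for j
  proof -
    obtain y where y: "y \<in> carrier_mat k 1" "lift_mat D u ^\<^sub>m j * first_cols n 1 = vcat (T ^\<^sub>m j * E 0) y"
      using lift_mat_pow[OF Dc u iso] by blast
    have [simp]: "dim_row y = k" "dim_col y = 1" using y(1) by auto
    have "st (first_cols n 1) * (H * (lift_mat D u ^\<^sub>m j * first_cols n 1)) = st (E 0) * ((C * T ^\<^sub>m j) * E 0)"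
      unfolding y(2) unfolding first_col
      by (simp add: H_mult_vcat st_vcat_mult zero_mult_dim add_zero_dim mult_assoc_dim)
    also have "\<dots> = st (E 0) * (Dm j * E 0)" unfolding C_T_pow ..
    also have "(st (E 0) * (Dm j * E 0)) $$ (0,0) = Dm j $$ (0,0)"
      using m_pos by (simp add: mult_index_1 E_def st_index if_distrib[of "\<lambda>x. _ * x"] if_distrib[of "\<lambda>x. x * _"] if_distrib[of cj]
          del: index_mult_mat(1) cong: if_cong)
    finally show ?thesis using m_pos by (simp add: hf_def Dm_def)
  qed
  have fr: "frame (lift_mat D u) (first_cols n 1) m = first_cols n m"
  proof (intro eq_matI)
    fix i j assume "i < dim_row (first_cols n m :: 'a mat)" "j < dim_col (first_cols n m :: 'a mat)"
    then have ij: "i < n" "j < m" by auto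
    obtain y where y: "lift_mat D u ^\<^sub>m j * first_cols n 1 = vcat (T ^\<^sub>m j * E 0) y" "y = 0\<^sub>m k 1"
      using lift_mat_pow[OF Dc u iso, of j] ij by blast
    have "lift_mat D u ^\<^sub>m j * first_cols n 1 = vcat (E j) (0\<^sub>m k 1)" using y T_pow_E[OF ij(2)] by simp
    then show "frame (lift_mat D u) (first_cols n 1) m $$ (i,j) = first_cols n m $$ (i,j)"
      using ij by (simp add: frame_def vcat_def E_def first_cols_def n_def del: index_mult_mat(1))
  qed simp_all
  show ?thesis unfolding normal_forms_def using lift_mat_UH[OF D u uu] h fr char_poly_lift_mat[OF Dc u iso] f by simp
qed

text \<open>The vector u is r(M) applied to the first basis vector. The recurrence makes its orbit
  orthogonal to the Krylov vectors, so M acts on this orbit through D, and the moments of u vanish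
  one after another.\<close>

lemma normal_forms_lift_mat:
  assumes M: "M \<in> normal_forms H c m n f"
  shows "\<exists>D u. M = lift_mat D u \<and> D \<in> U k \<and> u \<in> carrier_mat k 1 \<and> (\<forall>j. st u * (D ^\<^sub>m j * u) = 0\<^sub>m 1 1)"
proof -
  let ?e = "first_cols n 1 :: 'a mat" and ?J = "first_cols n m :: 'a mat"
  have MU: "M \<in> UH H n" and h: "\<And>j. hf H ?e (M ^\<^sub>m j * ?e) = c (int j)" and fr: "frame M ?e m = ?J"
    using M by (auto simp: normal_forms_def)
  have [simp]: "dim_row M = n" "dim_col M = n" using MU by (simp_all add: UH_D)
  have Mc: "M \<in> carrier_mat n n" by (rule carrier_matI) simp_all
  have ec: "?e \<in> carrier_mat n 1" by (rule carrier_matI) simp_all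
  obtain A B N E where b: "A \<in> carrier_mat m m" "B \<in> carrier_mat m k" "N \<in> carrier_mat k m" "E \<in> carrier_mat k k"
    "M = four_block_mat A B N E" by (rule block_cases[OF Mc])
  have [simp]: "dim_row A = m" "dim_col A = m" "dim_row B = m" "dim_col B = k"
    "dim_row N = k" "dim_col N = m" "dim_row E = k" "dim_col E = k" using b by auto
  have J: "?J = vcat (1\<^sub>m m) (0\<^sub>m k m)" using first_cols_vcat[of m] by (simp add: first_cols_m)
  have FJ: "st ?J * (H * (M ^\<^sub>m a * ?J)) = Dm a" for a
  proof (intro eq_matI)
    fix i j assume "i < dim_row (Dm a)" "j < dim_col (Dm a)"
    then have ij: "i < m" "j < m" by auto
    have "(st (frame M ?e m) * (H * (M ^\<^sub>m a * frame M ?e m))) $$ (i,j) = hf H (M ^\<^sub>m i * ?e) (M ^\<^sub>m a * (M ^\<^sub>m j * ?e))"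
      using ij unfolding hf_def by (simp add: mult_index_1 frame_def st_index del: index_mult_mat(1))
    also have "M ^\<^sub>m a * (M ^\<^sub>m j * ?e) = M ^\<^sub>m (a + j) * ?e" by (simp add: pow_mat_add_dim mult_assoc_dim)
    also have "hf H (M ^\<^sub>m i * ?e) (M ^\<^sub>m (a + j) * ?e) = c (int (a + j) - int i)"
      by (rule hf_pow[OF MU H_carrier(1) st_H ec h herm])
    finally show "(st ?J * (H * (M ^\<^sub>m a * ?J))) $$ (i,j) = Dm a $$ (i,j)"
      using ij unfolding fr by (simp add: Dm_def del: index_mult_mat(1))
  qed simp_all
  have MJ: "M * ?J = vcat A N"
  proof -
    have "M * ?J = vcat (A * 1\<^sub>m m + B * 0\<^sub>m k m) (N * 1\<^sub>m m + E * 0\<^sub>m k m)"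
      unfolding J b(5) by (rule four_block_mult_vcat[OF b(1-4)]) simp_all
    then show ?thesis by (simp add: mult_one_dim mult_zero_dim add_zero_dim)
  qed
  have stJ: "st ?J * (H * vcat a b) = C * a" if "dim_row a = m" "dim_row b = k" "dim_col a = dim_col b" for a b
    unfolding J using that by (simp add: H_mult_vcat st_vcat_mult one_mult_dim zero_mult_dim add_zero_dim)
  \<comment> \<open>Pairing the images of the Krylov vectors with the Krylov vectors determines the
    upper left block, since C is invertible.\<close>
  have "C * A = C * T"
  proof -
    have "C * A = st ?J * (H * (M * ?J))" unfolding MJ using stJ[of A N] by simp
    also have "\<dots> = Dm 1" using FJ[of 1] by (simp add: one_mult_dim)
    finally show ?thesis unfolding C_T .
  qed
  then have "Ci * C * A = Ci * C * T" by (simp add: mult_assoc_dim)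
  then have A: "A = T" unfolding Ci_C by (simp add: one_mult_dim)
  \<comment> \<open>All Krylov vectors but the last are mapped to the next one, so the lower left
    block lives in its last column.\<close>
  have N0: "N $$ (i,j) = 0" if "i < k" "Suc j < m" for i j
  proof -
    have "N $$ (i,j) = (M * ?J) $$ (m + i, j)" unfolding MJ using that by (simp add: vcat_def)
    also have "\<dots> = (M * frame M ?e m) $$ (m + i, j)" unfolding fr ..
    also have "\<dots> = (M * (M ^\<^sub>m j * ?e)) $$ (m + i, 0)"
      using that by (simp add: mult_index_1 frame_def n_def del: index_mult_mat(1))
    also have "M * (M ^\<^sub>m j * ?e) = M ^\<^sub>m Suc j * ?e"
      by (subst pow_mat_Suc_left) (simp_all add: mult_assoc_dim)
    also have "(M ^\<^sub>m Suc j * ?e) $$ (m + i, 0) = frame M ?e m $$ (m + i, Suc j)"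
      using that by (simp add: frame_def n_def del: index_mult_mat(1) pow_mat.simps)
    also have "\<dots> = 0" unfolding fr using that by (simp add: first_cols_def n_def)
    finally show ?thesis .
  qed
  define u where "u = N * eps"
  have [simp]: "dim_row u = k" "dim_col u = 1" by (simp_all add: u_def)
  have uN: "u $$ (i,0) = N $$ (i, m - 1)" if "i < k" for i
  proof -
    have "u $$ (i,0) = (\<Sum>l<m. N $$ (i,l) * (if Suc l = m then 1 else 0))"
      unfolding u_def using that by (simp add: mult_index_1 eps_def del: index_mult_mat(1))
    also have "\<dots> = (\<Sum>l<m. if l = m - 1 then N $$ (i, m - 1) else 0)"
      by (intro sum.cong) auto
    finally have "u $$ (i,0) = (\<Sum>l<m. if l = m - 1 then N $$ (i, m - 1) else 0)" .
    then show ?thesis using m_pos by simp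
  qed
  have N: "N = u * st eps"
  proof (intro eq_matI)
    fix i j assume "i < dim_row (u * st eps)" "j < dim_col (u * st eps)"
    then have ij: "i < k" "j < m" by auto
    have "(u * st eps) $$ (i,j) = u $$ (i,0) * (if Suc j = m then 1 else 0)"
      using ij by (simp add: mult_index_1 eps_def st_index del: index_mult_mat(1))
    then show "N $$ (i,j) = (u * st eps) $$ (i,j)"
      using N0[of i j] uN[of i] ij by (cases "Suc j = m") (auto simp del: index_mult_mat(1))
  qed simp_all
  have iff: "st A * (C * A) + st N * N = C" "st A * (C * B) + st N * E = 0\<^sub>m m k" "st B * (C * B) + st E * E = 1\<^sub>m k"
    using UH_block_iff[OF b(1-4)] MU b(5) by auto
  have uu: "st u * u = 0\<^sub>m 1 1"
  proof -
    \<comment> \<open>T already preserves C, so the first block equation leaves nothing for this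
      term.\<close>
    have "st N * N = 0\<^sub>m m m"
    proof (intro eq_matI)
      fix i j assume "i < dim_row (0\<^sub>m m m :: 'a mat)" "j < dim_col (0\<^sub>m m m :: 'a mat)"
      then show "(st N * N) $$ (i,j) = 0\<^sub>m m m $$ (i,j)"
        using arg_cong[OF iff(1), of "\<lambda>X. X $$ (i,j)"] unfolding A T_iso by (simp del: index_mult_mat(1))
    qed simp_all
    then have "eps * ((st u * u) * st eps) = 0\<^sub>m m m" unfolding N by (simp add: st_mult mult_assoc_dim)
    then have "(st u * u) * st eps = 0\<^sub>m 1 m" using eps_cancel[of "(st u * u) * st eps"] by simp
    then have "st ((st u * u) * st eps) = 0\<^sub>m m 1" by simp
    then have "eps * (st u * u) = 0\<^sub>m m 1" by (simp add: st_mult mult_assoc_dim)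
    then show ?thesis using eps_cancel[of "st u * u"] by simp
  qed
  define w where "w = st u * E"
  have [simp]: "dim_row w = 1" "dim_col w = k" by (simp_all add: w_def)
  have Bw: "B = - (pp * w)"
  proof -
    have "st T * (C * (B + pp * w)) = st T * (C * B) + (st T * (C * pp)) * w"
      by (simp add: mult_add_dim mult_assoc_dim)
    also have "\<dots> = st A * (C * B) + st N * E" unfolding st_pp A N w_def by (simp add: st_mult mult_assoc_dim)
    finally have z: "st T * (C * (B + pp * w)) = 0\<^sub>m m k" unfolding iff(2) .
    have "B + pp * w = Ci * ((st (T * Ti) * C) * (B + pp * w))"
      unfolding Ti_T by (simp add: one_mult_dim Ci_C flip: mult_assoc_dim)
    also have "\<dots> = Ci * (st Ti * (st T * (C * (B + pp * w))))" by (simp add: st_mult mult_assoc_dim)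
    finally have e: "B + pp * w = 0\<^sub>m m k" unfolding z by (simp add: mult_zero_dim)
    show ?thesis
    proof (intro eq_matI)
      fix i j assume "i < dim_row (- (pp * w))" "j < dim_col (- (pp * w))"
      then show "B $$ (i,j) = (- (pp * w)) $$ (i,j)"
        using arg_cong[OF e, of "\<lambda>X. X $$ (i,j)"] by (simp add: eq_neg_iff_add_eq_0 del: index_mult_mat(1))
    qed simp_all
  qed
  \<comment> \<open>This undoes the \<tau> correction in the lower right block of
    \<open>lift_mat\<close>.\<close>
  define D where "D = E + \<tau> \<cdot>\<^sub>m (u * w)"
  have [simp]: "dim_row D = k" "dim_col D = k" by (simp_all add: D_def)
  have uD: "st u * D = w"
  proof -
    have "st u * D = w + \<tau> \<cdot>\<^sub>m ((st u * u) * w)" unfolding D_def by (simp add: mult_add_dim mult_smult_dim mult_assoc_dim w_def)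
    then show ?thesis unfolding uu by (simp add: zero_mult_dim) (intro eq_matI, auto)
  qed
  have ED: "E = D - \<tau> \<cdot>\<^sub>m (u * (st u * D))"
    unfolding uD unfolding D_def by (intro eq_matI) (auto simp del: index_mult_mat(1))
  have stw: "st E * u = st w" by (simp add: w_def st_mult)
  have "st D * D = (st E * E + \<tau> \<cdot>\<^sub>m ((st E * u) * w)) + cj \<tau> \<cdot>\<^sub>m (st w * (st u * E) + \<tau> \<cdot>\<^sub>m (st w * ((st u * u) * w)))"
    unfolding D_def by (simp add: st_add st_smult st_mult mult_assoc_dim mult_add_dim add_mult_dim smult_mult_dim mult_smult_dim)
      (intro eq_matI, auto simp: algebra_simps simp del: index_mult_mat(1))
  also have "\<dots> = (\<tau> + cj \<tau>) \<cdot>\<^sub>m (st w * w) + st E * E"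
    unfolding uu stw w_def[symmetric]
    by (simp add: zero_mult_dim mult_zero_dim) (intro eq_matI, auto simp: algebra_simps simp del: index_mult_mat(1))
  also have "(\<tau> + cj \<tau>) \<cdot>\<^sub>m (st w * w) = st B * (C * B)"
    unfolding Bw using pp_form[of w] by (simp add: st_uminus mult_uminus_dim uminus_mult_dim)
  also have "st B * (C * B) + st E * E = 1\<^sub>m k" by (rule iff(3))
  finally have DU: "D \<in> U k" by (intro U_I) simp_all
  have MM: "M = lift_mat D u" unfolding lift_mat_def ED[symmetric] unfolding b(5) A N Bw uD ..
  define rv where "rv = - (T * eps)"
  have [simp]: "dim_row rv = m" "dim_col rv = 1" by (simp_all add: rv_def)
  \<comment> \<open>As X = M e - T e for the last Krylov vector e, it is M^m v minus its projection
    to the span of the Krylov vectors, that is, r(M) v.\<close>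
  define X where "X = vcat (0\<^sub>m m 1) u"
  have [simp]: "dim_row X = n" "dim_col X = 1" by (simp_all add: X_def n_def)
  have ee: "st eps * eps = 1\<^sub>m 1"
  proof (intro eq_matI)
    fix i j assume "i < dim_row (1\<^sub>m 1 :: 'a mat)" "j < dim_col (1\<^sub>m 1 :: 'a mat)"
    moreover have "(\<Sum>l<m. cj (if Suc l = m then 1 else 0) * (if Suc l = m then 1 else 0)) = (\<Sum>l<m. if l = m - 1 then 1 else 0)"
      using m_pos by (intro sum.cong) auto
    ultimately show "(st eps * eps) $$ (i,j) = 1\<^sub>m 1 $$ (i,j)"
      using m_pos by (simp add: mult_index_1 eps_def st_index del: index_mult_mat(1))
  qed simp_all
  have X: "X = M * (?J * eps) + ?J * rv"
  proof -
    have "M * (?J * eps) = vcat A N * eps" unfolding MJ[symmetric] by (simp add: mult_assoc_dim)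
    also have "\<dots> = vcat (T * eps) u"
      unfolding A u_def by (intro eq_matI) (auto simp: vcat_def mult_index_1 simp del: index_mult_mat(1))
    finally have 1: "M * (?J * eps) = vcat (T * eps) u" .
    have 2: "?J * rv = vcat rv (0\<^sub>m k 1)" unfolding J
      by (intro eq_matI) (auto simp: vcat_def mult_index_1 if_distrib[of "\<lambda>x. x * _"] simp del: index_mult_mat(1) cong: if_cong)
    show ?thesis unfolding 1 2 unfolding X_def rv_def by (intro eq_matI) (auto simp: vcat_def simp del: index_mult_mat(1))
  qed
  have FX: "st ?J * (H * (M ^\<^sub>m j * X)) = 0\<^sub>m m 1" for j
  proof -
    have "M ^\<^sub>m j * X = (M ^\<^sub>m Suc j * ?J) * eps + (M ^\<^sub>m j * ?J) * rv"
      unfolding X by (simp add: mult_add_dim mult_assoc_dim)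
    then have "st ?J * (H * (M ^\<^sub>m j * X)) = (st ?J * (H * (M ^\<^sub>m Suc j * ?J))) * eps + (st ?J * (H * (M ^\<^sub>m j * ?J))) * rv"
      by (simp add: mult_add_dim mult_assoc_dim del: pow_mat.simps)
    also have "\<dots> = Dm j * (T * eps) + Dm j * rv" unfolding FJ Dm_T[symmetric] by (simp add: mult_assoc_dim)
    also have "\<dots> = 0\<^sub>m m 1" unfolding rv_def
      by (simp add: mult_uminus_dim) (intro eq_matI, auto simp del: index_mult_mat(1))
    finally show ?thesis .
  qed
  have main: "M ^\<^sub>m j * X = vcat (0\<^sub>m m 1) (D ^\<^sub>m j * u) \<and> st u * (D ^\<^sub>m j * u) = 0\<^sub>m 1 1" for j
  proof (induction j)
    case 0
    show ?case using uu by (simp add: one_mult_dim X_def flip: n_def)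
  next
    case (Suc j)
    define y where "y = D ^\<^sub>m j * u"
    have [simp]: "dim_row y = k" "dim_col y = 1" by (simp_all add: y_def)
    have IH: "M ^\<^sub>m j * X = vcat (0\<^sub>m m 1) y" using Suc by (simp add: y_def)
    have "M ^\<^sub>m Suc j * X = M * vcat (0\<^sub>m m 1) y"
      unfolding IH[symmetric] by (subst pow_mat_Suc_left) (simp_all add: mult_assoc_dim)
    also have "\<dots> = vcat (A * 0\<^sub>m m 1 + B * y) (N * 0\<^sub>m m 1 + E * y)"
      unfolding b(5) by (rule four_block_mult_vcat[OF b(1-4)]) simp_all
    also have "\<dots> = vcat (B * y) (E * y)" by (simp add: mult_zero_dim zero_add_dim)
    finally have e: "M ^\<^sub>m Suc j * X = vcat (B * y) (E * y)" .
    \<comment> \<open>The orbit of X is orthogonal to the Krylov vectors, so B y = 0. Since B = - pp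
      w and pp can be cancelled, w y = 0, which is the next moment of u.\<close>
    have "C * (B * y) = 0\<^sub>m m 1" using FX[of "Suc j"] stJ[of "B * y" "E * y"] unfolding e by simp
    then have "Ci * C * (B * y) = 0\<^sub>m m 1" by (simp add: mult_assoc_dim mult_zero_dim)
    then have By: "B * y = 0\<^sub>m m 1" unfolding Ci_C by (simp add: one_mult_dim)
    have neg: "- (pp * (w * y)) = 0\<^sub>m m 1" using By unfolding Bw by (simp add: uminus_mult_dim mult_assoc_dim)
    have "pp * (w * y) = 0\<^sub>m m 1"
    proof (intro eq_matI)
      fix i j assume "i < dim_row (0\<^sub>m m 1 :: 'a mat)" "j < dim_col (0\<^sub>m m 1 :: 'a mat)"
      then show "(pp * (w * y)) $$ (i,j) = 0\<^sub>m m 1 $$ (i,j)"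
        using arg_cong[OF neg, of "\<lambda>X. X $$ (i,j)"] by (simp del: index_mult_mat(1))
    qed simp_all
    then have wy: "w * y = 0\<^sub>m 1 1" using pp_cancel[of "w * y"] by simp
    have Dy: "D ^\<^sub>m Suc j * u = D * y"
      unfolding y_def by (subst pow_mat_Suc_left) (simp_all add: mult_assoc_dim)
    have "E * y = D * y"
      by (subst ED) (simp add: uD minus_mult_dim smult_mult_dim mult_assoc_dim wy mult_zero_dim, intro eq_matI, auto)
    moreover have "st u * (D * y) = 0\<^sub>m 1 1" using wy unfolding uD[symmetric] by (simp add: mult_assoc_dim)
    ultimately show ?case unfolding e By Dy by simp
  qed
  have "u \<in> carrier_mat k 1" by (rule carrier_matI) simp_all
  then show ?thesis using MM DU main by blast
qed

text \<open>The lower left block shows u. Because u is isotropic, u^* times the lower right block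
  equals u^* D, and from this D is recovered.\<close>

lemma lift_mat_inject:
  assumes "D \<in> U k" "D' \<in> U k" "u \<in> carrier_mat k 1" "u' \<in> carrier_mat k 1" "st u * u = 0\<^sub>m 1 1" "lift_mat D u = lift_mat D' u'"
  shows "D = D' \<and> u = u'"
proof -
  have [simp]: "dim_row D = k" "dim_col D = k" "dim_row u = k" "dim_col u = 1" "dim_row D' = k" "dim_col D' = k" "dim_row u' = k" "dim_col u' = 1"
    using assms(1-4) by (auto simp: U_D)
  have idx: "lift_mat D u $$ (m + i, j) = lift_mat D' u' $$ (m + i, j)" for i j using assms(6) by simp
  have uu: "u = u'"
  proof (intro eq_matI)
    fix i j assume "i < dim_row u'" "j < dim_col u'"
    then have ij: "i < k" "j = 0" by auto
    have "(u * st eps) $$ (i, m - 1) = (u' * st eps) $$ (i, m - 1)"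
      using idx[of i "m - 1"] m_pos ij by (simp add: lift_mat_def del: index_mult_mat(1))
    then show "u $$ (i,j) = u' $$ (i,j)" using ij m_pos by (simp add: mult_index_1 eps_def st_index del: index_mult_mat(1))
  qed simp_all
  have e: "D - \<tau> \<cdot>\<^sub>m (u * (st u * D)) = D' - \<tau> \<cdot>\<^sub>m (u * (st u * D'))"
  proof (intro eq_matI)
    fix i j assume "i < dim_row (D' - \<tau> \<cdot>\<^sub>m (u * (st u * D')))" "j < dim_col (D' - \<tau> \<cdot>\<^sub>m (u * (st u * D')))"
    then show "(D - \<tau> \<cdot>\<^sub>m (u * (st u * D))) $$ (i,j) = (D' - \<tau> \<cdot>\<^sub>m (u * (st u * D'))) $$ (i,j)"
      using idx[of i "m + j"] uu by (simp add: lift_mat_def del: index_mult_mat(1) index_minus_mat(1))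
  qed simp_all
  have su: "st u * (X - \<tau> \<cdot>\<^sub>m (u * (st u * X))) = st u * X" if [simp]: "dim_row X = k" for X
  proof -
    have "st u * (X - \<tau> \<cdot>\<^sub>m (u * (st u * X))) = st u * X - \<tau> \<cdot>\<^sub>m ((st u * u) * (st u * X))"
      by (simp add: mult_minus_dim mult_smult_dim mult_assoc_dim)
    then show ?thesis unfolding assms(5) by (simp add: zero_mult_dim) (intro eq_matI, auto)
  qed
  have "st u * D = st u * D'" using su[of D] su[of D'] e by simp
  moreover have "D = (D - \<tau> \<cdot>\<^sub>m (u * (st u * D))) + \<tau> \<cdot>\<^sub>m (u * (st u * D))"
    by (intro eq_matI) (auto simp del: index_mult_mat(1))
  moreover have "D' = (D' - \<tau> \<cdot>\<^sub>m (u * (st u * D'))) + \<tau> \<cdot>\<^sub>m (u * (st u * D'))"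
    by (intro eq_matI) (auto simp del: index_mult_mat(1))
  ultimately show ?thesis using e uu by metis
qed

lemma card_normal_forms: "card (normal_forms H c m n f) = (if r dvd f then card (moment_pairs (\<lambda>_. 0) k (f div r)) else 0)"
proof -
  have r0: "r \<noteq> 0" using monic_r by auto
  let ?S = "{(D,u). D \<in> U k \<and> u \<in> carrier_mat k 1 \<and> (\<forall>j. st u * (D ^\<^sub>m j * u) = 0\<^sub>m 1 1) \<and> r * char_poly D = f}"
  have "bij_betw (\<lambda>(D,u). lift_mat D u) ?S (normal_forms H c m n f)"
  proof (rule bij_betw_imageI)
    show "inj_on (\<lambda>(D,u). lift_mat D u) ?S"
    proof (rule inj_onI, clarify)
      fix D u D' u' assume a: "D \<in> U k" "u \<in> carrier_mat k 1" "\<forall>j. st u * (D ^\<^sub>m j * u) = 0\<^sub>m 1 1"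
        "D' \<in> U k" "u' \<in> carrier_mat k 1" "lift_mat D u = lift_mat D' u'"
      have [simp]: "dim_row u = k" using a(2) by auto
      have [simp]: "dim_row D = k" "dim_col D = k" using U_D[OF a(1)] by auto
      have "st u * u = 0\<^sub>m 1 1" using spec[OF a(3), of 0] by (simp add: one_mult_dim)
      from lift_mat_inject[OF a(1,4,2,5) this a(6)] show "D = D' \<and> u = u'" .
    qed
    show "(\<lambda>(D,u). lift_mat D u) ` ?S = normal_forms H c m n f"
    proof (intro equalityI subsetI)
      fix M assume "M \<in> (\<lambda>(D,u). lift_mat D u) ` ?S"
      then obtain z where z: "M = (\<lambda>(D,u). lift_mat D u) z" "z \<in> ?S" by (rule imageE)
      obtain D u where Du: "z = (D,u)" by (cases z)
      have "D \<in> U k" "u \<in> carrier_mat k 1" "\<And>j. st u * (D ^\<^sub>m j * u) = 0\<^sub>m 1 1" "r * char_poly D = f"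
        using z(2) unfolding Du mem_Collect_eq split_conv by (simp_all del: One_nat_def)
      from lift_mat_normal_forms[OF this] show "M \<in> normal_forms H c m n f" unfolding z(1) Du by simp
    next
      fix M assume M: "M \<in> normal_forms H c m n f"
      from normal_forms_lift_mat[OF M] obtain D u where Du: "M = lift_mat D u" "D \<in> U k" "u \<in> carrier_mat k 1" "\<And>j. st u * (D ^\<^sub>m j * u) = 0\<^sub>m 1 1"
        by blast
      have "D \<in> carrier_mat k k" using Du(2) unfolding U_iff by simp
      then have "char_poly M = r * char_poly D" unfolding Du(1) using Du(3,4) by (rule char_poly_lift_mat)
      moreover have "char_poly M = f" using M unfolding normal_forms_def by simp
      ultimately have "r * char_poly D = f" by simp
      then have "(D,u) \<in> ?S" using Du(2-4) by simp
      then show "M \<in> (\<lambda>(D,u). lift_mat D u) ` ?S" by (rule rev_image_eqI) (simp add: Du(1))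
    qed
  qed
  then have "card (normal_forms H c m n f) = card ?S" by (rule bij_betw_same_card[symmetric])
  also have "?S = (if r dvd f then moment_pairs (\<lambda>_. 0) k (f div r) else {})"
  proof -
    have "(\<forall>j. st u * (D ^\<^sub>m j * u) = 0\<^sub>m 1 1) \<longleftrightarrow> (\<forall>j. hf (1\<^sub>m k) u (D ^\<^sub>m j * u) = 0)"
      if D: "D \<in> U k" and u: "u \<in> carrier_mat k 1" for D u
    proof -
      have [simp]: "dim_row u = k" "dim_row D = k" "dim_col D = k" "dim_col u = 1" using U_D[OF D] u by auto
      have "st u * (D ^\<^sub>m j * u) = 0\<^sub>m 1 1 \<longleftrightarrow> hf (1\<^sub>m k) u (D ^\<^sub>m j * u) = 0" for j
        unfolding hf_def by (subst mat_1x1_eq_iff) (simp_all add: one_mult_dim del: index_mult_mat(1))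
      then show ?thesis by simp
    qed
    then have e: "?S = {(D,u). D \<in> U k \<and> u \<in> carrier_mat k 1 \<and> (\<forall>j. hf (1\<^sub>m k) u (D ^\<^sub>m j * u) = 0) \<and> r * char_poly D = f}"
      by blast
    show ?thesis
    proof (cases "r dvd f")
      case True
      then have "r * p = f \<longleftrightarrow> p = f div r" for p using r0 by auto
      then show ?thesis unfolding e moment_pairs_def using True by simp
    next
      case False
      then have "r * p \<noteq> f" for p by auto
      then show ?thesis unfolding e using False by simp
    qed
  qed
  finally show ?thesis by (simp split: if_splits)
qed

text \<open>The count depends on c only through r: every sequence is reduced to the zero sequence in
  smaller dimension.\<close>

lemma card_moment_pairs_c: "card (moment_pairs c n f) * card (U k) = card (U n) * (if r dvd f then card (moment_pairs (\<lambda>_. 0) k (f div r)) else 0)"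
  using card_moment_pairs_normal_forms[of f] card_normal_forms[of f] by simp

end

section \<open>Hermitian linear recurrences\<close>

lemma lists_poly:
  "finite {p :: 'b::{finite,zero} poly. \<forall>i\<ge>d. coeff p i = 0} \<and>
   card {p :: 'b poly. \<forall>i\<ge>d. coeff p i = 0} = card (UNIV :: 'b set) ^ d"
proof -
  let ?L = "{xs :: 'b list. set xs \<subseteq> UNIV \<and> length xs = d}"
  have b: "bij_betw (\<lambda>p. map (coeff p) [0..<d]) {p :: 'b poly. \<forall>i\<ge>d. coeff p i = 0} ?L"
  proof (rule bij_betwI[where g = Poly])
    fix p :: "'b poly" assume "p \<in> {p. \<forall>i\<ge>d. coeff p i = 0}"
    then show "Poly (map (coeff p) [0..<d]) = p"
      by (intro poly_eqI) (auto simp: nth_default_def)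
  next
    fix xs :: "'b list" assume "xs \<in> ?L"
    then show "map (coeff (Poly xs)) [0..<d] = xs"
      by (intro nth_equalityI) (auto simp: nth_default_def)
  qed (auto simp: nth_default_def)
  have "finite ?L" by (rule finite_lists_length_eq) simp
  moreover have "card ?L = card (UNIV :: 'b set) ^ d" by (rule card_lists_length_eq) simp
  ultimately show ?thesis using bij_betw_finite[OF b] bij_betw_same_card[OF b] by simp
qed

text \<open>The polynomial p in the shift operator. Sequences are two-sided so that the shift is
  invertible and the symmetry c (- k) = cj (c k) makes sense.\<close>

definition act :: "'b::comm_semiring_1 poly \<Rightarrow> (int \<Rightarrow> 'b) \<Rightarrow> int \<Rightarrow> 'b" where
  "act p c k = (\<Sum>i\<le>degree p. coeff p i * c (k + int i))"

lemma act_bound: "degree p \<le> N \<Longrightarrow> act p c k = (\<Sum>i\<le>N. coeff p i * c (k + int i))"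
  unfolding act_def by (rule sum.mono_neutral_left) (auto simp: coeff_eq_0)

lemma act_0 [simp]: "act 0 c k = 0" by (simp add: act_def)

lemma act_add: "act (p + s) c k = act p c k + act s c k"
proof -
  let ?N = "max (degree p) (degree s)"
  have "act (p + s) c k = (\<Sum>i\<le>?N. coeff (p + s) i * c (k + int i))"
    by (rule act_bound) (simp add: degree_add_le)
  then show ?thesis by (simp add: act_bound[of p ?N] act_bound[of s ?N] algebra_simps sum.distrib)
qed

lemma act_smult: "act (Polynomial.smult a p) c k = a * act p c k"
  by (subst act_bound[of _ "degree p"]) (auto simp: degree_smult_le act_def sum_distrib_left mult_ac)

lemma act_pCons: "act (pCons a p) c k = a * c k + act p c (k + 1)"
proof -
  have "act (pCons a p) c k = (\<Sum>i\<le>Suc (degree p). coeff (pCons a p) i * c (k + int i))"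
    by (rule act_bound) (simp add: degree_pCons_le)
  then show ?thesis unfolding sum.atMost_Suc_shift by (simp add: act_def add.assoc)
qed

lemma act_zero_seq [simp]: "act p (\<lambda>_. 0) k = 0" by (simp add: act_def)

lemma act_mult: "act (p * s) c k = act p (act s c) k"
proof (induction p arbitrary: k)
  case (pCons a p)
  have "act (pCons a p * s) c k = act (Polynomial.smult a s + pCons 0 (p * s)) c k" by simp
  also have "\<dots> = a * act s c k + act (p * s) c (k + 1)" unfolding act_add act_smult act_pCons by simp
  finally show ?case by (simp add: pCons.IH act_pCons)
qed simp

definition kills :: "'b::comm_semiring_1 poly \<Rightarrow> (int \<Rightarrow> 'b) \<Rightarrow> bool" where
  "kills p c \<longleftrightarrow> (\<forall>k. act p c k = 0)"

lemma kills_mult: "kills p c \<Longrightarrow> kills (s * p) c"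
proof -
  assume "kills p c"
  then have "act p c = (\<lambda>_. 0)" by (auto simp: kills_def)
  then show ?thesis by (simp add: kills_def act_mult)
qed

lemma kills_dvd: "kills p c \<Longrightarrow> p dvd s \<Longrightarrow> kills s c"
  by (auto elim!: dvdE simp: mult.commute[of p] intro: kills_mult)

lemma kills_one: "kills 1 c \<longleftrightarrow> c = (\<lambda>_. 0)"
  by (auto simp: kills_def act_def fun_eq_iff)

lemma act_diff: "act (p - s) c k = act p c k - act s c k" for p s :: "'b::comm_ring_1 poly"
  using act_add[of "p - s" s c k] by simp

lemma ex_minimal_poly:
  fixes c :: "int \<Rightarrow> 'b::{field}"
  assumes "kills P c" "P \<noteq> 0"
  shows "\<exists>r. monic r \<and> (\<forall>p. kills p c \<longleftrightarrow> r dvd p)"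
proof -
  define d where "d = (LEAST d. \<exists>p. kills p c \<and> p \<noteq> 0 \<and> degree p = d)"
  have "\<exists>p. kills p c \<and> p \<noteq> 0 \<and> degree p = d"
    unfolding d_def by (rule LeastI_ex) (use assms in auto)
  then obtain p0 where p0: "kills p0 c" "p0 \<noteq> 0" "degree p0 = d" by auto
  have least: "d \<le> degree p" if "kills p c" "p \<noteq> 0" for p
    unfolding d_def by (rule Least_le) (use that in auto)
  define r where "r = Polynomial.smult (inverse (lead_coeff p0)) p0"
  have r: "monic r" "degree r = d" "r \<noteq> 0" using p0 by (auto simp: r_def)
  have rk: "kills r c" using p0(1) by (simp add: r_def kills_def act_smult)
  have "kills p c \<longleftrightarrow> r dvd p" for p
  proof
    assume p: "kills p c"
    have "kills (p div r * r) c" using rk by (rule kills_mult)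
    then have "kills (p mod r) c" using p unfolding minus_div_mult_eq_mod[symmetric] kills_def act_diff by simp
    then have "p mod r = 0" using least degree_mod_less[OF r(3), of p] r(2) by (metis not_le)
    then show "r dvd p" by auto
  qed (use rk kills_dvd in blast)
  then show ?thesis using r by blast
qed

definition minpoly :: "(int \<Rightarrow> 'b::field) \<Rightarrow> 'b poly" where
  "minpoly c = (SOME r. monic r \<and> (\<forall>p. kills p c \<longleftrightarrow> r dvd p))"

lemma minpoly:
  assumes "kills P c" "P \<noteq> 0"
  shows "monic (minpoly c)" "kills p c \<longleftrightarrow> minpoly c dvd p"
  using someI_ex[OF ex_minimal_poly[OF assms]] unfolding minpoly_def by blast+

section \<open>Self-dual polynomials and the sizes of their solution spaces\<close>

context quadratic_extension begin

text \<open>The conjugate reciprocal: coefficients are reversed and raised to the q-th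
  power.\<close>

definition pst :: "'a poly \<Rightarrow> 'a poly" where "pst G = map_poly cj (reflect_poly G)"

text \<open>The scalar is forced, being the leading coefficient of \<open>pst G\<close>.\<close>

definition self_dual :: "'a poly set" where
  "self_dual = {G. monic G \<and> coeff G 0 \<noteq> 0 \<and> pst G = Polynomial.smult (cj (coeff G 0)) G}"

lemma coeff_pst: "coeff (pst G) i = (if i \<le> degree G then cj (coeff G (degree G - i)) else 0)"
  by (simp add: pst_def coeff_map_poly coeff_reflect_poly)

lemma pst_mult: "pst (G * K) = pst G * pst K"
proof -
  have "map_poly cj (p * s) = map_poly cj p * map_poly cj s" for p s
    by (intro poly_eqI) (simp add: coeff_map_poly coeff_mult cj_sum cj_mult)
  then show ?thesis by (simp add: pst_def reflect_poly_mult)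
qed

lemma self_dual_1: "1 \<in> self_dual" by (simp add: self_dual_def pst_def)

lemma self_dual_mult: "G \<in> self_dual \<Longrightarrow> K \<in> self_dual \<Longrightarrow> G * K \<in> self_dual"
  by (auto simp: self_dual_def pst_mult coeff_mult_0 cj_mult lead_coeff_mult mult.commute)

lemma self_dual_nonzero: "G \<in> self_dual \<Longrightarrow> G \<noteq> 0" by (auto simp: self_dual_def)

lemma self_dual_cancel:
  assumes "G \<in> self_dual" "G * K \<in> self_dual" shows "K \<in> self_dual"
proof -
  have G: "monic G" "coeff G 0 \<noteq> 0" "pst G = Polynomial.smult (cj (coeff G 0)) G" "G \<noteq> 0" using assms(1) by (auto simp: self_dual_def)
  have GK: "monic (G * K)" "coeff (G * K) 0 \<noteq> 0" "pst (G * K) = Polynomial.smult (cj (coeff (G * K) 0)) (G * K)" using assms(2) by (auto simp: self_dual_def)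
  have "Polynomial.smult (cj (coeff G 0)) G * pst K = Polynomial.smult (cj (coeff G 0)) G * Polynomial.smult (cj (coeff K 0)) K"
    using GK(3) unfolding pst_mult G(3) by (simp add: coeff_mult_0 cj_mult mult.commute)
  moreover have "Polynomial.smult (cj (coeff G 0)) G \<noteq> 0" using G by simp
  ultimately have "pst K = Polynomial.smult (cj (coeff K 0)) K" by (metis mult_cancel_left)
  then show ?thesis using G GK by (simp add: self_dual_def lead_coeff_mult coeff_mult_0)
qed

definition inv_seq :: "(int \<Rightarrow> 'a) \<Rightarrow> int \<Rightarrow> 'a" where "inv_seq c k = cj (c (- k))"

lemma act_pst: "act (pst G) (inv_seq c) k = cj (act G c (- k - int (degree G)))"
proof -
  have "degree (pst G) \<le> degree G" by (rule degree_le) (simp add: coeff_pst)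
  then have "act (pst G) (inv_seq c) k = (\<Sum>i\<le>degree G. cj (coeff G (degree G - i)) * cj (c (- k - int i)))"
    by (subst act_bound) (auto simp: coeff_pst inv_seq_def intro!: sum.cong)
  also have "\<dots> = (\<Sum>i\<le>degree G. cj (coeff G i) * cj (c (- k - int (degree G - i))))"
    by (rule sum.reindex_bij_witness[of _ "\<lambda>i. degree G - i" "\<lambda>i. degree G - i"]) auto
  also have "\<dots> = cj (act G c (- k - int (degree G)))"
    unfolding act_def cj_sum cj_mult by (intro sum.cong) (auto simp: of_nat_diff algebra_simps)
  finally show ?thesis .
qed

lemma kills_pst: "kills G c \<Longrightarrow> kills (pst G) (inv_seq c)"
  by (simp add: kills_def act_pst)

definition herm_seq :: "(int \<Rightarrow> 'a) \<Rightarrow> bool" where "herm_seq c \<longleftrightarrow> inv_seq c = c"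

lemma herm_seqD: "herm_seq c \<Longrightarrow> c (- k) = cj (c k)"
  unfolding herm_seq_def by (metis inv_seq_def minus_minus)

text \<open>The conjugate reciprocal of the minimal polynomial kills the same hermitian sequence, so
  the minimal polynomial divides it, and the degrees leave only a scalar as quotient.\<close>

lemma minpoly_self_dual:
  assumes "herm_seq c" "kills P c" "P \<noteq> 0" "coeff P 0 \<noteq> 0"
  shows "minpoly c \<in> self_dual"
proof -
  let ?r = "minpoly c"
  note mp = minpoly[OF assms(2,3)]
  have "?r dvd P" using mp(2)[of P] assms(2) by simp
  then have r0: "coeff ?r 0 \<noteq> 0" using assms(4) by (auto elim!: dvdE simp: coeff_mult_0)
  have "kills ?r c" using mp(2)[of ?r] by simp
  then have "kills (pst ?r) c" using kills_pst[of ?r c] assms(1) by (simp add: herm_seq_def)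
  then have dv: "?r dvd pst ?r" using mp(2)[of "pst ?r"] by simp
  then obtain t where t: "pst ?r = ?r * t" by (elim dvdE)
  have "coeff (pst ?r) (degree ?r) = cj (coeff ?r 0)" by (simp add: coeff_pst)
  then have nz: "pst ?r \<noteq> 0" using r0 by auto
  have "degree (pst ?r) \<le> degree ?r" by (rule degree_le) (simp add: coeff_pst)
  then have "degree t = 0" using t nz by (metis degree_mult_eq add_le_same_cancel1 le_zero_eq mult_eq_0_iff)
  then obtain a where a: "t = [:a:]" by (metis degree_eq_zeroE)
  then have sm: "pst ?r = Polynomial.smult a ?r" using t by simp
  then have "a = cj (coeff ?r 0)" using \<open>coeff (pst ?r) (degree ?r) = cj (coeff ?r 0)\<close> mp(1) by simp
  then show ?thesis using mp(1) r0 sm by (simp add: self_dual_def)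
qed

definition solutions :: "'a poly \<Rightarrow> (int \<Rightarrow> 'a) set" where "solutions G = {c. kills G c}"
definition herm_solutions :: "'a poly \<Rightarrow> (int \<Rightarrow> 'a) set" where "herm_solutions G = {c. herm_seq c \<and> kills G c}"

lemma solutions_add: "c \<in> solutions G \<Longrightarrow> c' \<in> solutions G \<Longrightarrow> (\<lambda>k. c k + a * c' k) \<in> solutions G"
  by (simp add: solutions_def kills_def act_def algebra_simps sum.distrib flip: sum_distrib_left)

lemma solutions_shift: "c \<in> solutions G \<Longrightarrow> (\<lambda>k. c (k + l)) \<in> solutions G"
proof -
  assume "c \<in> solutions G"
  moreover have "act G (\<lambda>k. c (k + l)) k = act G c (k + l)" for k
    by (simp add: act_def algebra_simps)
  ultimately show ?thesis by (simp add: solutions_def kills_def)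
qed

lemma solutions_inv: "G \<in> self_dual \<Longrightarrow> c \<in> solutions G \<Longrightarrow> inv_seq c \<in> solutions G"
  using kills_pst[of G c] by (auto simp: solutions_def self_dual_def kills_def act_smult)

text \<open>A nonzero constant coefficient lets the recurrence run backwards too, so deg G
  consecutive values determine the two-sided sequence. The induction enlarges the interval of zeros
  by one at each end.\<close>

lemma solutions_zero:
  assumes G: "monic G" "coeff G 0 \<noteq> 0" and c: "c \<in> solutions G" and z: "\<And>i. i < degree G \<Longrightarrow> c (int i) = 0"
  shows "c k = 0"
proof -
  let ?d = "degree G"
  have act0: "(\<Sum>i\<le>?d. coeff G i * c (l + int i)) = 0" for l using c by (simp add: solutions_def kills_def act_def)
  have "\<forall>j. - int n \<le> j \<and> j < int ?d + int n \<longrightarrow> c j = 0" for n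
  proof (induction n)
    case 0
    show ?case
    proof (intro allI impI)
      fix j assume "- int 0 \<le> j \<and> j < int ?d + int 0"
      then have "j = int (nat j)" "nat j < ?d" by auto
      then show "c j = 0" using z[of "nat j"] by simp
    qed
  next
    case (Suc n)
    have up: "c (int ?d + int n) = 0"
    proof -
      have "(\<Sum>i\<le>?d. coeff G i * c (int n + int i)) = (\<Sum>i<?d. coeff G i * c (int n + int i)) + c (int n + int ?d)"
        using G(1) by (simp flip: lessThan_Suc_atMost)
      moreover have "(\<Sum>i<?d. coeff G i * c (int n + int i)) = 0"
        using Suc by (intro sum.neutral) auto
      ultimately show ?thesis using act0[of "int n"] by (simp add: add.commute)
    qed
    have down: "c (- int (Suc n)) = 0" 
    proof -
      have "(\<Sum>i\<le>?d. coeff G i * c (- int (Suc n) + int i)) = coeff G 0 * c (- int (Suc n))"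
      proof -
        have "(\<Sum>i\<in>{..?d} - {0}. coeff G i * c (- int (Suc n) + int i)) = 0"
        proof (intro sum.neutral ballI)
          fix i assume i: "i \<in> {..?d} - {0}"
          then have "- int n \<le> - int (Suc n) + int i \<and> - int (Suc n) + int i < int ?d + int n" by auto
          then have "c (- int (Suc n) + int i) = 0" using Suc by blast
          then show "coeff G i * c (- int (Suc n) + int i) = 0" by simp
        qed
        then show ?thesis by (simp add: sum.remove[of "{..?d}" 0])
      qed
      then show ?thesis using act0[of "- int (Suc n)"] G(2) by simp
    qed
    show ?case
    proof (intro allI impI)
      fix j assume j: "- int (Suc n) \<le> j \<and> j < int ?d + int (Suc n)"
      show "c j = 0"
      proof (cases "- int n \<le> j \<and> j < int ?d + int n")
        case False
        then have "j = - int (Suc n) \<or> j = int ?d + int n" using j by linarith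
        then show ?thesis using up down by auto
      qed (use Suc in blast)
    qed
  qed
  then have "- int (nat \<bar>k\<bar> + 1) \<le> k \<and> k < int ?d + int (nat \<bar>k\<bar> + 1) \<longrightarrow> c k = 0" by blast
  then show ?thesis by auto
qed

lemma finite_solutions: 
  assumes G: "monic G" "coeff G 0 \<noteq> 0"
  shows "finite (solutions G) \<and> card (solutions G) \<le> (q ^ 2) ^ degree G"
proof -
  let ?d = "degree G"
  let ?f = "\<lambda>c :: int \<Rightarrow> 'a. map (\<lambda>i. c (int i)) [0..<?d]"
  let ?L = "{xs :: 'a list. set xs \<subseteq> UNIV \<and> length xs = ?d}"
  have inj: "inj_on ?f (solutions G)"
  proof (rule inj_onI)
    fix c c' assume c: "c \<in> solutions G" "c' \<in> solutions G" and e: "?f c = ?f c'"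
    have "(\<lambda>k. c k + (- 1) * c' k) \<in> solutions G" by (rule solutions_add[OF c])
    moreover have "c (int i) + (- 1) * c' (int i) = 0" if "i < ?d" for i
      using arg_cong[OF e, of "\<lambda>xs. xs ! i"] that by simp
    ultimately have "c k + (- 1) * c' k = 0" for k using solutions_zero[OF G, of "\<lambda>k. c k + (- 1) * c' k"] by blast
    then show "c = c'" by (auto simp: fun_eq_iff)
  qed
  have sub: "?f ` solutions G \<subseteq> ?L" by auto
  have fin: "finite ?L" by (rule finite_lists_length_eq) simp
  have "card ?L = (q ^ 2) ^ ?d" using card_lists_length_eq[of "UNIV :: 'a set" ?d] card_F by simp
  then show ?thesis using inj_on_finite[OF inj sub fin] card_inj_on_le[OF inj sub fin] by simp
qed

lemma dvd_monom_mult: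
  fixes G :: "'a poly"
  assumes "coeff G 0 \<noteq> 0" "G dvd monom 1 a * p"
  shows "G dvd p"
  using assms(2)
proof (induction a)
  case (Suc a)
  then have "G dvd pCons 0 (monom 1 a * p)" by (simp add: monom_Suc)
  then obtain t where t: "pCons 0 (monom 1 a * p) = G * t" by (elim dvdE)
  obtain b t' where bt: "t = pCons b t'" by (cases t)
  have "coeff G 0 * b = 0" using arg_cong[OF t, of "\<lambda>p. coeff p 0"] bt by (auto simp: coeff_mult_0)
  then have "pCons 0 (monom 1 a * p) = pCons 0 (G * t')" using t bt assms(1) by simp
  then have "G dvd monom 1 a * p" by simp
  then show ?case by (rule Suc.IH)
qed simp

text \<open>X is invertible modulo G and there are finitely many residues, so X has finite
  order.\<close>

lemma ex_period:
  fixes G :: "'a poly"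
  assumes G: "monic G" "coeff G 0 \<noteq> 0"
  shows "\<exists>N>0. G dvd monom 1 N - 1"
proof -
  let ?d = "degree G"
  let ?f = "\<lambda>n. monom (1::'a) n mod G"
  have G0: "G \<noteq> 0" using G by auto
  have "?f n \<in> {p. \<forall>i\<ge>Suc ?d. coeff p i = 0}" for n
    using degree_mod_less[OF G0, of "monom 1 n"] by (auto intro!: coeff_eq_0)
  then have "finite (range ?f)" using lists_poly[of "Suc ?d", where ?'b = 'a] by (meson finite_subset image_subsetI)
  then have "\<not> inj ?f" using finite_imageD infinite_UNIV_nat by blast
  then obtain a b where ab: "?f a = ?f b" "a \<noteq> b" by (auto simp: inj_def)
  have main: "\<exists>N>0. G dvd monom 1 N - 1" if ab: "?f a = ?f b" "a < b" for a b
  proof -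
    have "G dvd monom 1 b - monom 1 a" using ab(1) by (metis mod_eq_dvd_iff)
    also have "monom 1 b - monom 1 a = monom (1::'a) a * (monom 1 (b - a) - 1)"
      using ab(2) by (simp add: algebra_simps mult_monom)
    finally have d: "G dvd monom 1 a * (monom 1 (b - a) - 1)" .
    have "G dvd monom 1 (b - a) - 1" by (rule dvd_monom_mult[OF G(2) d])
    then show ?thesis using ab(2) by (intro exI[of _ "b - a"]) simp
  qed
  show ?thesis using main[of a b] main[of b a] ab by (metis linorder_neqE_nat)
qed

text \<open>The sequence takes k to the coefficient of X^(deg G - 1) in X^k y mod G. Reducing k
  modulo a period N of X gives a meaning to negative powers.\<close>

definition shift_seq :: "'a poly \<Rightarrow> nat \<Rightarrow> 'a poly \<Rightarrow> int \<Rightarrow> 'a" where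
  "shift_seq G N y k = coeff ((monom 1 (nat (k mod int N)) * y) mod G) (degree G - 1)"

lemma monom_period:
  fixes G :: "'a poly"
  assumes "G dvd monom 1 N - 1" shows "G dvd monom 1 (N * j) - 1"
proof -
  have "monom (1::'a) N - 1 dvd monom 1 N ^ j - 1"
    by (metis dvd_triv_left power_diff_1_eq)
  then show ?thesis using assms by (simp add: monom_power dvd_trans)
qed

lemma shift_seq_eq:
  fixes G :: "'a poly"
  assumes N: "N > 0" "G dvd monom 1 N - 1"
  shows "shift_seq G N y (k + int i) = coeff ((monom 1 (nat (k mod int N)) * monom 1 i * y) mod G) (degree G - 1)"
proof -
  let ?a = "nat (k mod int N)"
  have "(k + int i) mod int N = int ((?a + i) mod N)"
    using N(1) by (simp add: zmod_int mod_add_left_eq)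
  then have e: "nat ((k + int i) mod int N) = (?a + i) mod N" by simp
  have "monom (1::'a) (?a + i) - monom 1 ((?a + i) mod N) = monom 1 ((?a + i) mod N) * (monom 1 (N * ((?a + i) div N)) - 1)"
    by (simp add: algebra_simps mult_monom)
  then have "G dvd monom 1 (?a + i) - monom 1 ((?a + i) mod N)" using monom_period[OF N(2)] by simp
  then have "G dvd (monom 1 (?a + i) - monom 1 ((?a + i) mod N)) * y" by (rule dvd_mult2)
  then have "(monom 1 (?a + i) * y) mod G = (monom 1 ((?a + i) mod N) * y) mod G"
    by (simp add: mod_eq_dvd_iff left_diff_distrib)
  then show ?thesis unfolding shift_seq_def e by (simp add: mult_monom)
qed

lemma sum_mod_poly: "(\<Sum>i\<in>A. f i mod G) = (\<Sum>i\<in>A. f i) mod (G :: 'a poly)"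
  by (induction A rule: infinite_finite_induct) (simp_all add: poly_mod_add_left)

lemma shift_seq_solutions:
  fixes G :: "'a poly"
  assumes N: "N > 0" "G dvd monom 1 N - 1"
  shows "shift_seq G N y \<in> solutions G"
proof -
  have "act G (shift_seq G N y) k = 0" for k
  proof -
    let ?m = "monom (1::'a) (nat (k mod int N))"
    have "act G (shift_seq G N y) k = (\<Sum>i\<le>degree G. coeff ((Polynomial.smult (coeff G i) (?m * monom 1 i * y)) mod G) (degree G - 1))"
      unfolding act_def shift_seq_eq[OF N] by (simp add: mod_smult_left)
    also have "\<dots> = coeff ((\<Sum>i\<le>degree G. Polynomial.smult (coeff G i) (?m * monom 1 i * y)) mod G) (degree G - 1)"
      unfolding sum_mod_poly[symmetric] by (simp add: coeff_sum)
    also have "(\<Sum>i\<le>degree G. Polynomial.smult (coeff G i) (?m * monom 1 i * y)) = ?m * y * (\<Sum>i\<le>degree G. monom (coeff G i) i)"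
      unfolding sum_distrib_left
    proof (rule sum.cong[OF refl])
      fix i
      have e: "monom (coeff G i) i = Polynomial.smult (coeff G i) (monom 1 i)" by (simp add: smult_monom)
      show "Polynomial.smult (coeff G i) (?m * monom 1 i * y) = ?m * y * monom (coeff G i) i"
        unfolding e by (simp only: mult_smult_right mult.assoc mult.commute[of y] mult.left_commute)
    qed
    also have "\<dots> = ?m * y * G" by (simp add: poly_as_sum_of_monoms)
    finally show ?thesis by simp
  qed
  then show ?thesis by (simp add: solutions_def kills_def)
qed

text \<open>Initial values bound the number from above. From below, the residues y modulo G embed
  into the solutions through \<open>shift_seq\<close>.\<close>

lemma card_solutions:
  assumes G: "monic G" "coeff G 0 \<noteq> 0"
  shows "card (solutions G) = (q ^ 2) ^ degree G"
proof (cases "degree G = 0")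
  case True
  then have "G = 1" using G(1) by (metis monic_degree_0)
  then have "solutions G = {\<lambda>_. 0}" by (simp add: solutions_def kills_one)
  then show ?thesis using True by simp
next
  case False
  let ?d = "degree G"
  obtain N where N: "N > 0" "G dvd monom 1 N - 1" using ex_period[OF G] by blast
  let ?P = "{p :: 'a poly. \<forall>i\<ge>?d. coeff p i = 0}"
  have lin: "shift_seq G N (x - y) k = shift_seq G N x k - shift_seq G N y k" for x y k
    by (simp add: shift_seq_def right_diff_distrib poly_mod_diff_left)
  have "inj_on (shift_seq G N) ?P"
  proof (rule inj_onI)
    fix x y assume xy: "x \<in> ?P" "y \<in> ?P" "shift_seq G N x = shift_seq G N y"
    define z where "z = x - y"
    have z0: "shift_seq G N z k = 0" for k using lin[of x y k] xy(3) by (simp add: z_def)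
    have zP: "coeff z i = 0" if "i \<ge> ?d" for i using xy that by (simp add: z_def)
    have "z = 0"
    proof (rule ccontr)
      assume nz: "z \<noteq> 0"
      then have dz: "degree z < ?d" using zP by (metis leI leading_coeff_0_iff)
      \<comment> \<open>Shifting by this amount moves the leading coefficient of z to the place that
        \<open>shift_seq\<close> reads, without any reduction modulo G.\<close>
      let ?i = "?d - 1 - degree z"
      have deg: "degree (monom 1 ?i * z) = ?d - 1" using nz dz by (simp add: degree_mult_eq degree_monom_eq)
      then have "(monom 1 ?i * z) mod G = monom 1 ?i * z" using False by (intro mod_poly_less) simp
      then have "shift_seq G N z (0 + int ?i) = coeff (monom 1 ?i * z) (?d - 1)"
        using shift_seq_eq[OF N, of z 0 ?i] by simp
      also have "\<dots> = lead_coeff (monom 1 ?i * z)" using deg by simp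
      also have "\<dots> \<noteq> 0" using nz by simp
      finally show False using z0 by simp
    qed
    then show "x = y" by (simp add: z_def)
  qed
  moreover have "shift_seq G N ` ?P \<subseteq> solutions G" using shift_seq_solutions[OF N] by blast
  ultimately have "card ?P \<le> card (solutions G)" using finite_solutions[OF G] by (intro card_inj_on_le) auto
  then have "(q ^ 2) ^ ?d \<le> card (solutions G)" using lists_poly[of ?d, where ?'b = 'a] card_F by simp
  then show ?thesis using finite_solutions[OF G] by simp
qed

lemma herm_solutions_solutions: "herm_solutions G = {c \<in> solutions G. herm_seq c}" by (auto simp: herm_solutions_def solutions_def)

lemma self_dual_D: "G \<in> self_dual \<Longrightarrow> monic G" "G \<in> self_dual \<Longrightarrow> coeff G 0 \<noteq> 0" by (auto simp: self_dual_def)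

lemma finite_herm_solutions: "G \<in> self_dual \<Longrightarrow> finite (herm_solutions G)"
  using finite_solutions[OF self_dual_D] by (simp add: herm_solutions_solutions)

text \<open>Hermitian solutions form an F_q-structure of the solution space, with 1 and \<theta> as
  basis of the larger field, so their number is the square root of that of all solutions. The
  inverse map solves c = a + \<theta> b and \<open>inv_seq c\<close> = a + cj \<theta> b for a and
  b.\<close>

lemma solutions_herm_solutions:
  assumes G: "G \<in> self_dual" and \<theta>: "cj \<theta> \<noteq> \<theta>"
  shows "bij_betw (\<lambda>(a,b) k. a k + \<theta> * b k) (herm_solutions G \<times> herm_solutions G) (solutions G)"
proof (rule bij_betwI[where g = "\<lambda>c. (\<lambda>k. (cj \<theta> * c k - \<theta> * inv_seq c k) / (cj \<theta> - \<theta>), \<lambda>k. (inv_seq c k - c k) / (cj \<theta> - \<theta>))"])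
  let ?D = "cj \<theta> - \<theta>"
  have D: "?D \<noteq> 0" "cj ?D = - ?D" using \<theta> by (auto simp: cj_diff)
  show "(\<lambda>(a,b) k. a k + \<theta> * b k) \<in> herm_solutions G \<times> herm_solutions G \<rightarrow> solutions G"
    using solutions_add by (auto simp: herm_solutions_solutions)
  show "(\<lambda>c. (\<lambda>k. (cj \<theta> * c k - \<theta> * inv_seq c k) / ?D, \<lambda>k. (inv_seq c k - c k) / ?D)) \<in> solutions G \<rightarrow> herm_solutions G \<times> herm_solutions G"
  proof
    fix c assume c: "c \<in> solutions G"
    have i: "inv_seq c \<in> solutions G" using solutions_inv[OF G c] .
    have z: "(\<lambda>_. 0) \<in> solutions G" by (simp add: solutions_def kills_def)
    have lin: "(\<lambda>k. a * c k + b * inv_seq c k) \<in> solutions G" for a b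
      using solutions_add[OF solutions_add[OF z c] i, of a b] by simp
    have 1: "(\<lambda>k. (cj \<theta> * c k - \<theta> * inv_seq c k) / ?D) \<in> solutions G"
      using lin[of "cj \<theta> / ?D" "- \<theta> / ?D"] by (simp add: diff_divide_distrib)
    have 2: "(\<lambda>k. (inv_seq c k - c k) / ?D) \<in> solutions G"
      using lin[of "- 1 / ?D" "1 / ?D"] by (simp add: diff_divide_distrib)
    have 3: "herm_seq (\<lambda>k. (cj \<theta> * c k - \<theta> * inv_seq c k) / ?D)"
      unfolding herm_seq_def inv_seq_def cj_divide D(2)
      by (simp add: fun_eq_iff cj_diff cj_mult divide_simps D) (simp add: algebra_simps)
    have 4: "herm_seq (\<lambda>k. (inv_seq c k - c k) / ?D)"
      unfolding herm_seq_def inv_seq_def cj_divide D(2)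
      by (simp add: fun_eq_iff cj_diff cj_mult divide_simps D) (simp add: algebra_simps)
    show "(\<lambda>k. (cj \<theta> * c k - \<theta> * inv_seq c k) / ?D, \<lambda>k. (inv_seq c k - c k) / ?D) \<in> herm_solutions G \<times> herm_solutions G"
      using 1 2 3 4 by (simp add: herm_solutions_solutions)
  qed
  show "(\<lambda>k. (cj \<theta> * ((\<lambda>(a,b) k. a k + \<theta> * b k) ab) k - \<theta> * inv_seq ((\<lambda>(a,b) k. a k + \<theta> * b k) ab) k) / ?D,
         \<lambda>k. (inv_seq ((\<lambda>(a,b) k. a k + \<theta> * b k) ab) k - ((\<lambda>(a,b) k. a k + \<theta> * b k) ab) k) / ?D) = ab"
    if ab: "ab \<in> herm_solutions G \<times> herm_solutions G" for ab
  proof -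
    obtain a b where e: "ab = (a,b)" by (cases ab)
    have h: "inv_seq a = a" "inv_seq b = b" using ab e by (auto simp: herm_solutions_def herm_seq_def)
    have i: "inv_seq (\<lambda>k. a k + \<theta> * b k) k = a k + cj \<theta> * b k" for k
      using fun_cong[OF h(1), of k] fun_cong[OF h(2), of k] by (simp add: inv_seq_def cj_add cj_mult)
    have "(cj \<theta> * (a k + \<theta> * b k) - \<theta> * (a k + cj \<theta> * b k)) / ?D = a k" for k
      using D(1) by (simp add: divide_simps) (simp add: algebra_simps)
    moreover have "((a k + cj \<theta> * b k) - (a k + \<theta> * b k)) / ?D = b k" for k
      using D(1) by (simp add: divide_simps) (simp add: algebra_simps)
    ultimately show ?thesis unfolding e split_conv i by simp
  qed
  show "(\<lambda>(a,b) k. a k + \<theta> * b k) (\<lambda>k. (cj \<theta> * c k - \<theta> * inv_seq c k) / ?D, \<lambda>k. (inv_seq c k - c k) / ?D) = c" for c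
    using D(1) by (simp add: fun_eq_iff divide_simps) (simp add: algebra_simps)
qed

lemma card_herm_solutions:
  assumes G: "G \<in> self_dual" shows "card (herm_solutions G) = q ^ degree G"
proof -
  obtain \<theta> where "cj \<theta> \<noteq> \<theta>" using ex_not_Fix by blast
  from bij_betw_same_card[OF solutions_herm_solutions[OF G this]] have "card (herm_solutions G) * card (herm_solutions G) = (q ^ degree G) * (q ^ degree G)"
    using card_solutions[OF self_dual_D[OF G]] by (simp add: card_cartesian_product power2_eq_square power_mult_distrib)
  then show ?thesis by (metis power2_eq_square power2_eq_iff_nonneg zero_le)
qed

lemma herm_solutions_0_in_Fix: "c \<in> herm_solutions G \<Longrightarrow> c 0 \<in> Fix"
  using herm_seqD[of c 0] by (simp add: herm_solutions_def Fix_def)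

text \<open>Evaluation at 0 is a linear functional over \<open>Fix\<close> on the hermitian
  solutions. It is not zero, because a shift-invariant space all of whose members vanish at 0 is
  trivial; so its fibres are translates of each other.\<close>

lemma card_herm_solutions_0_1:
  assumes G: "G \<in> self_dual" "degree G > 0"
  shows "card {c \<in> herm_solutions G. c 0 = 0} = card {c \<in> herm_solutions G. c 0 = 1}"
proof -
  obtain \<theta> where \<theta>: "cj \<theta> \<noteq> \<theta>" using ex_not_Fix by blast
  have "\<exists>c \<in> solutions G. c 0 \<noteq> 0"
  proof (rule ccontr)
    assume "\<not> ?thesis"
    then have z: "c 0 = 0" if "c \<in> solutions G" for c using that by blast
    have "c = (\<lambda>_. 0)" if "c \<in> solutions G" for c
    proof
      fix k show "c k = 0" using z[OF solutions_shift[OF that, of k]] by simp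
    qed
    then have "solutions G \<subseteq> {\<lambda>_. 0}" by blast
    then have "card (solutions G) \<le> 1" using card_mono[of "{\<lambda>_::int. 0::'a}"] by simp
    moreover have "1 < q ^ (2 * degree G)" using G(2) q_ge_2 by (intro one_less_power) auto
    then have "card (solutions G) > 1" using card_solutions[OF self_dual_D[OF G(1)]] by (simp flip: power_mult)
    ultimately show False by simp
  qed
  then obtain c where c: "c \<in> solutions G" "c 0 \<noteq> 0" by blast
  have "c \<in> (\<lambda>(a,b) k. a k + \<theta> * b k) ` (herm_solutions G \<times> herm_solutions G)"
    using c(1) solutions_herm_solutions[OF G(1) \<theta>] by (simp add: bij_betw_def)
  then obtain a b where ab: "a \<in> herm_solutions G" "b \<in> herm_solutions G" "c = (\<lambda>k. a k + \<theta> * b k)" by auto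
  then have "a 0 \<noteq> 0 \<or> b 0 \<noteq> 0" using c(2) by auto
  then obtain e where e: "e \<in> herm_solutions G" "e 0 \<noteq> 0" using ab by blast
  have sc: "(\<lambda>k. x k + t * y k) \<in> herm_solutions G" if "x \<in> herm_solutions G" "y \<in> herm_solutions G" "t \<in> Fix" for x y t
  proof -
    have "inv_seq (\<lambda>k. x k + t * y k) = (\<lambda>k. x k + t * y k)"
      using that unfolding herm_solutions_def herm_seq_def inv_seq_def by (auto simp: fun_eq_iff cj_add cj_mult Fix_def)
    then show ?thesis using that solutions_add by (auto simp: herm_solutions_solutions herm_seq_def)
  qed
  let ?t = "inverse (e 0)"
  have t: "?t \<in> Fix" "- ?t \<in> Fix" using herm_solutions_0_in_Fix[OF e(1)] Fix_inverse Fix_diff[of 0 ?t] by auto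
  have "bij_betw (\<lambda>c k. c k + ?t * e k) {c \<in> herm_solutions G. c 0 = 0} {c \<in> herm_solutions G. c 0 = 1}"
    by (rule bij_betwI[where g = "\<lambda>c k. c k + (- ?t) * e k"])
       (use sc[OF _ e(1) t(1)] sc[OF _ e(1) t(2)] e(2) in auto)
  then show ?thesis by (rule bij_betw_same_card)
qed

definition herm_with_minpoly :: "'a poly \<Rightarrow> (int \<Rightarrow> 'a) set" where "herm_with_minpoly r = {c \<in> herm_solutions r. minpoly c = r}"

definition sd_divisors :: "'a poly \<Rightarrow> 'a poly set" where "sd_divisors f = {r \<in> self_dual. r dvd f}"

lemma finite_sd_divisors: "f \<noteq> 0 \<Longrightarrow> finite (sd_divisors f)"
proof -
  assume f: "f \<noteq> 0"
  have "sd_divisors f \<subseteq> {p. \<forall>i\<ge>Suc (degree f). coeff p i = 0}"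
    using f by (auto simp: sd_divisors_def intro!: coeff_eq_0 dest: dvd_imp_degree_le)
  then show ?thesis using lists_poly[of "Suc (degree f)", where ?'b = 'a] finite_subset by blast
qed

lemma herm_solutions_herm_with_minpoly:
  assumes G: "G \<in> self_dual"
  shows "herm_solutions G = (\<Union>r\<in>sd_divisors G. herm_with_minpoly r)"
proof (intro equalityI subsetI)
  fix c assume c: "c \<in> herm_solutions G"
  then have k: "kills G c" "herm_seq c" by (auto simp: herm_solutions_def)
  note mp = minpoly[OF k(1) self_dual_nonzero[OF G]]
  have "minpoly c \<in> self_dual" by (rule minpoly_self_dual[OF k(2,1) self_dual_nonzero[OF G] self_dual_D(2)[OF G]])
  moreover have "minpoly c dvd G" using mp(2)[of G] k(1) by simp
  ultimately have "minpoly c \<in> sd_divisors G" by (simp add: sd_divisors_def)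
  moreover have "kills (minpoly c) c" using mp(2)[of "minpoly c"] by simp
  then have "c \<in> herm_with_minpoly (minpoly c)" using k(2) by (simp add: herm_with_minpoly_def herm_solutions_def)
  ultimately show "c \<in> (\<Union>r\<in>sd_divisors G. herm_with_minpoly r)" by blast
next
  fix c assume "c \<in> (\<Union>r\<in>sd_divisors G. herm_with_minpoly r)"
  then show "c \<in> herm_solutions G" using kills_dvd by (auto simp: sd_divisors_def herm_with_minpoly_def herm_solutions_def)
qed

lemma sum_herm_solutions:
  fixes g :: "_ \<Rightarrow> real"
  assumes G: "G \<in> self_dual"
  shows "(\<Sum>c\<in>herm_solutions G. g c) = (\<Sum>r\<in>sd_divisors G. \<Sum>c\<in>herm_with_minpoly r. g c)"
  unfolding herm_solutions_herm_with_minpoly[OF G]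
proof (rule sum.UNION_disjoint)
  show "finite (sd_divisors G)" by (rule finite_sd_divisors[OF self_dual_nonzero[OF G]])
  show "\<forall>i\<in>sd_divisors G. finite (herm_with_minpoly i)" using finite_herm_solutions by (auto simp: sd_divisors_def herm_with_minpoly_def)
qed (auto simp: herm_with_minpoly_def)

text \<open>Summed over the norms of all vectors of length $n$ this weight gives exactly $(-q)^n$.\<close>
definition norm_weight :: "'a \<Rightarrow> real" where "norm_weight t = (if t = 0 then 1 else if t = 1 then - 1 else 0)"

lemma sum_norm_weight: "finite A \<Longrightarrow> (\<Sum>x\<in>A. norm_weight (g x)) = real (card {x\<in>A. g x = 0}) - real (card {x\<in>A. g x = 1})"
proof -
  assume A: "finite A"
  have "(\<Sum>x\<in>A. norm_weight (g x)) = (\<Sum>x\<in>A. (if g x = 0 then 1 else 0) - (if g x = 1 then 1 else 0))"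
    by (intro sum.cong) (auto simp: norm_weight_def)
  also have "\<dots> = real (card {x\<in>A. g x = 0}) - real (card {x\<in>A. g x = 1})"
    using A by (simp add: sum_subtractf sum.If_cases Int_def)
  finally show ?thesis .
qed

text \<open>The fibres over 0 and 1 have equal size and cancel, unless only the zero sequence is
  present. In terms of convolutions, the signed weight is inverse to the constant function
  1.\<close>

lemma sum_herm_solutions_norm_weight:
  assumes G: "G \<in> self_dual"
  shows "(\<Sum>c\<in>herm_solutions G. norm_weight (c 0)) = (if G = 1 then 1 else 0)"
proof (cases "degree G = 0")
  case True
  then have "G = 1" using self_dual_D(1)[OF G] by (metis monic_degree_0)
  moreover have "herm_solutions 1 = {\<lambda>_. 0}" by (auto simp: herm_solutions_def kills_one herm_seq_def inv_seq_def)
  ultimately show ?thesis by (simp add: norm_weight_def)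
next
  case False
  then have "G \<noteq> 1" by auto
  then show ?thesis using sum_norm_weight[OF finite_herm_solutions[OF G], of "\<lambda>c. c 0"] card_herm_solutions_0_1[OF G] False by simp
qed

end

section \<open>The recursion for the distribution of characteristic polynomials\<close>

context quadratic_extension begin

text \<open>The left factor is evaluated at self-dual divisors only, the right one at arbitrary
  cofactors; the operation is commutative only at self-dual arguments, where cofactors are again
  self-dual.\<close>

definition conv :: "('a poly \<Rightarrow> real) \<Rightarrow> ('a poly \<Rightarrow> real) \<Rightarrow> 'a poly \<Rightarrow> real" where
  "conv g h f = (\<Sum>r\<in>sd_divisors f. g r * h (f div r))"

lemma monic_nonzero: "monic (f :: 'a poly) \<Longrightarrow> f \<noteq> 0" by auto

lemma sd_divisors_D:
  assumes f: "monic f" and r: "r \<in> sd_divisors f"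
  shows "r \<in> self_dual" "f = r * (f div r)" "monic (f div r)" "r \<noteq> 0" "degree f = degree r + degree (f div r)"
proof -
  show "r \<in> self_dual" using r by (simp add: sd_divisors_def)
  then show r0: "r \<noteq> 0" by (rule self_dual_nonzero)
  show e: "f = r * (f div r)" using r by (simp add: sd_divisors_def)
  have "lead_coeff f = lead_coeff r * lead_coeff (f div r)" by (metis e lead_coeff_mult)
  then show m: "monic (f div r)" using f self_dual_D(1)[OF \<open>r \<in> self_dual\<close>] by simp
  then have "f div r \<noteq> 0" by auto
  then show "degree f = degree r + degree (f div r)" using e r0 by (metis degree_mult_eq)
qed

lemma sd_divisors_self_dual:
  assumes "K \<in> self_dual" "r \<in> sd_divisors K"
  shows "K div r \<in> self_dual" "K div r \<in> sd_divisors K" "K div (K div r) = r"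
proof -
  have r: "r \<in> self_dual" "K = r * (K div r)" "r \<noteq> 0" using sd_divisors_D[OF self_dual_D(1)[OF assms(1)] assms(2)] by auto
  show 1: "K div r \<in> self_dual" using self_dual_cancel[OF r(1)] r(2) assms(1) by metis
  have K0: "K div r \<noteq> 0" using 1 self_dual_nonzero by blast
  have "K div r dvd K" using r(2) by (metis dvd_triv_right)
  then show "K div r \<in> sd_divisors K" using 1 by (simp add: sd_divisors_def)
  show "K div (K div r) = r" using r(2) K0 by (metis nonzero_mult_div_cancel_right)
qed

lemma conv_comm: "K \<in> self_dual \<Longrightarrow> conv g h K = conv h g K"
  unfolding conv_def
  by (rule sum.reindex_bij_witness[of _ "\<lambda>r. K div r" "\<lambda>r. K div r"]) (auto simp: sd_divisors_self_dual mult.commute)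

lemma conv_cong:
  assumes "monic f" "\<And>r. r \<in> self_dual \<Longrightarrow> g r = g' r" "\<And>p. monic p \<Longrightarrow> h p = h' p"
  shows "conv g h f = conv g' h' f"
  unfolding conv_def using assms(2,3) sd_divisors_D(1,3)[OF assms(1)] by (intro sum.cong) auto

text \<open>Both sides sum over factorizations f = r t p with r and t self-dual. They are regrouped
  by K = r t, and \<open>self_dual_cancel\<close> ensures that K div r is self-dual.\<close>

lemma conv_assoc:
  assumes f: "monic f"
  shows "conv g1 (conv g2 h) f = conv (conv g1 g2) h f"
proof -
  have f0: "f \<noteq> 0" using f by auto
  have fin: "finite (sd_divisors f)" by (rule finite_sd_divisors[OF f0])
  have fin1: "finite (sd_divisors (f div r))" if "r \<in> sd_divisors f" for r
    using sd_divisors_D(3)[OF f that] monic_nonzero finite_sd_divisors by blast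
  have fin2: "finite (sd_divisors r)" if "r \<in> sd_divisors f" for r using sd_divisors_D(4)[OF f that] finite_sd_divisors by blast
  have "conv g1 (conv g2 h) f = (\<Sum>r\<in>sd_divisors f. \<Sum>t\<in>sd_divisors (f div r). g1 r * g2 t * h (f div r div t))"
    unfolding conv_def by (simp add: sum_distrib_left mult.assoc)
  also have "\<dots> = (\<Sum>(r,t)\<in>(SIGMA r:sd_divisors f. sd_divisors (f div r)). g1 r * g2 t * h (f div r div t))"
    by (subst sum.Sigma) (use fin fin1 in auto)
  also have "\<dots> = (\<Sum>(K,r)\<in>(SIGMA K:sd_divisors f. sd_divisors K). g1 r * g2 (K div r) * h (f div K))"
  proof (rule sum.reindex_bij_witness[of _ "\<lambda>(K,r). (r, K div r)" "\<lambda>(r,t). (r * t, r)"])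
    fix x assume "x \<in> (SIGMA r:sd_divisors f. sd_divisors (f div r))"
    then obtain r t where x: "x = (r,t)" "r \<in> sd_divisors f" "t \<in> sd_divisors (f div r)" by auto
    note r = sd_divisors_D[OF f x(2)]
    note t = sd_divisors_D[OF r(3) x(3)]
    show "(\<lambda>(K,r). (r, K div r)) ((\<lambda>(r,t). (r * t, r)) x) = x" using x(1) r(4) by simp
    have "f = (r * t) * (f div r div t)" using r(2) t(2) by (metis mult.assoc)
    then have "r * t dvd f" by (metis dvd_triv_left)
    then have "r * t \<in> sd_divisors f" using self_dual_mult[OF r(1) t(1)] by (simp add: sd_divisors_def)
    then show "(\<lambda>(r,t). (r * t, r)) x \<in> (SIGMA K:sd_divisors f. sd_divisors K)" using x(1) r(1) by (simp add: sd_divisors_def)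
    show "(case (\<lambda>(r,t). (r * t, r)) x of (K,r) \<Rightarrow> g1 r * g2 (K div r) * h (f div K)) = (case x of (r,t) \<Rightarrow> g1 r * g2 t * h (f div r div t))"
      using x(1) r(4) by (simp add: poly_div_mult_right)
  next
    fix y assume "y \<in> (SIGMA K:sd_divisors f. sd_divisors K)"
    then obtain K r where y: "y = (K,r)" "K \<in> sd_divisors f" "r \<in> sd_divisors K" by auto
    note K = sd_divisors_D[OF f y(2)]
    have r: "r \<in> self_dual" "K = r * (K div r)" "r \<noteq> 0" using sd_divisors_D[OF self_dual_D(1)[OF K(1)] y(3)] by auto
    show "(\<lambda>(r,t). (r * t, r)) ((\<lambda>(K,r). (r, K div r)) y) = y" using y(1) r(2) by simp
    have "r dvd f" using r(2) K(2) by (metis dvd_mult2 dvd_triv_left)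
    then have rf: "r \<in> sd_divisors f" using r(1) by (simp add: sd_divisors_def)
    have "f div r = (K div r) * (f div K)" using K(2) r(2,3) by (metis mult.assoc nonzero_mult_div_cancel_left)
    then have "K div r dvd f div r" by simp
    then have "K div r \<in> sd_divisors (f div r)" using sd_divisors_self_dual(1)[OF K(1) y(3)] by (simp add: sd_divisors_def)
    then show "(\<lambda>(K,r). (r, K div r)) y \<in> (SIGMA r:sd_divisors f. sd_divisors (f div r))" using y(1) rf by simp
  qed
  also have "\<dots> = (\<Sum>K\<in>sd_divisors f. \<Sum>r\<in>sd_divisors K. g1 r * g2 (K div r) * h (f div K))"
    by (subst sum.Sigma) (use fin fin2 in auto)
  also have "\<dots> = conv (conv g1 g2) h f"
    unfolding conv_def by (simp add: sum_distrib_right)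
  finally show ?thesis .
qed

lemma one_in_sd_divisors: "1 \<in> sd_divisors f" by (simp add: sd_divisors_def self_dual_1)

text \<open>The divisor 1 contributes the value at f itself and all other divisors involve lower
  degrees, so induction on the degree applies.\<close>

lemma conv_one_cancel:
  assumes "\<And>f. monic f \<Longrightarrow> conv (\<lambda>_. 1) x f = conv (\<lambda>_. 1) y f" "monic f"
  shows "x f = y f"
  using assms(2)
proof (induction "degree f" arbitrary: f rule: less_induct)
  case less
  have fin: "finite (sd_divisors f)" by (rule finite_sd_divisors) (use less.prems in auto)
  have "(\<Sum>r\<in>sd_divisors f - {1}. 1 * x (f div r)) = (\<Sum>r\<in>sd_divisors f - {1}. 1 * y (f div r))"
  proof (rule sum.cong[OF refl])
    fix r assume r: "r \<in> sd_divisors f - {1}"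
    note d = sd_divisors_D[OF less.prems, of r]
    have "degree r \<noteq> 0" using r d(1) self_dual_D(1) by (metis DiffD1 DiffD2 insertI1 monic_degree_0)
    then show "1 * x (f div r) = 1 * y (f div r)" using less.hyps[of "f div r"] d r by simp
  qed
  then show ?case using assms(1)[OF less.prems] fin one_in_sd_divisors[of f]
    unfolding conv_def by (simp add: sum.remove[of "sd_divisors f" 1])
qed

section \<open>The number of vectors of given norm\<close>

definition norm_count :: "nat \<Rightarrow> 'a \<Rightarrow> nat" where
  "norm_count n t = card {xs. length xs = n \<and> (\<Sum>x\<leftarrow>xs. x * cj x) = t}"

lemma finite_lists: "finite {xs :: 'a list. length xs = n \<and> P xs}"
  by (rule finite_subset[OF _ finite_lists_length_eq[of "UNIV :: 'a set" n]]) auto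

lemma sum_norm_Fix: "(\<Sum>x\<leftarrow>xs. x * cj x) \<in> Fix"
  by (induction xs) (auto intro: Fix_add norm_in_Fix)

lemma sum_norm_count: "(\<Sum>t\<in>Fix. norm_count n t) = q ^ (2 * n)"
proof -
  have "(\<Sum>t\<in>Fix. norm_count n t) = card (\<Union>t\<in>Fix. {xs. length xs = n \<and> (\<Sum>x\<leftarrow>xs. x * cj x) = t})"
    unfolding norm_count_def by (subst card_UN_disjoint) (auto simp: finite_lists)
  also have "(\<Union>t\<in>Fix. {xs. length xs = n \<and> (\<Sum>x\<leftarrow>xs. x * cj x) = t}) = {xs. set xs \<subseteq> UNIV \<and> length xs = n}"
    using sum_norm_Fix by auto
  also have "card \<dots> = q ^ (2 * n)" by (subst card_lists_length_eq) (auto simp: card_F power_mult)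
  finally show ?thesis .
qed

text \<open>Split off one coordinate. Its norm is 0 for one value and equals each nonzero element of
  \<open>Fix\<close> for q + 1 values; the counts for dimension n over all norms add up to
  q^(2n).\<close>

lemma norm_count_Suc: "t \<in> Fix \<Longrightarrow> real (norm_count (Suc n) t) = (real q + 1) * real q ^ (2 * n) - real q * real (norm_count n t)"
proof -
  assume t: "t \<in> Fix"
  have "{xs. length xs = Suc n \<and> (\<Sum>x\<leftarrow>xs. x * cj x) = t} =
     (\<Union>x\<in>UNIV. (#) x ` {xs. length xs = n \<and> (\<Sum>x\<leftarrow>xs. x * cj x) = t - x * cj x})"
  proof (intro equalityI subsetI)
    fix xs assume "xs \<in> {xs. length xs = Suc n \<and> (\<Sum>x\<leftarrow>xs. x * cj x) = t}"
    then obtain x ys where "xs = x # ys" "length ys = n" "x * cj x + (\<Sum>x\<leftarrow>ys. x * cj x) = t"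
      by (auto simp: length_Suc_conv)
    then show "xs \<in> (\<Union>x\<in>UNIV. (#) x ` {xs. length xs = n \<and> (\<Sum>x\<leftarrow>xs. x * cj x) = t - x * cj x})"
      by (auto simp: algebra_simps)
  qed auto
  then have "norm_count (Suc n) t = (\<Sum>x\<in>UNIV. card ((#) x ` {xs. length xs = n \<and> (\<Sum>x\<leftarrow>xs. x * cj x) = t - x * cj x}))"
    unfolding norm_count_def by (simp only:) (rule card_UN_disjoint, auto simp: finite_lists)
  also have "\<dots> = (\<Sum>x\<in>UNIV. norm_count n (t - x * cj x))"
    unfolding norm_count_def by (intro sum.cong refl card_image) auto
  also have "\<dots> = (\<Sum>s\<in>Fix. \<Sum>x\<in>{x \<in> UNIV. x * cj x = s}. norm_count n (t - x * cj x))"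
    by (rule sum.group[symmetric]) (auto intro: norm_in_Fix)
  also have "\<dots> = (\<Sum>s\<in>Fix. card {x. x * cj x = s} * norm_count n (t - s))" by simp
  also have "\<dots> = card {x. x * cj x = 0} * norm_count n t + (\<Sum>s\<in>Fix - {0}. card {x. x * cj x = s} * norm_count n (t - s))"
    by (subst sum.remove[of _ 0]) auto
  also have "{x. x * cj x = 0} = {0}" by auto
  also have "(\<Sum>s\<in>Fix - {0}. card {x. x * cj x = s} * norm_count n (t - s)) = (q + 1) * (\<Sum>s\<in>Fix - {0}. norm_count n (t - s))"
    unfolding sum_distrib_left by (intro sum.cong) (auto simp: norm_fibre)
  finally have 1: "norm_count (Suc n) t = norm_count n t + (q + 1) * (\<Sum>s\<in>Fix - {0}. norm_count n (t - s))" by simp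
  have "(\<Sum>s\<in>Fix. norm_count n (t - s)) = (\<Sum>s\<in>Fix. norm_count n s)"
    by (rule sum.reindex_bij_witness[of _ "\<lambda>s. t - s" "\<lambda>s. t - s"]) (auto intro: Fix_diff t)
  then have 2: "norm_count n t + (\<Sum>s\<in>Fix - {0}. norm_count n (t - s)) = q ^ (2 * n)"
    unfolding sum_norm_count by (subst (asm) sum.remove[of _ 0]) auto
  have 3: "real (\<Sum>s\<in>Fix - {0}. norm_count n (t - s)) = real q ^ (2 * n) - real (norm_count n t)"
    using arg_cong[OF 2, of real] by simp
  show ?thesis unfolding 1 of_nat_add of_nat_mult 3 by (simp add: algebra_simps)
qed

lemma norm_count_diff: "real (norm_count n 0) - real (norm_count n 1) = (- real q) ^ n"
proof (induction n)
  case 0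
  have "{xs :: 'a list. length xs = 0 \<and> (\<Sum>x\<leftarrow>xs. x * cj x) = 0} = {[]}" "{xs :: 'a list. length xs = 0 \<and> (\<Sum>x\<leftarrow>xs. x * cj x) = 1} = {}" by auto
  then show ?case unfolding norm_count_def by simp
next
  case (Suc n)
  have "real (norm_count (Suc n) 0) - real (norm_count (Suc n) 1) = - real q * (real (norm_count n 0) - real (norm_count n 1))"
    by (simp add: norm_count_Suc algebra_simps)
  then show ?case using Suc by simp
qed

lemma sum_norm_weight_vectors: "(\<Sum>v\<in>carrier_mat n 1. norm_weight (hf (1\<^sub>m n) v v)) = (- real q) ^ n"
proof -
  have card_eq: "card {v \<in> carrier_mat n 1. hf (1\<^sub>m n) v v = t} = norm_count n t" for t
  proof -
    have "bij_betw (\<lambda>v. map (\<lambda>i. v $$ (i,0)) [0..<n]) {v \<in> carrier_mat n 1. hf (1\<^sub>m n) v v = t}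
      {xs. length xs = n \<and> (\<Sum>x\<leftarrow>xs. x * cj x) = t}"
    proof (rule bij_betwI[where g = "\<lambda>xs. mat n 1 (\<lambda>(i,_). xs ! i)"])
      have hf: "hf (1\<^sub>m n) v v = (\<Sum>i<n. v $$ (i,0) * cj (v $$ (i,0)))" if "v \<in> carrier_mat n 1" for v
      proof -
        have [simp]: "dim_row v = n" "dim_col v = 1" using that by auto
        show ?thesis unfolding hf_def by (simp add: one_mult_dim mult_index_1 st_index mult.commute del: index_mult_mat(1))
      qed
      show "(\<lambda>v. map (\<lambda>i. v $$ (i,0)) [0..<n]) \<in> {v \<in> carrier_mat n 1. hf (1\<^sub>m n) v v = t} \<rightarrow> {xs. length xs = n \<and> (\<Sum>x\<leftarrow>xs. x * cj x) = t}"
        using hf by (auto simp: comp_def interv_sum_list_conv_sum_set_nat atLeast0LessThan)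
      show "(\<lambda>xs. mat n 1 (\<lambda>(i,_). xs ! i)) \<in> {xs. length xs = n \<and> (\<Sum>x\<leftarrow>xs. x * cj x) = t} \<rightarrow> {v \<in> carrier_mat n 1. hf (1\<^sub>m n) v v = t}"
        using hf by (auto simp: sum_list_sum_nth atLeast0LessThan)
    next
      fix v assume "v \<in> {v \<in> carrier_mat n 1. hf (1\<^sub>m n) v v = t}"
      then show "mat n 1 (\<lambda>(i,_). map (\<lambda>i. v $$ (i,0)) [0..<n] ! i) = v" by (intro eq_matI) auto
    next
      fix xs :: "'a list" assume "xs \<in> {xs. length xs = n \<and> (\<Sum>x\<leftarrow>xs. x * cj x) = t}"
      then show "map (\<lambda>i. mat n 1 (\<lambda>(i,_). xs ! i) $$ (i,0)) [0..<n] = xs" by (intro nth_equalityI) auto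
    qed
    then show ?thesis unfolding norm_count_def by (rule bij_betw_same_card)
  qed
  show ?thesis using sum_norm_weight[OF conjunct1[OF card_carrier_mat[of n 1]], of "\<lambda>v. hf (1\<^sub>m n) v v"] norm_count_diff[of n]
    unfolding card_eq by simp
qed

section \<open>From moment sequences to the recursion\<close>

lemma U_pow: "M \<in> U n \<Longrightarrow> M ^\<^sub>m j \<in> U n"
proof (induction j)
  case 0
  then have "dim_row M = n" using U_D by blast
  then show ?case using one_in_U by simp
next
  case (Suc j)
  have [simp]: "dim_row M = n" "dim_col M = n" using U_D[OF Suc.prems] by auto
  have "st (M ^\<^sub>m j * M) * (M ^\<^sub>m j * M) = st M * ((st (M ^\<^sub>m j) * M ^\<^sub>m j) * M)" by (simp add: st_mult mult_assoc_dim)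
  also have "\<dots> = 1\<^sub>m n" using U_D(3)[OF Suc.IH[OF Suc.prems]] U_D(3)[OF Suc.prems] by (simp add: one_mult_dim)
  finally have "M ^\<^sub>m j * M \<in> U n" by (intro U_I) simp_all
  then show ?case by simp
qed

lemma U_period: "M \<in> U n \<Longrightarrow> \<exists>N>0. M ^\<^sub>m N = 1\<^sub>m n"
proof -
  assume M: "M \<in> U n"
  have [simp]: "dim_row M = n" "dim_col M = n" using U_D[OF M] by auto
  have "range (\<lambda>j. M ^\<^sub>m j) \<subseteq> U n" using U_pow[OF M] by blast
  then have "finite (range (\<lambda>j. M ^\<^sub>m j))" using finite_UH finite_subset by blast
  then have "\<not> inj (\<lambda>j. M ^\<^sub>m j)" using finite_imageD infinite_UNIV_nat by blast
  then obtain a b where ab: "M ^\<^sub>m a = M ^\<^sub>m b" "a \<noteq> b" by (auto simp: inj_def)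
  have main: "\<exists>N>0. M ^\<^sub>m N = 1\<^sub>m n" if ab: "M ^\<^sub>m a = M ^\<^sub>m b" "a < b" for a b
  proof -
    have "M ^\<^sub>m b = M ^\<^sub>m a * M ^\<^sub>m (b - a)" using pow_mat_add_dim[of M a "b - a"] ab(2) by simp
    then have "st (M ^\<^sub>m a) * M ^\<^sub>m a = (st (M ^\<^sub>m a) * M ^\<^sub>m a) * M ^\<^sub>m (b - a)" using ab(1) by (simp add: mult_assoc_dim)
    then have "M ^\<^sub>m (b - a) = 1\<^sub>m n" using U_D(3)[OF U_pow[OF M, of a]] by (simp add: one_mult_dim)
    then show ?thesis using ab(2) by (intro exI[of _ "b - a"]) simp
  qed
  show ?thesis using main[of a b] main[of b a] ab by (metis linorder_neqE_nat)
qed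

text \<open>The moments are extended to negative indices by hermitian symmetry. A period N of M is a
  period of the extended sequence, so it is killed by X^N - 1, whose constant coefficient is
  nonzero, and its minimal polynomial is self-dual.\<close>

lemma ex_seq:
  assumes M: "M \<in> U n" and v: "v \<in> carrier_mat n 1"
  shows "\<exists>c r. r \<in> self_dual \<and> c \<in> herm_with_minpoly r \<and> (\<forall>j. hf (1\<^sub>m n) v (M ^\<^sub>m j * v) = c (int j))"
proof -
  have [simp]: "dim_row M = n" "dim_col M = n" "dim_row v = n" "dim_col v = 1" using U_D[OF M] v by auto
  define c where "c k = (if k \<ge> 0 then hf (1\<^sub>m n) v (M ^\<^sub>m nat k * v) else cj (hf (1\<^sub>m n) v (M ^\<^sub>m nat (- k) * v)))" for k :: int
  have c: "hf (1\<^sub>m n) v (M ^\<^sub>m j * v) = c (int j)" for j by (simp add: c_def)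
  have c0: "cj (hf (1\<^sub>m n) v v) = hf (1\<^sub>m n) v v" by (rule hf_cj[OF st_one one_carrier_mat v v])
  have hs: "c (- k) = cj (c k)" for k
  proof (cases "k = 0")
    case True
    then show ?thesis using c0 by (simp add: c_def one_mult_dim)
  qed (auto simp: c_def)
  then have herm: "herm_seq c" by (simp add: herm_seq_def inv_seq_def fun_eq_iff)
  obtain N where N: "N > 0" "M ^\<^sub>m N = 1\<^sub>m n" using U_period[OF M] by blast
  note hp = hf_pow[OF M one_carrier_mat st_one v c hs]
  have per: "c (k + int N) = c k" for k
  proof -
    \<comment> \<open>Writing k as a difference of nonnegative exponents treats both signs at once
      through \<open>hf_pow\<close>.\<close>
    let ?i = "nat (- k)" and ?j = "nat k"
    have k: "k = int ?j - int ?i" by simp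
    have "c (int (?j + N) - int ?i) = hf (1\<^sub>m n) (M ^\<^sub>m ?i * v) (M ^\<^sub>m (?j + N) * v)" by (rule hp[symmetric])
    also have "M ^\<^sub>m (?j + N) = M ^\<^sub>m ?j" by (simp add: pow_mat_add_dim N mult_one_dim)
    also have "hf (1\<^sub>m n) (M ^\<^sub>m ?i * v) (M ^\<^sub>m ?j * v) = c (int ?j - int ?i)" by (rule hp)
    finally have "c (int (?j + N) - int ?i) = c (int ?j - int ?i)" .
    moreover have "int (?j + N) - int ?i = k + int N" by simp
    ultimately show ?thesis using k by metis
  qed
  let ?P = "monom 1 N - 1 :: 'a poly"
  have "act (monom 1 N) c k = c (k + int N)" for k
  proof -
    have "act (monom 1 N) c k = (\<Sum>i\<le>N. if i = N then c (k + int N) else 0)"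
      unfolding act_def by (intro sum.cong) (auto simp: degree_monom_eq)
    then show ?thesis by simp
  qed
  moreover have "act 1 c k = c k" for k by (simp add: act_def)
  ultimately have "kills ?P c" by (simp add: kills_def act_diff per)
  moreover have P0: "coeff ?P 0 \<noteq> 0" using N(1) by simp
  then have "?P \<noteq> 0" by (metis coeff_0)
  ultimately have "minpoly c \<in> self_dual" "kills (minpoly c) c"
    using minpoly_self_dual[OF herm _ _ P0] minpoly(2)[of ?P c "minpoly c"] by auto
  then show ?thesis using c herm by (intro exI[of _ c] exI[of _ "minpoly c"]) (auto simp: herm_with_minpoly_def herm_solutions_def)
qed

text \<open>A kernel vector of the Toeplitz matrix is a polynomial p of degree below m such that act
  p c vanishes at m consecutive indices. As act p c is killed by r as well, it vanishes everywhere,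
  so the minimal polynomial r divides p and p = 0.\<close>

lemma toeplitz_inverse:
  assumes r: "r \<in> self_dual" and c: "c \<in> herm_with_minpoly r" and m: "degree r = m"
  shows "\<exists>Ci \<in> carrier_mat m m. toeplitz c m * Ci = 1\<^sub>m m"
proof -
  let ?C = "toeplitz c m"
  have C: "?C \<in> carrier_mat m m" by (rule carrier_matI) simp_all
  have k: "kills r c" and mp: "minpoly c = r" using c by (auto simp: herm_with_minpoly_def herm_solutions_def)
  have r0: "r \<noteq> 0" using self_dual_nonzero[OF r] .
  have "det ?C \<noteq> 0"
  proof
    assume "det ?C = 0"
    then obtain a where a: "a \<in> carrier_vec m" "a \<noteq> 0\<^sub>v m" "?C *\<^sub>v a = 0\<^sub>v m"
      using det_0_iff_vec_prod_zero[OF C] by blast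
    define p where "p = (\<Sum>j<m. monom (a $ j) j)"
    have cp: "coeff p j = (if j < m then a $ j else 0)" for j
      unfolding p_def coeff_sum by (simp add: if_distrib sum.delta' cong: if_cong)
    have act: "act p c l = (\<Sum>j<m. a $ j * c (l + int j))" for l
    proof -
      have "act p c l = (\<Sum>j\<le>m. coeff p j * c (l + int j))"
        by (rule act_bound) (rule degree_le, simp add: cp)
      also have "\<dots> = (\<Sum>j<m. coeff p j * c (l + int j)) + coeff p m * c (l + int m)" by (simp flip: lessThan_Suc_atMost)
      finally show ?thesis by (simp add: cp)
    qed
    have z: "act p c (- int i) = 0" if "i < m" for i
    proof -
      have "(?C *\<^sub>v a) $ i = (\<Sum>j<m. c (int j - int i) * a $ j)"
        using that a(1) by (simp add: scalar_prod_def toeplitz_def atLeast0LessThan)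
      then show ?thesis using a(3) that by (simp add: act mult.commute)
    qed
    have "kills r (act p c)"
    proof -
      have "act r (act p c) l = act p (act r c) l" for l by (metis act_mult mult.commute)
      moreover have "act r c = (\<lambda>_. 0)" using k by (auto simp: kills_def)
      ultimately show ?thesis by (simp add: kills_def)
    qed
    \<comment> \<open>The shift moves the known zeros -(m-1), ..., 0 to the indices 0, ...,
      m-1.\<close>
    then have S: "(\<lambda>l. act p c (l + (- int m + 1))) \<in> solutions r" using solutions_shift[of "act p c" r "- int m + 1"] by (simp add: solutions_def)
    have "act p c (int i + (- int m + 1)) = 0" if "i < degree r" for i
    proof -
      have "int i + (- int m + 1) = - int (m - 1 - i)" using that m by simp
      moreover have "m - 1 - i < m" using that m by simp
      ultimately show ?thesis using z[of "m - 1 - i"] by metis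
    qed
    then have "act p c (l + (- int m + 1)) = 0" for l
      using solutions_zero[OF self_dual_D[OF r] S] by blast
    from this[of "l - (- int m + 1)" for l] have "kills p c" by (simp add: kills_def)
    then have "r dvd p" using minpoly(2)[OF k r0, of p] mp by simp
    moreover have "p = 0 \<or> degree p < m"
    proof (cases m)
      case 0
      then show ?thesis by (simp add: p_def)
    next
      case (Suc m')
      have "degree p \<le> m'" by (rule degree_le) (use Suc in \<open>auto simp: cp\<close>)
      then show ?thesis using Suc by simp
    qed
    ultimately have "p = 0" using m by (metis dvd_imp_degree_le not_le)
    then have "a $ j = 0" if "j < m" for j using cp[of j] that by simp
    then have "a = 0\<^sub>v m" using a(1) by (intro eq_vecI) auto
    then show False using a(2) by simp
  qed
  then have "?C * (inverse (det ?C) \<cdot>\<^sub>m adj_mat ?C) = 1\<^sub>m m"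
    using adj_mat(2)[OF C] adj_mat(1)[OF C] by (subst mult_smult_dim) (auto intro!: eq_matI)
  moreover have "inverse (det ?C) \<cdot>\<^sub>m adj_mat ?C \<in> carrier_mat m m" using adj_mat(1)[OF C] by simp
  ultimately show ?thesis by blast
qed

text \<open>The unknown function to be eliminated: the average over the unitary group of the number
  of vectors with vanishing moments, restricted to matrices with characteristic polynomial
  h.\<close>

definition null_prob :: "'a poly \<Rightarrow> real" where
  "null_prob h = real (card (moment_pairs (\<lambda>_. 0) (degree h) h)) / real (card (U (degree h)))"

lemma card_moment_pairs_null_prob:
  assumes r: "r \<in> self_dual" and c: "c \<in> herm_with_minpoly r" and f: "monic f" "degree f = n"
  shows "real (card (moment_pairs c n f)) = real (card (U n)) * (if r dvd f then null_prob (f div r) else 0)"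
proof (cases "degree r = 0")
  case True
  then have r1: "r = 1" using self_dual_D(1)[OF r] by (metis monic_degree_0)
  then have "c = (\<lambda>_. 0)" using c by (simp add: herm_with_minpoly_def herm_solutions_def kills_one)
  then show ?thesis using r1 f(2) card_U_pos[of n] by (simp add: null_prob_def)
next
  case False
  define m where "m = degree r"
  have m0: "m > 0" using False by (simp add: m_def)
  obtain Ci where Ci: "Ci \<in> carrier_mat m m" "toeplitz c m * Ci = 1\<^sub>m m" using toeplitz_inverse[OF r c] m_def by blast
  have hs: "herm_seq c" and kl: "kills r c" using c by (auto simp: herm_with_minpoly_def herm_solutions_def)
  have herm: "c (- k) = cj (c k)" for k by (rule herm_seqD[OF hs])
  show ?thesis
  proof (cases "m \<le> n")
    case True
    interpret gram_rec q F c m "n - m" n Ci r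
      by unfold_locales (use m0 True herm Ci self_dual_D(1)[OF r] kl in \<open>auto simp: m_def kills_def act_def\<close>)
    have e: "real (card (moment_pairs c n f)) * real (card (U (n - m))) = real (card (U n)) * (if r dvd f then real (card (moment_pairs (\<lambda>_. 0) (n - m) (f div r))) else 0)"
      using arg_cong[OF card_moment_pairs_c[of f], of real] by (simp split: if_splits)
    have Up: "real (card (U (n - m))) > 0" using card_U_pos by simp
    show ?thesis
    proof (cases "r dvd f")
      case True
      then have "r \<in> sd_divisors f" using r by (simp add: sd_divisors_def)
      then have "degree (f div r) = n - m" using sd_divisors_D(5)[OF f(1)] f(2) m_def by fastforce
      then show ?thesis using e Up True by (simp add: null_prob_def field_simps)
    next
      case False
      then show ?thesis using e Up by simp
    qed
  next
    case False
    \<comment> \<open>For m > n, a frame of m vectors in dimension n with invertible Gram matrix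
      would give an injection of m coordinates into n.\<close>
    have "moment_pairs c n f = {}"
    proof (rule ccontr)
      assume "moment_pairs c n f \<noteq> {}"
      then obtain M v where Mv: "M \<in> U n" "v \<in> carrier_mat n 1" "\<And>j. hf (1\<^sub>m n) v (M ^\<^sub>m j * v) = c (int j)"
        by (auto simp: moment_pairs_def)
      have [simp]: "dim_row v = n" using Mv(2) by auto
      let ?V = "frame M v m"
      have [simp]: "dim_row Ci = m" "dim_col Ci = m" using Ci by auto
      have g: "st ?V * (1\<^sub>m n * ?V) = toeplitz c m"
        by (rule frame_gram[OF Mv(1) one_carrier_mat st_one Mv(2,3) herm])
      have CiC: "Ci * toeplitz c m = 1\<^sub>m m"
        by (rule inverse_mat_commute[OF _ Ci]) (rule carrier_matI, simp_all)
      have "inj_on (\<lambda>x. ?V * x) (carrier_mat m 1)"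
      proof (rule inj_onI)
        fix x y :: "'a mat" assume xy: "x \<in> carrier_mat m 1" "y \<in> carrier_mat m 1" "?V * x = ?V * y"
        have [simp]: "dim_row x = m" "dim_row y = m" using xy by auto
        have rec: "z = Ci * (st ?V * (?V * z))" if [simp]: "dim_row z = m" for z
        proof -
          have "Ci * (st ?V * (?V * z)) = (Ci * (st ?V * (1\<^sub>m n * ?V))) * z" by (simp add: mult_assoc_dim one_mult_dim)
          then show ?thesis unfolding g CiC by (simp add: one_mult_dim)
        qed
        show "x = y" using rec[of x] rec[of y] xy(3) by simp
      qed
      moreover have "(\<lambda>x. ?V * x) ` carrier_mat m 1 \<subseteq> carrier_mat n 1" by (auto intro!: carrier_matI)
      ultimately have "card (carrier_mat m 1 :: 'a mat set) \<le> card (carrier_mat n 1 :: 'a mat set)"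
        using card_inj_on_le card_carrier_mat by blast
      moreover have "card (UNIV :: 'a set) > 1" using q_ge_2 one_less_power[of q 2] by (simp add: card_F)
      ultimately show False using False by (simp add: card_carrier_mat)
    qed
    moreover have "\<not> r dvd f" using False f by (auto simp: m_def dest: dvd_imp_degree_le)
    ultimately show ?thesis by simp
  qed
qed

definition charpoly_prob :: "'a poly \<Rightarrow> real" where
  "charpoly_prob f = real (card {M \<in> U (degree f). char_poly M = f}) / real (card (U (degree f)))"

text \<open>Sort the pairs (M,v) by moment sequence c and by the minimal polynomial of c. The norm
  of v is c 0, so a weight on norms becomes a weight on sequences, and
  \<open>card_moment_pairs_null_prob\<close> supplies the other factor.\<close>

lemma sum_vectors:
  assumes f: "monic f" "degree f = n"
  shows "(\<Sum>M\<in>{M \<in> U n. char_poly M = f}. \<Sum>v\<in>carrier_mat n 1. g (hf (1\<^sub>m n) v v)) =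
    real (card (U n)) * conv (\<lambda>r. \<Sum>c\<in>herm_with_minpoly r. g (c 0)) null_prob f"
proof -
  let ?A = "{M \<in> U n. char_poly M = f}"
  have f0: "f \<noteq> 0" using f by auto
  have finA: "finite ?A" using finite_UH by simp
  have finV: "finite (carrier_mat n 1 :: 'a mat set)" using card_carrier_mat by blast
  have finC: "finite (herm_with_minpoly r)" if "r \<in> sd_divisors f" for r using finite_herm_solutions that by (auto simp: sd_divisors_def herm_with_minpoly_def)
  define I where "I = (SIGMA r:sd_divisors f. herm_with_minpoly r)"
  have finI: "finite I" unfolding I_def using finite_sd_divisors[OF f0] finC by auto
  have un: "?A \<times> (carrier_mat n 1 :: 'a mat set) = (\<Union>rc\<in>I. moment_pairs (snd rc) n f)"
  proof (intro equalityI subsetI)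
    fix x assume "x \<in> ?A \<times> (carrier_mat n 1 :: 'a mat set)"
    then obtain M v where x: "x = (M,v)" "M \<in> U n" "char_poly M = f" "v \<in> carrier_mat n 1" by auto
    obtain c r where cr: "r \<in> self_dual" "c \<in> herm_with_minpoly r" "\<forall>j. hf (1\<^sub>m n) v (M ^\<^sub>m j * v) = c (int j)"
      using ex_seq[OF x(2,4)] by blast
    have xS: "x \<in> moment_pairs c n f" using x cr by (simp add: moment_pairs_def)
    then have "card (moment_pairs c n f) > 0" using finite_moment_pairs card_gt_0_iff by blast
    then have "r dvd f" using card_moment_pairs_null_prob[OF cr(1,2) f] by (auto split: if_splits)
    then have "(r,c) \<in> I" using cr by (simp add: I_def sd_divisors_def)
    then show "x \<in> (\<Union>rc\<in>I. moment_pairs (snd rc) n f)" using xS by (intro UN_I[of "(r,c)"]) simp_all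
  next
    fix x assume "x \<in> (\<Union>rc\<in>I. moment_pairs (snd rc) n f)"
    then show "x \<in> ?A \<times> (carrier_mat n 1 :: 'a mat set)" by (auto simp: moment_pairs_def)
  qed
  have disj: "moment_pairs (snd x) n f \<inter> moment_pairs (snd y) n f = {}" if xy: "x \<in> I" "y \<in> I" "x \<noteq> y" for x y
  proof (rule ccontr)
    assume "\<not> ?thesis"
    then obtain M v where Mv: "(M,v) \<in> moment_pairs (snd x) n f" "(M,v) \<in> moment_pairs (snd y) n f" by auto
    obtain r c r' c' where e: "x = (r,c)" "y = (r',c')" by (cases x, cases y)
    have j: "c (int j) = c' (int j)" for j using Mv e by (auto simp: moment_pairs_def)
    have h: "herm_seq c" "herm_seq c'" "minpoly c = r" "minpoly c' = r'" using xy e by (auto simp: I_def herm_with_minpoly_def herm_solutions_def)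
    have "c k = c' k" for k
    proof (cases "k \<ge> 0")
      case True
      then show ?thesis using j[of "nat k"] by simp
    next
      case False
      then show ?thesis using j[of "nat (- k)"] herm_seqD[OF h(1), of "- k"] herm_seqD[OF h(2), of "- k"] by simp
    qed
    then have "c = c'" by blast
    then show False using h e xy(3) by simp
  qed
  have "(\<Sum>M\<in>?A. \<Sum>v\<in>carrier_mat n 1. g (hf (1\<^sub>m n) v v)) = (\<Sum>(M,v)\<in>?A \<times> (carrier_mat n 1 :: 'a mat set). g (hf (1\<^sub>m n) v v))"
    by (rule sum.cartesian_product)
  also have "\<dots> = (\<Sum>rc\<in>I. \<Sum>(M,v)\<in>moment_pairs (snd rc) n f. g (hf (1\<^sub>m n) v v))"
    unfolding un by (rule sum.UNION_disjoint) (use finI finite_moment_pairs disj in auto)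
  also have "\<dots> = (\<Sum>rc\<in>I. g (snd rc 0) * real (card (moment_pairs (snd rc) n f)))"
  proof (rule sum.cong[OF refl])
    fix rc
    have "(\<Sum>(M,v)\<in>moment_pairs (snd rc) n f. g (hf (1\<^sub>m n) v v)) = (\<Sum>x\<in>moment_pairs (snd rc) n f. g (snd rc 0))"
    proof (rule sum.cong[OF refl])
      fix x assume "x \<in> moment_pairs (snd rc) n f"
      then obtain M v where x: "x = (M,v)" "M \<in> U n" "v \<in> carrier_mat n 1" "\<And>j. hf (1\<^sub>m n) v (M ^\<^sub>m j * v) = snd rc (int j)"
        by (auto simp: moment_pairs_def)
      have [simp]: "dim_row M = n" "dim_row v = n" using x U_D by auto
      have "hf (1\<^sub>m n) v v = snd rc 0" using x(4)[of 0] by (simp add: one_mult_dim)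
      then show "(case x of (M,v) \<Rightarrow> g (hf (1\<^sub>m n) v v)) = g (snd rc 0)" using x(1) by simp
    qed
    then show "(\<Sum>(M,v)\<in>moment_pairs (snd rc) n f. g (hf (1\<^sub>m n) v v)) = g (snd rc 0) * real (card (moment_pairs (snd rc) n f))" by simp
  qed
  also have "\<dots> = (\<Sum>(r,c)\<in>I. g (c 0) * real (card (moment_pairs c n f)))" by (simp add: case_prod_beta)
  also have "\<dots> = (\<Sum>r\<in>sd_divisors f. \<Sum>c\<in>herm_with_minpoly r. g (c 0) * real (card (moment_pairs c n f)))"
    unfolding I_def by (rule sum.Sigma[symmetric]) (use finite_sd_divisors[OF f0] finC in auto)
  also have "\<dots> = (\<Sum>r\<in>sd_divisors f. \<Sum>c\<in>herm_with_minpoly r. g (c 0) * (real (card (U n)) * null_prob (f div r)))"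
    by (intro sum.cong refl) (auto simp: card_moment_pairs_null_prob[OF _ _ f] sd_divisors_def)
  also have "\<dots> = real (card (U n)) * conv (\<lambda>r. \<Sum>c\<in>herm_with_minpoly r. g (c 0)) null_prob f"
    unfolding conv_def by (simp add: sum_distrib_left sum_distrib_right mult_ac)
  finally show ?thesis .
qed

text \<open>Write * for \<open>conv\<close> and 1 for the constant function. Then W2 = \<phi> *
  null_prob and Wm = \<mu> * null_prob, where 1 * \<phi> = qd and 1 * \<mu> is the unit. Hence
  null_prob = 1 * Wm and 1 * W2 = qd * 1 * Wm. Cancelling 1 leaves W2 = qd * Wm, which is the claim
  multiplied by q^(deg f).\<close>

lemma charpoly_prob_recursion:
  assumes f: "monic f"
  shows "real q ^ degree f * charpoly_prob f = (\<Sum>K\<in>sd_divisors f. (- 1) ^ degree (f div K) * charpoly_prob (f div K))"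
proof -
  define W2 where "W2 p = real q ^ (2 * degree p) * charpoly_prob p" for p
  define Wm where "Wm p = (- real q) ^ degree p * charpoly_prob p" for p
  define \<phi> where "\<phi> r = (\<Sum>c\<in>herm_with_minpoly r. (1::real))" for r
  define \<mu> where "\<mu> r = (\<Sum>c\<in>herm_with_minpoly r. norm_weight (c 0))" for r
  define qd where "qd K = real q ^ degree K" for K :: "'a poly"
  let ?L = "\<lambda>_ :: 'a poly. 1 :: real"
  have W2: "W2 p = conv \<phi> null_prob p" if p: "monic p" for p
  proof -
    have "real (card (U (degree p))) * conv \<phi> null_prob p = (\<Sum>M\<in>{M \<in> U (degree p). char_poly M = p}. \<Sum>v\<in>(carrier_mat (degree p) 1 :: 'a mat set). 1)"
      unfolding \<phi>_def by (rule sum_vectors[OF p refl, of "\<lambda>_. 1", symmetric])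
    also have "\<dots> = real (card (U (degree p))) * W2 p"
      using card_U_pos[of "degree p"] by (simp add: W2_def charpoly_prob_def card_carrier_mat card_F power_mult)
    finally show ?thesis using card_U_pos[of "degree p"] by simp
  qed
  have Wm: "Wm p = conv \<mu> null_prob p" if p: "monic p" for p
  proof -
    have "real (card (U (degree p))) * conv \<mu> null_prob p = (\<Sum>M\<in>{M \<in> U (degree p). char_poly M = p}. \<Sum>v\<in>carrier_mat (degree p) 1. norm_weight (hf (1\<^sub>m (degree p)) v v))"
      unfolding \<mu>_def by (rule sum_vectors[OF p refl, of norm_weight, symmetric])
    also have "\<dots> = real (card (U (degree p))) * Wm p"
      using card_U_pos[of "degree p"] unfolding sum_norm_weight_vectors by (simp add: Wm_def charpoly_prob_def)
    finally show ?thesis using card_U_pos[of "degree p"] by simp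
  qed
  have L\<phi>: "conv ?L \<phi> K = qd K" if K: "K \<in> self_dual" for K
  proof -
    have "conv ?L \<phi> K = (\<Sum>r\<in>sd_divisors K. \<phi> r)" unfolding conv_comm[OF K, of ?L] by (simp add: conv_def)
    also have "\<dots> = real (card (herm_solutions K))" unfolding \<phi>_def sum_herm_solutions[OF K, of "\<lambda>_. 1", symmetric] by simp
    finally show ?thesis by (simp add: card_herm_solutions[OF K] qd_def)
  qed
  have L\<mu>: "conv ?L \<mu> K = (if K = 1 then 1 else 0)" if K: "K \<in> self_dual" for K
  proof -
    have "conv ?L \<mu> K = (\<Sum>r\<in>sd_divisors K. \<mu> r)" unfolding conv_comm[OF K, of ?L] by (simp add: conv_def)
    also have "\<dots> = (if K = 1 then 1 else 0)" unfolding \<mu>_def sum_herm_solutions[OF K, of "\<lambda>c. norm_weight (c 0)", symmetric] by (rule sum_herm_solutions_norm_weight[OF K])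
    finally show ?thesis .
  qed
  have LWm: "conv ?L Wm p = null_prob p" if p: "monic p" for p
  proof -
    have "conv ?L Wm p = conv ?L (conv \<mu> null_prob) p" by (rule conv_cong[OF p]) (auto simp: Wm)
    also have "\<dots> = conv (conv ?L \<mu>) null_prob p" by (rule conv_assoc[OF p])
    also have "\<dots> = conv (\<lambda>K. if K = 1 then 1 else 0) null_prob p" by (rule conv_cong[OF p]) (auto simp: L\<mu>)
    also have "\<dots> = (\<Sum>r\<in>sd_divisors p. if r = 1 then null_prob p else 0)" unfolding conv_def by (intro sum.cong) auto
    also have "\<dots> = null_prob p" using one_in_sd_divisors[of p] finite_sd_divisors[OF monic_nonzero[OF p]] by simp
    finally show ?thesis .
  qed
  have eq: "conv ?L W2 p = conv ?L (conv qd Wm) p" if p: "monic p" for p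
  proof -
    have "conv ?L W2 p = conv ?L (conv \<phi> null_prob) p" by (rule conv_cong[OF p]) (auto simp: W2)
    also have "\<dots> = conv (conv ?L \<phi>) null_prob p" by (rule conv_assoc[OF p])
    also have "\<dots> = conv qd (conv ?L Wm) p" by (rule conv_cong[OF p]) (auto simp: L\<phi> LWm)
    also have "\<dots> = conv (conv qd ?L) Wm p" by (rule conv_assoc[OF p])
    also have "\<dots> = conv (conv ?L qd) Wm p" by (rule conv_cong[OF p]) (auto intro: conv_comm)
    also have "\<dots> = conv ?L (conv qd Wm) p" by (rule conv_assoc[OF p, symmetric])
    finally show ?thesis .
  qed
  have main: "W2 f = conv qd Wm f" by (rule conv_one_cancel[OF eq f])
  have q0: "real q \<noteq> 0" using q_ge_2 by simp
  have "real q ^ degree f * (real q ^ degree f * charpoly_prob f) = W2 f" by (simp add: W2_def power_add mult_2)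
  also have "\<dots> = (\<Sum>K\<in>sd_divisors f. real q ^ degree f * ((- 1) ^ degree (f div K) * charpoly_prob (f div K)))"
    unfolding main conv_def
  proof (rule sum.cong[OF refl])
    fix K assume K: "K \<in> sd_divisors f"
    have "degree f = degree K + degree (f div K)" by (rule sd_divisors_D(5)[OF f K])
    then have "real q ^ degree f = real q ^ degree K * real q ^ degree (f div K)" by (metis power_add)
    moreover have "(- real q) ^ degree (f div K) = (- 1) ^ degree (f div K) * real q ^ degree (f div K)" by (metis mult_minus1 power_mult_distrib)
    ultimately show "qd K * Wm (f div K) = real q ^ degree f * ((- 1) ^ degree (f div K) * charpoly_prob (f div K))"
      by (simp add: qd_def Wm_def)
  qed
  also have "\<dots> = real q ^ degree f * (\<Sum>K\<in>sd_divisors f. (- 1) ^ degree (f div K) * charpoly_prob (f div K))" by (simp add: sum_distrib_left)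
  finally show ?thesis using q0 by simp
qed

end

section \<open>Short intervals\<close>

locale short_classes = quadratic_extension q F for q :: nat and F :: "'a::{field,finite} itself" +
  fixes l :: nat
  assumes l_pos: "l > 0"
begin

text \<open>Residues modulo z^(l+1) are represented by truncated power series, so that inverses can
  be taken among power series.\<close>

definition tr :: "'a fps \<Rightarrow> 'a fps" where "tr a = Abs_fps (\<lambda>i. if i \<le> l then fps_nth a i else 0)"

lemma tr_nth [simp]: "fps_nth (tr a) i = (if i \<le> l then fps_nth a i else 0)" by (simp add: tr_def)

lemma tr_tr [simp]: "tr (tr a) = tr a" by (intro fps_ext) simp

lemma tr_mult_left: "tr (tr a * b) = tr (a * b)"
  by (intro fps_ext) (auto simp: fps_mult_nth intro!: sum.cong)

lemma tr_mult_right: "tr (a * tr b) = tr (a * b)"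
  using tr_mult_left[of b a] by (simp add: mult.commute)

text \<open>The group of power series with constant coefficient 1 modulo z^(l+1);
  \<open>class_quot\<close> is division in it.\<close>

definition unit_classes :: "'a fps set" where "unit_classes = {a. fps_nth a 0 = 1 \<and> tr a = a}"

definition class_quot :: "'a fps \<Rightarrow> 'a fps \<Rightarrow> 'a fps" where "class_quot g c = tr (g * inverse c)"

lemma unit_classes_D: "c \<in> unit_classes \<Longrightarrow> fps_nth c 0 = 1" "c \<in> unit_classes \<Longrightarrow> tr c = c" by (auto simp: unit_classes_def)

lemma unit_classes_inv: "c \<in> unit_classes \<Longrightarrow> c * inverse c = 1" "c \<in> unit_classes \<Longrightarrow> inverse c * c = 1"
  using inverse_mult_eq_1[of c] inverse_mult_eq_1'[of c] by (auto simp: unit_classes_def)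

lemma class_quot_unit_classes: "g \<in> unit_classes \<Longrightarrow> c \<in> unit_classes \<Longrightarrow> class_quot g c \<in> unit_classes"
  by (simp add: unit_classes_def class_quot_def)

lemma mult_unit_classes: "g \<in> unit_classes \<Longrightarrow> c \<in> unit_classes \<Longrightarrow> tr (g * c) \<in> unit_classes"
  by (simp add: unit_classes_def)

lemma class_quot_mult: "g \<in> unit_classes \<Longrightarrow> c \<in> unit_classes \<Longrightarrow> class_quot (tr (g * c)) c = g"
  by (simp add: class_quot_def tr_mult_left mult.assoc unit_classes_inv unit_classes_D)

lemma mult_class_quot: "g \<in> unit_classes \<Longrightarrow> c \<in> unit_classes \<Longrightarrow> tr (class_quot g c * c) = g"
  by (simp add: class_quot_def tr_mult_left mult.assoc unit_classes_inv unit_classes_D)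

lemma class_quot_class_quot: "g \<in> unit_classes \<Longrightarrow> c \<in> unit_classes \<Longrightarrow> class_quot g (class_quot g c) = c"
  using class_quot_mult[of c "class_quot g c"] mult_class_quot[of g c] class_quot_unit_classes[of g c] by (simp add: mult.commute)

lemma card_unit_classes: "finite unit_classes \<and> card unit_classes = q ^ (2 * l)"
proof -
  let ?L = "{xs :: 'a list. set xs \<subseteq> UNIV \<and> length xs = l}"
  have b: "bij_betw (\<lambda>a. map (\<lambda>i. fps_nth a (Suc i)) [0..<l]) unit_classes ?L"
  proof (rule bij_betwI[where g = "\<lambda>xs. Abs_fps (\<lambda>i. if i = 0 then 1 else if i \<le> l then xs ! (i - 1) else 0)"])
    fix a assume a: "a \<in> unit_classes"
    show "Abs_fps (\<lambda>i. if i = 0 then 1 else if i \<le> l then map (\<lambda>i. fps_nth a (Suc i)) [0..<l] ! (i - 1) else 0) = a"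
    proof (intro fps_ext)
      fix i
      have "fps_nth a i = fps_nth (tr a) i" using unit_classes_D(2)[OF a] by simp
      then show "fps_nth (Abs_fps (\<lambda>i. if i = 0 then 1 else if i \<le> l then map (\<lambda>i. fps_nth a (Suc i)) [0..<l] ! (i - 1) else 0)) i = fps_nth a i"
        using unit_classes_D(1)[OF a] by (cases i) auto
    qed
  next
    fix xs :: "'a list" assume "xs \<in> ?L"
    then show "map (\<lambda>i. fps_nth (Abs_fps (\<lambda>i. if i = 0 then 1 else if i \<le> l then xs ! (i - 1) else 0)) (Suc i)) [0..<l] = xs"
      by (intro nth_equalityI) auto
  qed (auto simp: unit_classes_def fps_eq_iff)
  have "finite ?L" by (rule finite_lists_length_eq) simp
  moreover have "card ?L = card (UNIV :: 'a set) ^ l" by (rule card_lists_length_eq) simp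
  ultimately show ?thesis using bij_betw_finite[OF b] bij_betw_same_card[OF b] by (simp add: card_F power_mult)
qed

lemma sum_class_quot_left: "c \<in> unit_classes \<Longrightarrow> (\<Sum>g\<in>unit_classes. y (class_quot g c)) = (\<Sum>g\<in>unit_classes. y g)" for y :: "_ \<Rightarrow> real"
  by (rule sum.reindex_bij_witness[of _ "\<lambda>g. tr (g * c)" "\<lambda>g. class_quot g c"])
     (auto simp: class_quot_mult mult_class_quot class_quot_unit_classes mult_unit_classes)

lemma sum_class_quot_right: "g \<in> unit_classes \<Longrightarrow> (\<Sum>c\<in>unit_classes. y (class_quot g c)) = (\<Sum>c\<in>unit_classes. y c)" for y :: "_ \<Rightarrow> real"
  by (rule sum.reindex_bij_witness[of _ "\<lambda>c. class_quot g c" "\<lambda>c. class_quot g c"])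
     (auto simp: class_quot_class_quot class_quot_unit_classes)

text \<open>Encodes the $l$ coefficients below the leading one as a unit modulo $z^{l+1}$, so that products of
monic polynomials become products of classes.\<close>
definition poly_class :: "'a poly \<Rightarrow> 'a fps" where "poly_class f = tr (fps_of_poly (reflect_poly f))"

lemma poly_class_nth: "fps_nth (poly_class f) i = (if i \<le> l \<and> i \<le> degree f then coeff f (degree f - i) else 0)"
  by (simp add: poly_class_def coeff_reflect_poly)

lemma poly_class_unit_classes: "monic f \<Longrightarrow> poly_class f \<in> unit_classes"
  by (simp add: unit_classes_def poly_class_def coeff_reflect_poly)

lemma poly_class_mult: "poly_class (f * g) = tr (poly_class f * poly_class g)"
  by (simp add: poly_class_def reflect_poly_mult fps_of_poly_mult tr_mult_left tr_mult_right)

definition monics :: "nat \<Rightarrow> 'a poly set" where "monics n = {f. monic f \<and> degree f = n}"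

lemma finite_monics: "finite (monics n)"
  by (rule finite_subset[OF _ conjunct1[OF lists_poly[of "Suc n", where ?'b = 'a]]])
     (auto simp: monics_def coeff_eq_0)

definition self_dual_deg :: "nat \<Rightarrow> 'a poly set" where "self_dual_deg m = {K \<in> self_dual. degree K = m}"

lemma finite_self_dual_deg: "finite (self_dual_deg m)"
  by (rule finite_subset[OF _ finite_monics[of m]]) (auto simp: self_dual_deg_def monics_def self_dual_D)

definition P :: "nat \<Rightarrow> 'a fps \<Rightarrow> real" where "P n g = (\<Sum>f\<in>{f \<in> monics n. poly_class f = g}. charpoly_prob f)"

lemma char_poly_monics: "M \<in> U n \<Longrightarrow> char_poly M \<in> monics n"
  using degree_monic_char_poly[of M n] by (auto simp: monics_def U_iff)

lemma P_eq: "P n g = real (card {M \<in> U n. poly_class (char_poly M) = g}) / real (card (U n))"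
proof -
  let ?I = "{f \<in> monics n. poly_class f = g}"
  have "{M \<in> U n. poly_class (char_poly M) = g} = (\<Union>f\<in>?I. {M \<in> U n. char_poly M = f})"
    using char_poly_monics by auto
  then have "card {M \<in> U n. poly_class (char_poly M) = g} = (\<Sum>f\<in>?I. card {M \<in> U n. char_poly M = f})"
    by (simp only:) (rule card_UN_disjoint, auto simp: finite_monics finite_UH)
  moreover have "P n g = (\<Sum>f\<in>?I. real (card {M \<in> U n. char_poly M = f}) / real (card (U n)))"
    unfolding P_def by (intro sum.cong) (auto simp: charpoly_prob_def monics_def)
  ultimately show ?thesis by (simp add: sum_divide_distrib)
qed

lemma sum_P: "(\<Sum>g\<in>unit_classes. P n g) = 1"
proof -
  have "(\<Sum>g\<in>unit_classes. P n g) = real (\<Sum>g\<in>unit_classes. card {M \<in> U n. poly_class (char_poly M) = g}) / real (card (U n))"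
    unfolding P_eq by (simp add: sum_divide_distrib)
  also have "(\<Sum>g\<in>unit_classes. card {M \<in> U n. poly_class (char_poly M) = g}) = card (\<Union>g\<in>unit_classes. {M \<in> U n. poly_class (char_poly M) = g})"
    by (rule card_UN_disjoint[symmetric]) (auto simp: card_unit_classes finite_UH)
  also have "(\<Union>g\<in>unit_classes. {M \<in> U n. poly_class (char_poly M) = g}) = U n"
  proof -
    have "poly_class (char_poly M) \<in> unit_classes" if "M \<in> U n" for M
      using poly_class_unit_classes[of "char_poly M"] char_poly_monics[OF that] unfolding monics_def by blast
    then show ?thesis by auto
  qed
  finally show ?thesis using card_U_pos[of n] by simp
qed

text \<open>This is the recursion for single polynomials summed over a class: in a factorization f =
  K p the class of p is the quotient of the classes of f and K.\<close>

lemma P_recursion: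
  assumes g: "g \<in> unit_classes"
  shows "real q ^ n * P n g = (\<Sum>m\<le>n. \<Sum>K\<in>self_dual_deg m. (- 1) ^ (n - m) * P (n - m) (class_quot g (poly_class K)))"
proof -
  let ?I = "{f \<in> monics n. poly_class f = g}"
  have finI: "finite ?I" using finite_monics by simp
  have finS: "finite (sd_divisors f)" if "f \<in> ?I" for f using that by (intro finite_sd_divisors) (auto simp: monics_def)
  let ?A = "SIGMA f:?I. sd_divisors f"
  let ?B = "SIGMA m:{..n}. SIGMA K:self_dual_deg m. {p \<in> monics (n - m). poly_class p = class_quot g (poly_class K)}"
  have "real q ^ n * P n g = (\<Sum>f\<in>?I. \<Sum>K\<in>sd_divisors f. (- 1) ^ degree (f div K) * charpoly_prob (f div K))"
    unfolding P_def sum_distrib_left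
  proof (rule sum.cong[OF refl])
    fix f assume "f \<in> ?I"
    then have "monic f" "degree f = n" by (auto simp: monics_def)
    then show "real q ^ n * charpoly_prob f = (\<Sum>K\<in>sd_divisors f. (- 1) ^ degree (f div K) * charpoly_prob (f div K))"
      using charpoly_prob_recursion[of f] by simp
  qed
  also have "\<dots> = (\<Sum>(f,K)\<in>?A. (- 1) ^ degree (f div K) * charpoly_prob (f div K))"
    by (rule sum.Sigma) (use finI finS in auto)
  also have "\<dots> = (\<Sum>(m,K,p)\<in>?B. (- 1) ^ (n - m) * charpoly_prob p)"
  proof (rule sum.reindex_bij_witness[of _ "\<lambda>(m,K,p). (K * p, K)" "\<lambda>(f,K). (degree K, K, f div K)"])
    fix x assume "x \<in> ?A"
    then obtain f K where x: "x = (f,K)" "f \<in> monics n" "poly_class f = g" "K \<in> sd_divisors f" by auto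
    have f: "monic f" "degree f = n" using x(2) by (auto simp: monics_def)
    note d = sd_divisors_D[OF f(1) x(4)]
    show "(\<lambda>(m,K,p). (K * p, K)) ((\<lambda>(f,K). (degree K, K, f div K)) x) = x" using x(1) d(2) by simp
    have "poly_class f = tr (poly_class (f div K) * poly_class K)" using poly_class_mult[of K "f div K"] d(2) by (simp add: mult.commute)
    then have "poly_class (f div K) = class_quot g (poly_class K)"
      using class_quot_mult[OF poly_class_unit_classes[OF d(3)] poly_class_unit_classes[OF self_dual_D(1)[OF d(1)]]] x(3) by simp
    then show "(\<lambda>(f,K). (degree K, K, f div K)) x \<in> ?B" using x(1) d f by (auto simp: self_dual_deg_def monics_def)
    show "(case (\<lambda>(f,K). (degree K, K, f div K)) x of (m,K,p) \<Rightarrow> (- 1) ^ (n - m) * charpoly_prob p) =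
      (case x of (f,K) \<Rightarrow> (- 1) ^ degree (f div K) * charpoly_prob (f div K))"
      using x(1) d(5) f(2) by simp
  next
    fix z assume "z \<in> ?B"
    then obtain m K p where z: "z = (m,K,p)" "m \<le> n" "K \<in> self_dual" "degree K = m" "monic p" "degree p = n - m" "poly_class p = class_quot g (poly_class K)"
      by (auto simp: self_dual_deg_def monics_def)
    have K: "monic K" "K \<noteq> 0" using z(3) self_dual_D(1) self_dual_nonzero by auto
    have p0: "p \<noteq> 0" using z(5) by auto
    show "(\<lambda>(f,K). (degree K, K, f div K)) ((\<lambda>(m,K,p). (K * p, K)) z) = z" using z K by simp
    have "monic (K * p)" using K(1) z(5) by (simp add: lead_coeff_mult)
    moreover have "degree (K * p) = n" using K(2) p0 z by (simp add: degree_mult_eq)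
    moreover have "poly_class (K * p) = g" using mult_class_quot[OF g poly_class_unit_classes[OF K(1)]] z(7) poly_class_mult[of K p] by (simp add: mult.commute)
    ultimately show "(\<lambda>(m,K,p). (K * p, K)) z \<in> ?A" using z by (simp add: monics_def sd_divisors_def)
  qed
  also have "\<dots> = (\<Sum>m\<le>n. \<Sum>(K,p)\<in>(SIGMA K:self_dual_deg m. {p \<in> monics (n - m). poly_class p = class_quot g (poly_class K)}). (- 1) ^ (n - m) * charpoly_prob p)"
    by (rule sum.Sigma[symmetric]) (auto simp: finite_self_dual_deg finite_monics)
  also have "\<dots> = (\<Sum>m\<le>n. \<Sum>K\<in>self_dual_deg m. \<Sum>p\<in>{p \<in> monics (n - m). poly_class p = class_quot g (poly_class K)}. (- 1) ^ (n - m) * charpoly_prob p)"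
    by (intro sum.cong refl sum.Sigma[symmetric]) (auto simp: finite_self_dual_deg finite_monics)
  finally show ?thesis by (simp add: P_def sum_distrib_left)
qed

lemma self_dual_deg_unit_classes: "K \<in> self_dual_deg m \<Longrightarrow> poly_class K \<in> unit_classes" using poly_class_unit_classes self_dual_D(1) by (auto simp: self_dual_deg_def)

text \<open>Summing the recursion over all classes removes the probabilities, since every
  distribution has total 1, and what remains counts self-dual polynomials. Adding the relations for
  two consecutive degrees isolates one count.\<close>

lemma sum_self_dual_deg: "(\<Sum>m\<le>n. (- 1) ^ (n - m) * real (card (self_dual_deg m))) = real q ^ n"
proof -
  have "real q ^ n = (\<Sum>g\<in>unit_classes. real q ^ n * P n g)" by (simp add: sum_P flip: sum_distrib_left)
  also have "\<dots> = (\<Sum>g\<in>unit_classes. \<Sum>m\<le>n. \<Sum>K\<in>self_dual_deg m. (- 1) ^ (n - m) * P (n - m) (class_quot g (poly_class K)))"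
    by (intro sum.cong) (auto simp: P_recursion)
  also have "\<dots> = (\<Sum>m\<le>n. \<Sum>g\<in>unit_classes. \<Sum>K\<in>self_dual_deg m. (- 1) ^ (n - m) * P (n - m) (class_quot g (poly_class K)))"
    by (rule sum.swap)
  also have "\<dots> = (\<Sum>m\<le>n. \<Sum>K\<in>self_dual_deg m. \<Sum>g\<in>unit_classes. (- 1) ^ (n - m) * P (n - m) (class_quot g (poly_class K)))"
    by (intro sum.cong refl sum.swap)
  also have "\<dots> = (\<Sum>m\<le>n. \<Sum>K\<in>self_dual_deg m. (- 1) ^ (n - m))"
    by (intro sum.cong refl) (simp add: sum_class_quot_left self_dual_deg_unit_classes sum_P flip: sum_distrib_left)
  also have "\<dots> = (\<Sum>m\<le>n. (- 1) ^ (n - m) * real (card (self_dual_deg m)))" by (simp add: mult.commute)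
  finally show ?thesis by simp
qed

lemma card_self_dual_deg_Suc: "real (card (self_dual_deg (Suc n))) = real q ^ Suc n + real q ^ n"
proof -
  have "(\<Sum>m\<le>n. (- 1) ^ (Suc n - m) * real (card (self_dual_deg m))) = - (\<Sum>m\<le>n. (- 1) ^ (n - m) * real (card (self_dual_deg m)))"
    unfolding sum_negf[symmetric] by (intro sum.cong) (auto simp: Suc_diff_le)
  then show ?thesis using sum_self_dual_deg[of "Suc n"] sum_self_dual_deg[of n] by simp
qed

section \<open>The deviation from uniformity and the distribution of self-dual polynomials over the
  classes\<close>

definition Y :: "nat \<Rightarrow> 'a fps \<Rightarrow> real" where "Y n g = P n g - 1 / real q ^ (2 * l)"

lemma sum_Y: "(\<Sum>g\<in>unit_classes. Y n g) = 0"
  using q_ge_2 by (simp add: Y_def sum_subtractf sum_P card_unit_classes)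

text \<open>By \<open>sum_self_dual_deg\<close> the uniform value satisfies the recursion of P, so
  the difference does too.\<close>

lemma Y_recursion:
  assumes g: "g \<in> unit_classes"
  shows "real q ^ n * Y n g = (\<Sum>m\<le>n. (- 1) ^ (n - m) * (\<Sum>K\<in>self_dual_deg m. Y (n - m) (class_quot g (poly_class K))))"
proof -
  let ?c = "1 / real q ^ (2 * l)"
  have "(\<Sum>m\<le>n. (- 1) ^ (n - m) * (\<Sum>K\<in>self_dual_deg m. Y (n - m) (class_quot g (poly_class K)))) =
    (\<Sum>m\<le>n. (\<Sum>K\<in>self_dual_deg m. (- 1) ^ (n - m) * P (n - m) (class_quot g (poly_class K))) - ?c * ((- 1) ^ (n - m) * real (card (self_dual_deg m))))"
    by (intro sum.cong refl) (simp add: Y_def sum_subtractf sum_distrib_left algebra_simps)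
  also have "\<dots> = real q ^ n * P n g - ?c * real q ^ n"
    unfolding sum_subtractf P_recursion[OF g] sum_distrib_left[symmetric] sum_self_dual_deg by simp
  finally show ?thesis by (simp add: Y_def algebra_simps)
qed

text \<open>Self-duality ties the bottom $l$ coefficients to the top $l$ ones and to the constant term $k$. When
$m > 2l$ these ranges do not overlap, so the class can be exchanged freely with the middle kept.\<close>
definition rep :: "nat \<Rightarrow> 'a fps \<Rightarrow> 'a \<Rightarrow> 'a poly \<Rightarrow> 'a poly" where
  "rep m c k K = (\<Sum>j\<le>m. monom (if m - j \<le> l then fps_nth c (m - j) else if j \<le> l then k * cj (fps_nth c j) else coeff K j) j)"

lemma coeff_sum_monom: "coeff (\<Sum>j\<le>m. monom (a j) j) i = (if i \<le> m then a i else 0)"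
proof -
  have "coeff (\<Sum>j\<le>m. monom (a j) j) i = (\<Sum>j\<le>m. if j = i then a j else 0)" by (simp add: coeff_sum)
  then show ?thesis by simp
qed

lemma coeff_rep: "coeff (rep m c k K) j = (if j \<le> m then (if m - j \<le> l then fps_nth c (m - j) else if j \<le> l then k * cj (fps_nth c j) else coeff K j) else 0)"
  unfolding rep_def by (rule coeff_sum_monom)

lemma self_dual_coeff:
  assumes K: "K \<in> self_dual" "j \<le> degree K"
  shows "coeff K j = coeff K 0 * cj (coeff K (degree K - j))" "coeff K 0 * cj (coeff K 0) = 1"
proof -
  have e: "cj (coeff K (degree K - i)) = cj (coeff K 0) * coeff K i" if "i \<le> degree K" for i
  proof -
    have "pst K = Polynomial.smult (cj (coeff K 0)) K" using K(1) by (simp add: self_dual_def)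
    then have "coeff (pst K) i = coeff (Polynomial.smult (cj (coeff K 0)) K) i" by (rule arg_cong)
    then show ?thesis using that unfolding coeff_pst coeff_smult by simp
  qed
  have lc: "coeff K (degree K) = 1" using self_dual_D(1)[OF K(1)] .
  have "1 = cj (coeff K 0) * coeff K 0" using e[of 0] unfolding diff_zero lc cj_1 by blast
  then show n: "coeff K 0 * cj (coeff K 0) = 1" by (metis mult.commute)
  have "coeff K 0 * cj (coeff K (degree K - j)) = (coeff K 0 * cj (coeff K 0)) * coeff K j"
    unfolding e[OF K(2)] by (rule mult.assoc[symmetric])
  then show "coeff K j = coeff K 0 * cj (coeff K (degree K - j))" unfolding n by simp
qed

lemma self_dual_I:
  assumes "\<And>j. j > m \<Longrightarrow> coeff K j = 0" "coeff K m = 1" "k * cj k = 1" "\<And>j. j \<le> m \<Longrightarrow> coeff K j = k * cj (coeff K (m - j))"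
  shows "K \<in> self_dual" "degree K = m" "coeff K 0 = k"
proof -
  have "degree K \<le> m" by (rule degree_le) (use assms(1) in auto)
  moreover have "m \<le> degree K" by (rule le_degree) (use assms(2) in simp)
  ultimately show d: "degree K = m" by simp
  show k0: "coeff K 0 = k" using assms(4)[of 0] assms(2) by simp
  have knz: "k \<noteq> 0" using assms(3) by auto
  have "pst K = Polynomial.smult (cj k) K"
  proof (intro poly_eqI)
    fix j
    show "coeff (pst K) j = coeff (Polynomial.smult (cj k) K) j"
    proof (cases "j \<le> m")
      case True
      have "cj k * coeff K j = (k * cj k) * cj (coeff K (m - j))" by (subst assms(4)[OF True]) (simp add: mult_ac)
      then show ?thesis using True assms(3) d by (simp add: coeff_pst)
    next
      case False
      then show ?thesis using assms(1) d by (simp add: coeff_pst)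
    qed
  qed
  then show "K \<in> self_dual" using d assms(2) k0 knz by (simp add: self_dual_def)
qed

text \<open>For m = 2 l the two ends share the coefficient of index l, and the condition
  \<open>mid\<close> makes the two prescriptions agree there.\<close>

lemma rep_self_dual:
  assumes c: "c \<in> unit_classes" and k: "k * cj k = 1" and m: "m \<ge> 2 * l" and mid: "m = 2 * l \<Longrightarrow> fps_nth c l = k * cj (fps_nth c l)"
    and K: "\<And>j. l < j \<Longrightarrow> j < m - l \<Longrightarrow> coeff K j = k * cj (coeff K (m - j))"
  shows "rep m c k K \<in> self_dual_deg m" "poly_class (rep m c k K) = c" "coeff (rep m c k K) 0 = k"
proof -
  have c0: "fps_nth c 0 = 1" using unit_classes_D(1)[OF c] .
  have kk: "k * (cj k * x) = x" for x using k by (metis mult.assoc mult_1)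
  have lm: "l < m" using m l_pos by simp
  have "coeff (rep m c k K) j = k * cj (coeff (rep m c k K) (m - j))" if j: "j \<le> m" for j
  proof -
    consider "m - j \<le> l" "j \<le> l" | "m - j \<le> l" "l < j" | "l < m - j" "j \<le> l" | "l < m - j" "l < j" by linarith
    then show ?thesis
    proof cases
      case 1
      then have "j = l" "m = 2 * l" using m j by linarith+
      then show ?thesis using mid by (simp add: coeff_rep)
    next
      case 2
      then show ?thesis using j by (simp add: coeff_rep cj_mult kk)
    next
      case 3
      then show ?thesis using j by (simp add: coeff_rep)
    next
      case 4
      then show ?thesis using j K[of j] by (simp add: coeff_rep)
    qed
  qed
  then have S: "rep m c k K \<in> self_dual" "degree (rep m c k K) = m" "coeff (rep m c k K) 0 = k"
    using self_dual_I[of m "rep m c k K" k] k c0 by (auto simp: coeff_rep)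
  show "rep m c k K \<in> self_dual_deg m" using S by (simp add: self_dual_deg_def)
  show "coeff (rep m c k K) 0 = k" using S by simp
  show "poly_class (rep m c k K) = c"
  proof (intro fps_ext)
    fix i
    have "fps_nth c i = fps_nth (tr c) i" using unit_classes_D(2)[OF c] by simp
    then show "fps_nth (poly_class (rep m c k K)) i = fps_nth c i"
      using lm S(2) by (auto simp: poly_class_nth coeff_rep)
  qed
qed

lemma rep_eq:
  assumes K: "K \<in> self_dual_deg m" and m: "m \<ge> 2 * l" and c: "\<And>j. l < j \<Longrightarrow> j < m - l \<Longrightarrow> coeff K' j = coeff K j"
  shows "rep m (poly_class K) (coeff K 0) K' = K"
proof (intro poly_eqI)
  fix j
  have K1: "K \<in> self_dual" "degree K = m" using K by (auto simp: self_dual_deg_def)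
  show "coeff (rep m (poly_class K) (coeff K 0) K') j = coeff K j"
  proof (cases "j \<le> m")
    case True
    then show ?thesis using self_dual_coeff(1)[OF K1(1), of j] K1(2) c[of j] m by (auto simp: coeff_rep poly_class_nth)
  next
    case False
    then show ?thesis using K1 by (simp add: coeff_rep coeff_eq_0)
  qed
qed

lemma card_fibre_const:
  assumes m: "m > 2 * l" and c: "c \<in> unit_classes" "c' \<in> unit_classes"
  shows "card {K \<in> self_dual_deg m. poly_class K = c} = card {K \<in> self_dual_deg m. poly_class K = c'}"
proof -
  have fact: "rep m c' (coeff K 0) K \<in> {K \<in> self_dual_deg m. poly_class K = c'} \<and> rep m c (coeff (rep m c' (coeff K 0) K) 0) (rep m c' (coeff K 0) K) = K"
    if K: "K \<in> {K \<in> self_dual_deg m. poly_class K = c}" and c': "c' \<in> unit_classes" for K c c'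
  proof -
    have K1: "K \<in> self_dual" "degree K = m" "K \<in> self_dual_deg m" "poly_class K = c" using K by (auto simp: self_dual_deg_def)
    have mid: "coeff K j = coeff K 0 * cj (coeff K (m - j))" if "l < j" "j < m - l" for j
      using self_dual_coeff(1)[OF K1(1), of j] K1(2) that by simp
    have r: "rep m c' (coeff K 0) K \<in> self_dual_deg m" "poly_class (rep m c' (coeff K 0) K) = c'" "coeff (rep m c' (coeff K 0) K) 0 = coeff K 0"
    proof -
      have kk: "coeff K 0 * cj (coeff K 0) = 1" using self_dual_coeff(2)[OF K1(1), of 0] by simp
      have m2: "2 * l \<le> m" using m by simp
      have m3: "fps_nth c' l = coeff K 0 * cj (fps_nth c' l)" if "m = 2 * l" using m that by simp
      show "rep m c' (coeff K 0) K \<in> self_dual_deg m" by (rule rep_self_dual(1)[OF c' kk m2 m3 mid])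
      show "poly_class (rep m c' (coeff K 0) K) = c'" by (rule rep_self_dual(2)[OF c' kk m2 m3 mid])
      show "coeff (rep m c' (coeff K 0) K) 0 = coeff K 0" by (rule rep_self_dual(3)[OF c' kk m2 m3 mid])
    qed
    have "rep m (poly_class K) (coeff K 0) (rep m c' (coeff K 0) K) = K"
      by (rule rep_eq[OF K1(3)]) (use m in \<open>auto simp: coeff_rep\<close>)
    then show ?thesis using r K1(4) by simp
  qed
  have "bij_betw (\<lambda>K. rep m c' (coeff K 0) K) {K \<in> self_dual_deg m. poly_class K = c} {K \<in> self_dual_deg m. poly_class K = c'}"
    by (rule bij_betwI[where g = "\<lambda>K. rep m c (coeff K 0) K"]) (use fact c in blast)+
  then show ?thesis by (rule bij_betw_same_card)
qed

lemma sum_self_dual_deg_fibres: "(\<Sum>K\<in>self_dual_deg m. y (poly_class K)) = (\<Sum>c\<in>unit_classes. real (card {K \<in> self_dual_deg m. poly_class K = c}) * y c)" for y :: "_ \<Rightarrow> real"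
proof -
  have "(\<Sum>K\<in>self_dual_deg m. y (poly_class K)) = (\<Sum>c\<in>unit_classes. \<Sum>K\<in>{K \<in> self_dual_deg m. poly_class K = c}. y (poly_class K))"
    by (rule sum.group[symmetric]) (use finite_self_dual_deg card_unit_classes self_dual_deg_unit_classes in auto)
  then show ?thesis by simp
qed

lemma sum_self_dual_deg_large:
  fixes y :: "'a fps \<Rightarrow> real"
  assumes m: "m > 2 * l" and g: "g \<in> unit_classes" and y: "(\<Sum>c\<in>unit_classes. y c) = 0"
  shows "(\<Sum>K\<in>self_dual_deg m. y (class_quot g (poly_class K))) = 0"
proof -
  have "(\<Sum>K\<in>self_dual_deg m. y (class_quot g (poly_class K))) = (\<Sum>c\<in>unit_classes. real (card {K \<in> self_dual_deg m. poly_class K = c}) * y (class_quot g c))"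
    by (rule sum_self_dual_deg_fibres)
  also have "\<dots> = (\<Sum>c\<in>unit_classes. real (card {K \<in> self_dual_deg m. poly_class K = g}) * y (class_quot g c))"
    using card_fibre_const[OF m _ g] by (intro sum.cong) auto
  also have "\<dots> = real (card {K \<in> self_dual_deg m. poly_class K = g}) * (\<Sum>c\<in>unit_classes. y c)"
    by (simp add: sum_class_quot_right[OF g] flip: sum_distrib_left)
  finally show ?thesis using y by simp
qed

text \<open>At degree 2 l the class leaves only the constant coefficient k free. It has norm 1 and
  must carry the conjugate of the l-th coefficient a of the class to a: this is no further condition
  if a = 0 and means k = a / cj a otherwise.\<close>

lemma card_fibre_mid:
  assumes c: "c \<in> unit_classes"
  shows "card {K \<in> self_dual_deg (2 * l). poly_class K = c} = (if fps_nth c l = 0 then q + 1 else 1)"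
proof -
  let ?N = "{k. k * cj k = 1 \<and> fps_nth c l = k * cj (fps_nth c l)}"
  have "bij_betw (\<lambda>K. coeff K 0) {K \<in> self_dual_deg (2 * l). poly_class K = c} ?N"
  proof (rule bij_betwI[where g = "\<lambda>k. rep (2 * l) c k 0"])
    show "(\<lambda>K. coeff K 0) \<in> {K \<in> self_dual_deg (2 * l). poly_class K = c} \<rightarrow> ?N"
    proof
      fix K assume "K \<in> {K \<in> self_dual_deg (2 * l). poly_class K = c}"
      then have K: "K \<in> self_dual" "degree K = 2 * l" "poly_class K = c" by (auto simp: self_dual_deg_def)
      have "fps_nth c l = coeff K l" using K by (auto simp: poly_class_nth)
      moreover have "coeff K l = coeff K 0 * cj (coeff K (degree K - l))"
        by (rule self_dual_coeff(1)[OF K(1)]) (simp add: K(2))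
      moreover have "degree K - l = l" using K(2) by simp
      moreover have "coeff K 0 * cj (coeff K 0) = 1" by (rule self_dual_coeff(2)[OF K(1) le0])
      ultimately show "coeff K 0 \<in> ?N" unfolding mem_Collect_eq by metis
    qed
    have r: "rep (2 * l) c k 0 \<in> self_dual_deg (2 * l)" "poly_class (rep (2 * l) c k 0) = c" "coeff (rep (2 * l) c k 0) 0 = k"
      if k: "k \<in> ?N" for k
    proof -
      have k1: "k * cj k = 1" and k2: "fps_nth c l = k * cj (fps_nth c l)" using k by blast+
      have mid: "coeff 0 j = k * cj (coeff 0 (2 * l - j))" if "l < j" "j < 2 * l - l" for j
        using that by simp
      show "rep (2 * l) c k 0 \<in> self_dual_deg (2 * l)" by (rule rep_self_dual(1)[OF c k1 order_refl k2 mid])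
      show "poly_class (rep (2 * l) c k 0) = c" by (rule rep_self_dual(2)[OF c k1 order_refl k2 mid])
      show "coeff (rep (2 * l) c k 0) 0 = k" by (rule rep_self_dual(3)[OF c k1 order_refl k2 mid])
    qed
    show "(\<lambda>k. rep (2 * l) c k 0) \<in> ?N \<rightarrow> {K \<in> self_dual_deg (2 * l). poly_class K = c}"
      using r(1,2) by blast
    show "rep (2 * l) c (coeff K 0) 0 = K" if K: "K \<in> {K \<in> self_dual_deg (2 * l). poly_class K = c}" for K
    proof -
      have K1: "K \<in> self_dual_deg (2 * l)" and K2: "poly_class K = c" using K by blast+
      have "rep (2 * l) (poly_class K) (coeff K 0) 0 = K" by (rule rep_eq[OF K1]) simp_all
      then show ?thesis unfolding K2 .
    qed
    show "coeff (rep (2 * l) c k 0) 0 = k" if "k \<in> ?N" for k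
      using that by (rule r(3))
  qed
  then have e: "card {K \<in> self_dual_deg (2 * l). poly_class K = c} = card ?N" by (rule bij_betw_same_card)
  show ?thesis
  proof (cases "fps_nth c l = 0")
    case True
    then show ?thesis unfolding e using norm_fibre[of 1] by simp
  next
    case False
    let ?a = "fps_nth c l"
    have "?N = {?a / cj ?a}" using False by (auto simp: cj_divide field_simps)
    then show ?thesis unfolding e using False by simp
  qed
qed

text \<open>The fibre size is 1, plus q on classes whose l-th coefficient vanishes. The constant
  part cancels because y has sum 0, and the rest has total weight q^(2l-1). Bounding by the number
  q^(2l) + q^(2l-1) of polynomials would exceed the coefficient q^(2l) allowed at this
  degree.\<close>

lemma sum_self_dual_deg_mid:
  fixes y :: "'a fps \<Rightarrow> real"
  assumes g: "g \<in> unit_classes" and y: "(\<Sum>c\<in>unit_classes. y c) = 0" and b: "\<And>c. c \<in> unit_classes \<Longrightarrow> \<bar>y c\<bar> \<le> B"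
  shows "\<bar>\<Sum>K\<in>self_dual_deg (2 * l). y (class_quot g (poly_class K))\<bar> \<le> real q ^ (2 * l) * B"
proof -
  let ?Z = "{c \<in> unit_classes. fps_nth c l = 0}"
  have fin: "finite unit_classes" using card_unit_classes by simp
  have B0: "B \<ge> 0" using b[OF g] by linarith
  have "(\<Sum>K\<in>self_dual_deg (2 * l). y (class_quot g (poly_class K))) = (\<Sum>c\<in>unit_classes. real (card {K \<in> self_dual_deg (2 * l). poly_class K = c}) * y (class_quot g c))"
    by (rule sum_self_dual_deg_fibres)
  also have "\<dots> = (\<Sum>c\<in>unit_classes. y (class_quot g c) + (if fps_nth c l = 0 then real q * y (class_quot g c) else 0))"
  proof (rule sum.cong[OF refl])
    fix c assume c: "c \<in> unit_classes"
    show "real (card {K \<in> self_dual_deg (2 * l). poly_class K = c}) * y (class_quot g c) = y (class_quot g c) + (if fps_nth c l = 0 then real q * y (class_quot g c) else 0)"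
      unfolding card_fibre_mid[OF c] by (simp add: distrib_right)
  qed
  also have "\<dots> = (\<Sum>c\<in>?Z. real q * y (class_quot g c))"
    using fin y by (simp add: sum.distrib sum_class_quot_right[OF g] sum.inter_filter)
  finally have e: "(\<Sum>K\<in>self_dual_deg (2 * l). y (class_quot g (poly_class K))) = (\<Sum>c\<in>?Z. real q * y (class_quot g c))" .
  have "\<bar>\<Sum>c\<in>?Z. real q * y (class_quot g c)\<bar> \<le> (\<Sum>c\<in>?Z. \<bar>real q * y (class_quot g c)\<bar>)" by (rule sum_abs)
  also have "\<dots> \<le> (\<Sum>c\<in>?Z. real q * B)"
    using b class_quot_unit_classes[OF g] by (intro sum_mono) (auto simp: abs_mult intro!: mult_left_mono)
  also have "\<dots> = real (card ?Z * q) * B" by simp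
  also have "\<dots> \<le> real (q ^ (2 * l)) * B"
  proof (intro mult_right_mono B0 of_nat_mono)
    \<comment> \<open>The size of \<open>?Z\<close> is read off by comparing the sum of the fibre
      sizes with the known number of self-dual polynomials.\<close>
    have "card (self_dual_deg (2 * l)) = (\<Sum>c\<in>unit_classes. card {K \<in> self_dual_deg (2 * l). poly_class K = c})"
      using sum.group[of "self_dual_deg (2 * l)" unit_classes poly_class "\<lambda>_. 1::nat"] finite_self_dual_deg card_unit_classes self_dual_deg_unit_classes by (auto simp: image_subset_iff)
    also have "\<dots> = (\<Sum>c\<in>unit_classes. 1 + (if fps_nth c l = 0 then q else 0))"
      by (intro sum.cong) (auto simp: card_fibre_mid)
    also have "\<dots> = q ^ (2 * l) + card ?Z * q"
      unfolding sum.distrib using fin by (simp add: card_unit_classes sum.inter_filter[symmetric])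
    finally have 1: "card (self_dual_deg (2 * l)) = q ^ (2 * l) + card ?Z * q" .
    obtain l' where l': "2 * l = Suc l'" using l_pos by (cases "2 * l") auto
    have "real (card (self_dual_deg (2 * l))) = real q ^ (2 * l) + real q ^ l'" unfolding l' by (rule card_self_dual_deg_Suc)
    then have "real (card ?Z * q) = real (q ^ l')" unfolding 1 by simp
    then have "card ?Z * q = q ^ l'" by (simp only: of_nat_eq_iff)
    also have "\<dots> \<le> q ^ (2 * l)" using l' q_ge_2 by (intro power_increasing) auto
    finally show "card ?Z * q \<le> q ^ (2 * l)" .
  qed
  finally show ?thesis unfolding e by simp
qed

lemma P_bounds: "0 \<le> P n g" "P n g \<le> 1"
proof -
  have "card {M \<in> U n. poly_class (char_poly M) = g} \<le> card (U n)" by (intro card_mono finite_UH) auto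
  then show "0 \<le> P n g" "P n g \<le> 1" unfolding P_eq using card_U_pos[of n] by simp_all
qed

lemma Y_le_1: "\<bar>Y n g\<bar> \<le> 1"
proof -
  have "real q ^ (2 * l) \<ge> 1" using q_ge_2 by (intro one_le_power) auto
  then have "0 \<le> 1 / real q ^ (2 * l)" "1 / real q ^ (2 * l) \<le> 1"
    by (auto simp: divide_le_eq_1)
  then show ?thesis using P_bounds[of n g] unfolding Y_def by linarith
qed

lemma self_dual_deg_0: "self_dual_deg 0 = {1}"
proof (intro equalityI subsetI)
  fix K assume "K \<in> self_dual_deg 0"
  then have K: "K \<in> self_dual" "degree K = 0" by (auto simp: self_dual_deg_def)
  then have "K = 1" using self_dual_D(1)[OF K(1)] monic_degree_0[of K] by blast
  then show "K \<in> {1}" by blast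
qed (auto simp: self_dual_deg_def self_dual_1)

lemma class_quot_one: "g \<in> unit_classes \<Longrightarrow> class_quot g (poly_class 1) = g"
proof -
  assume g: "g \<in> unit_classes"
  have "poly_class 1 = 1" by (intro fps_ext) (simp add: poly_class_nth)
  then show ?thesis using unit_classes_D(2)[OF g] by (simp add: class_quot_def)
qed

lemma choose_ge_2: "0 < m \<Longrightarrow> m < k \<Longrightarrow> 2 \<le> k choose m"
proof -
  assume m: "0 < m" "m < k"
  obtain m' k' where e: "m = Suc m'" "k = Suc k'" using m by (metis less_nat_zero_code not0_implies_Suc)
  have "k' choose m' \<ge> 1" "k' choose Suc m' \<ge> 1" using m e by (simp_all add: Suc_le_eq)
  then show ?thesis using e by simp
qed

text \<open>The factor is the m-th coefficient of (1 + q u)^(2l), which is what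
  \<open>euler_power_rec\<close> requires. It is 0 for m > 2 l, where equidistribution makes the sum
  vanish.\<close>

lemma sum_self_dual_deg_bound:
  assumes g: "g \<in> unit_classes" and m: "0 < m" and B: "\<And>c. c \<in> unit_classes \<Longrightarrow> \<bar>Y n c\<bar> \<le> B"
  shows "\<bar>\<Sum>K\<in>self_dual_deg m. Y n (class_quot g (poly_class K))\<bar> \<le> real (2 * l choose m) * real q ^ m * B"
proof -
  have B0: "B \<ge> 0" using B[OF g] by linarith
  consider "m < 2 * l" | "m = 2 * l" | "m > 2 * l" by linarith
  then show ?thesis
  proof cases
    case 1
    obtain m' where m': "m = Suc m'" using m by (cases m) auto
    have "\<bar>\<Sum>K\<in>self_dual_deg m. Y n (class_quot g (poly_class K))\<bar> \<le> (\<Sum>K\<in>self_dual_deg m. \<bar>Y n (class_quot g (poly_class K))\<bar>)" by (rule sum_abs)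
    also have "\<dots> \<le> (\<Sum>K\<in>self_dual_deg m. B)" using B class_quot_unit_classes[OF g] self_dual_deg_unit_classes by (intro sum_mono) auto
    also have "\<dots> = real (card (self_dual_deg m)) * B" by simp
    also have "\<dots> \<le> (real (2 * l choose m) * real q ^ m) * B"
    proof (rule mult_right_mono[OF _ B0])
      have "real (card (self_dual_deg m)) = real q ^ m + real q ^ m'" unfolding m' by (rule card_self_dual_deg_Suc)
      also have "\<dots> \<le> 2 * real q ^ m" using q_ge_2 by (simp add: m')
      also have "\<dots> \<le> real (2 * l choose m) * real q ^ m"
        using choose_ge_2[OF m 1] by (intro mult_right_mono) auto
      finally show "real (card (self_dual_deg m)) \<le> real (2 * l choose m) * real q ^ m" .
    qed
    finally show ?thesis .
  next
    case 2
    then show ?thesis using sum_self_dual_deg_mid[OF g sum_Y B] by simp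
  next
    case 3
    have "0 \<le> real (2 * l choose m) * real q ^ m * B" by (intro mult_nonneg_nonneg B0) auto
    then show ?thesis using sum_self_dual_deg_large[OF 3 g sum_Y] by simp
  qed
qed

end

section \<open>Euler's product as a majorant\<close>

definition euler_coeff :: "real \<Rightarrow> nat \<Rightarrow> real" where
  "euler_coeff Q n = (\<Prod>i<n. Q / (Q ^ Suc i - 1))"

text \<open>The expansion of the product of the factors 1 + u / Q^i over all i \<ge> 0.\<close>

definition euler_fps :: "real \<Rightarrow> real fps" where "euler_fps Q = Abs_fps (euler_coeff Q)"

definition scale_fps :: "real \<Rightarrow> real fps \<Rightarrow> real fps" where "scale_fps Q a = Abs_fps (\<lambda>n. Q ^ n * fps_nth a n)"

lemma scale_fps_mult: "scale_fps Q (a * b) = scale_fps Q a * scale_fps Q b"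
proof (intro fps_ext)
  fix n
  have "fps_nth (scale_fps Q a * scale_fps Q b) n = (\<Sum>i=0..n. (Q ^ i * Q ^ (n - i)) * (fps_nth a i * fps_nth b (n - i)))"
    by (simp add: scale_fps_def fps_mult_nth mult_ac)
  also have "\<dots> = (\<Sum>i=0..n. Q ^ n * (fps_nth a i * fps_nth b (n - i)))"
    by (intro sum.cong) (auto simp flip: power_add)
  finally show "fps_nth (scale_fps Q (a * b)) n = fps_nth (scale_fps Q a * scale_fps Q b) n"
    by (simp add: scale_fps_def fps_mult_nth sum_distrib_left)
qed

lemma scale_fps_power: "scale_fps Q (a ^ k) = scale_fps Q a ^ k"
  by (induction k) (auto simp: scale_fps_mult, auto simp: scale_fps_def fps_eq_iff)

text \<open>Replacing u by Q u shifts the factors of the product by one and brings in the new factor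
  1 + Q u.\<close>

lemma scale_euler:
  assumes "Q > 1" shows "scale_fps Q (euler_fps Q) = (1 + fps_const Q * fps_X) * euler_fps Q"
proof (intro fps_ext)
  fix n
  show "fps_nth (scale_fps Q (euler_fps Q)) n = fps_nth ((1 + fps_const Q * fps_X) * euler_fps Q) n"
  proof (cases n)
    case 0
    then show ?thesis by (simp add: scale_fps_def distrib_right mult.assoc)
  next
    case (Suc m)
    have "Q ^ Suc m > 1" using assms by (intro one_less_power) auto
    then have "Q ^ Suc m * euler_coeff Q (Suc m) = euler_coeff Q (Suc m) + Q * euler_coeff Q m"
      by (simp add: euler_coeff_def field_simps)
    then show ?thesis using Suc by (simp add: scale_fps_def euler_fps_def distrib_right mult.assoc)
  qed
qed

lemma one_plus_X_power_nth: "fps_nth ((1 + fps_const Q * fps_X) ^ k) m = real (k choose m) * Q ^ m"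
proof (induction k arbitrary: m)
  case 0
  show ?case by (cases m) auto
next
  case (Suc k)
  note IH = Suc
  show ?case
  proof (cases m)
    case 0
    then show ?thesis by (simp add: distrib_right mult.assoc IH)
  next
    case (Suc m')
    have "fps_nth ((1 + fps_const Q * fps_X) ^ Suc k) m = real (k choose m) * Q ^ m + Q * (real (k choose m') * Q ^ m')"
      by (simp add: distrib_right mult.assoc IH Suc)
    then show ?thesis using Suc by (simp add: algebra_simps)
  qed
qed

text \<open>Compare coefficients in E^k (Q u) = (1 + Q u)^k E^k (u). For k = 2 l this is the
  recursion of the deviation with the estimates replaced by equalities.\<close>

lemma euler_power_rec:
  assumes "Q > 1"
  shows "Q ^ n * fps_nth (euler_fps Q ^ k) n = (\<Sum>m\<le>n. real (k choose m) * Q ^ m * fps_nth (euler_fps Q ^ k) (n - m))"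
proof -
  have "Q ^ n * fps_nth (euler_fps Q ^ k) n = fps_nth (scale_fps Q (euler_fps Q ^ k)) n" by (simp add: scale_fps_def)
  also have "\<dots> = fps_nth ((1 + fps_const Q * fps_X) ^ k * euler_fps Q ^ k) n"
    unfolding scale_fps_power scale_euler[OF assms] power_mult_distrib ..
  also have "\<dots> = (\<Sum>m\<le>n. real (k choose m) * Q ^ m * fps_nth (euler_fps Q ^ k) (n - m))"
    by (simp add: fps_mult_nth one_plus_X_power_nth atLeast0AtMost)
  finally show ?thesis .
qed

lemma euler_coeff_nonneg: "Q > 1 \<Longrightarrow> euler_coeff Q n \<ge> 0"
proof -
  assume Q: "Q > 1"
  have "Q ^ Suc i - 1 > 0" for i using Q one_less_power[of Q "Suc i"] by simp
  then show ?thesis unfolding euler_coeff_def using Q by (intro prod_nonneg) (auto simp: less_imp_le)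
qed

text \<open>Each factor satisfies Q / (Q^(i+1) - 1) \<le> Q / (Q^(i+1) - Q^i) = (1 + 1/(Q-1))
  Q^(-i), up to i = 0 where equality holds, and the exponents 0, ..., n-1 add up to n^2/2 -
  n/2.\<close>

lemma euler_coeff_le:
  assumes Q: "Q > 1"
  shows "euler_coeff Q n \<le> (1 + 1 / (Q - 1)) ^ n * Q powr (real n / 2 - real n ^ 2 / 2)"
proof (induction n)
  case 0
  show ?case using Q by (simp add: euler_coeff_def)
next
  case (Suc n)
  have "Q ^ Suc n - Q ^ n > 0" using Q by simp
  moreover have "Q ^ Suc n - Q ^ n \<le> Q ^ Suc n - 1" using Q by simp
  ultimately have "Q / (Q ^ Suc n - 1) \<le> Q / (Q ^ Suc n - Q ^ n)"
    using Q one_less_power[of Q "Suc n"] by (intro divide_left_mono mult_pos_pos) simp_all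
  also have "\<dots> = (1 + 1 / (Q - 1)) * Q powr (- real n)"
    using Q by (simp add: powr_minus powr_realpow field_simps)
  finally have 1: "Q / (Q ^ Suc n - 1) \<le> (1 + 1 / (Q - 1)) * Q powr (- real n)" .
  have "euler_coeff Q (Suc n) = euler_coeff Q n * (Q / (Q ^ Suc n - 1))" by (simp add: euler_coeff_def)
  also have "\<dots> \<le> ((1 + 1 / (Q - 1)) ^ n * Q powr (real n / 2 - real n ^ 2 / 2)) * ((1 + 1 / (Q - 1)) * Q powr (- real n))"
  proof (rule mult_mono[OF Suc.IH 1])
    have "Q ^ Suc n > 1" using Q by (intro one_less_power) auto
    then show "0 \<le> Q / (Q ^ Suc n - 1)" using Q by simp
  qed (use Q in simp)
  also have "\<dots> = (1 + 1 / (Q - 1)) ^ Suc n * (Q powr (real n / 2 - real n ^ 2 / 2) * Q powr (- real n))" by simp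
  also have "Q powr (real n / 2 - real n ^ 2 / 2) * Q powr (- real n) = Q powr (real (Suc n) / 2 - real (Suc n) ^ 2 / 2)"
    unfolding powr_add[symmetric] by (rule arg_cong[where f = "\<lambda>x. Q powr x"]) (simp add: power2_eq_square field_simps)
  finally show ?case .
qed

lemma sum_squares_ge:
  fixes a :: "nat \<Rightarrow> real"
  assumes "k > 0" "(\<Sum>i<k. a i) = s"
  shows "s ^ 2 / real k \<le> (\<Sum>i<k. a i ^ 2)"
proof -
  have "0 \<le> (\<Sum>i<k. (a i - s / real k) ^ 2)" by (rule sum_nonneg) simp
  also have "\<dots> = (\<Sum>i<k. a i ^ 2 - 2 * (s / real k) * a i + (s / real k) ^ 2)"
    by (intro sum.cong) (auto simp: power2_eq_square algebra_simps)
  also have "\<dots> = (\<Sum>i<k. a i ^ 2) - 2 * (s / real k) * s + real k * (s / real k) ^ 2"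
    unfolding sum.distrib sum_subtractf sum_distrib_left[symmetric] assms(2) by simp
  also have "\<dots> = (\<Sum>i<k. a i ^ 2) - s ^ 2 / real k"
    using assms(1) by (simp add: power2_eq_square field_simps)
  finally show ?thesis by simp
qed

text \<open>The coefficient is a sum over the ways to write n as an ordered sum of k nonnegative
  parts, of which there are n + k - 1 choose n. The squares of the parts add up to at least n^2/k,
  which gives the same bound for every term.\<close>

lemma euler_power_le:
  assumes Q: "Q > 1" and k: "k > 0"
  shows "fps_nth (euler_fps Q ^ k) n \<le>
    (1 + 1 / (Q - 1)) ^ n * Q powr (real n / 2 - real n ^ 2 / (2 * real k)) * real ((n + k - 1) choose n)"
proof -
  let ?t = "1 + 1 / (Q - 1)"
  have S: "natpermute n k = {v. length v = k \<and> sum_list v = n}" by (auto simp: natpermute_def)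
  have "fps_nth (euler_fps Q ^ k) n = (\<Sum>v\<in>natpermute n k. \<Prod>i\<in>{0..k - 1}. euler_coeff Q (v ! i))"
    using k by (simp add: fps_power_nth euler_fps_def)
  also have "\<dots> \<le> (\<Sum>v\<in>natpermute n k. ?t ^ n * Q powr (real n / 2 - real n ^ 2 / (2 * real k)))"
  proof (rule sum_mono)
    fix v assume "v \<in> natpermute n k"
    then have v: "length v = k" "sum_list v = n" unfolding S by auto
    have sv: "(\<Sum>i<k. v ! i) = n" using v by (simp add: sum_list_sum_nth atLeast0LessThan)
    have sr: "(\<Sum>i<k. real (v ! i)) = real n" using arg_cong[OF sv, of real] by simp
    have "{0..k - 1} = {..<k}" using k by auto
    then have "(\<Prod>i\<in>{0..k - 1}. euler_coeff Q (v ! i)) = (\<Prod>i<k. euler_coeff Q (v ! i))" by simp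
    also have "\<dots> \<le> (\<Prod>i<k. ?t ^ (v ! i) * Q powr (real (v ! i) / 2 - real (v ! i) ^ 2 / 2))"
      by (intro prod_mono conjI euler_coeff_le euler_coeff_nonneg Q)
    also have "\<dots> = ?t ^ (\<Sum>i<k. v ! i) * Q powr (\<Sum>i<k. real (v ! i) / 2 - real (v ! i) ^ 2 / 2)"
      using Q by (simp add: prod.distrib power_sum powr_sum)
    also have "(\<Sum>i<k. real (v ! i) / 2 - real (v ! i) ^ 2 / 2) = real n / 2 - (\<Sum>i<k. real (v ! i) ^ 2) / 2"
      using sr by (simp add: sum_subtractf sum_divide_distrib[symmetric])
    also have "?t ^ (\<Sum>i<k. v ! i) * Q powr (real n / 2 - (\<Sum>i<k. real (v ! i) ^ 2) / 2) \<le> ?t ^ n * Q powr (real n / 2 - real n ^ 2 / (2 * real k))"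
      unfolding sv
    proof (intro mult_left_mono powr_mono)
      show "real n / 2 - (\<Sum>i<k. real (v ! i) ^ 2) / 2 \<le> real n / 2 - real n ^ 2 / (2 * real k)"
        using sum_squares_ge[OF k sr] by (simp add: field_simps)
    qed (use Q in auto)
    finally show "(\<Prod>i\<in>{0..k - 1}. euler_coeff Q (v ! i)) \<le> ?t ^ n * Q powr (real n / 2 - real n ^ 2 / (2 * real k))" .
  qed
  also have "\<dots> = ?t ^ n * Q powr (real n / 2 - real n ^ 2 / (2 * real k)) * real (card (natpermute n k))" by simp
  also have "card (natpermute n k) = (n + k - 1) choose n" unfolding S by (rule card_length_sum_list)
  finally show ?thesis .
qed

section \<open>The bound for short intervals\<close>

context short_classes begin

text \<open>The term of degree 0 in the recursion is (-1)^n Y n g. Moved to the left it leaves the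
  factor q^n - (-1)^n, of absolute value at least q^n - 1, and the majorant satisfies its recursion
  with the factor q^n - 1.\<close>

lemma Y_bound: "g \<in> unit_classes \<Longrightarrow> \<bar>Y n g\<bar> \<le> fps_nth (euler_fps (real q) ^ (2 * l)) n"
proof (induction n arbitrary: g rule: less_induct)
  case (less n)
  let ?e = "\<lambda>n. fps_nth (euler_fps (real q) ^ (2 * l)) n"
  have Q: "real q > 1" using q_ge_2 by simp
  show ?case
  proof (cases "n = 0")
    case True
    have "?e 0 = 1" by (simp add: fps_nth_power_0 euler_fps_def euler_coeff_def)
    then show ?thesis using Y_le_1 True by simp
  next
    case False
    have split: "(\<Sum>m\<le>n. h m) = h 0 + (\<Sum>m\<in>{1..n}. h m)" for h :: "nat \<Rightarrow> real"
    proof -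
      have "{..n} - {0} = {1..n}" by auto
      then show ?thesis by (simp add: sum.remove[of "{..n}" 0])
    qed
    have "(real q ^ n - (- 1) ^ n) * Y n g = (\<Sum>m\<in>{1..n}. (- 1) ^ (n - m) * (\<Sum>K\<in>self_dual_deg m. Y (n - m) (class_quot g (poly_class K))))"
      using Y_recursion[OF less.prems, of n] unfolding split by (simp add: self_dual_deg_0 class_quot_one[OF less.prems] left_diff_distrib)
    then have "\<bar>real q ^ n - (- 1) ^ n\<bar> * \<bar>Y n g\<bar> = \<bar>\<Sum>m\<in>{1..n}. (- 1) ^ (n - m) * (\<Sum>K\<in>self_dual_deg m. Y (n - m) (class_quot g (poly_class K)))\<bar>"
      by (metis abs_mult)
    also have "\<dots> \<le> (\<Sum>m\<in>{1..n}. \<bar>(- 1) ^ (n - m) * (\<Sum>K\<in>self_dual_deg m. Y (n - m) (class_quot g (poly_class K)))\<bar>)" by (rule sum_abs)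
    also have "\<dots> \<le> (\<Sum>m\<in>{1..n}. real (2 * l choose m) * real q ^ m * ?e (n - m))"
    proof (rule sum_mono)
      fix m assume m: "m \<in> {1..n}"
      have "\<bar>\<Sum>K\<in>self_dual_deg m. Y (n - m) (class_quot g (poly_class K))\<bar> \<le> real (2 * l choose m) * real q ^ m * ?e (n - m)"
        by (rule sum_self_dual_deg_bound[OF less.prems]) (use m less.IH[of "n - m"] in auto)
      then show "\<bar>(- 1) ^ (n - m) * (\<Sum>K\<in>self_dual_deg m. Y (n - m) (class_quot g (poly_class K)))\<bar> \<le> real (2 * l choose m) * real q ^ m * ?e (n - m)"
        by (simp add: abs_mult power_abs)
    qed
    also have "\<dots> = (real q ^ n - 1) * ?e n"
      using euler_power_rec[OF Q, of n "2 * l"] unfolding split by (simp add: left_diff_distrib)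
    finally have 1: "\<bar>real q ^ n - (- 1) ^ n\<bar> * \<bar>Y n g\<bar> \<le> (real q ^ n - 1) * ?e n" .
    have q1: "real q ^ n - 1 > 0" using False Q one_less_power[of "real q" n] by simp
    have "real q ^ n - 1 \<le> \<bar>real q ^ n - (- 1) ^ n\<bar>" by (cases "even n") auto
    then have "(real q ^ n - 1) * \<bar>Y n g\<bar> \<le> (real q ^ n - 1) * ?e n"
      using 1 by (meson abs_ge_zero mult_right_mono order_trans)
    then show ?thesis using q1 by simp
  qed
qed

text \<open>The class records the coefficients of index n - l, ..., n, and n - l = h + 1.\<close>

lemma poly_class_eq_iff:
  assumes "f \<in> monics n" "g \<in> monics n" "n = l + h + 1"
  shows "poly_class g = poly_class f \<longleftrightarrow> g \<in> short_interval f h"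
proof -
  have d: "degree f = n" "degree g = n" "monic g" using assms by (auto simp: monics_def)
  have "f - g = 0 \<or> degree (f - g) \<le> h \<longleftrightarrow> (\<forall>j>h. coeff f j = coeff g j)"
  proof
    assume "f - g = 0 \<or> degree (f - g) \<le> h"
    then show "\<forall>j>h. coeff f j = coeff g j"
    proof
      assume "degree (f - g) \<le> h"
      then have "coeff (f - g) j = 0" if "j > h" for j using that by (intro coeff_eq_0) simp
      then show ?thesis by simp
    qed simp
  next
    assume "\<forall>j>h. coeff f j = coeff g j"
    then have "degree (f - g) \<le> h" by (intro degree_le) simp
    then show "f - g = 0 \<or> degree (f - g) \<le> h" ..
  qed
  also have "\<dots> \<longleftrightarrow> (\<forall>i\<le>l. coeff f (n - i) = coeff g (n - i))"
  proof
    assume a: "\<forall>i\<le>l. coeff f (n - i) = coeff g (n - i)"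
    show "\<forall>j>h. coeff f j = coeff g j"
    proof (intro allI impI)
      fix j assume j: "j > h"
      show "coeff f j = coeff g j"
      proof (cases "j \<le> n")
        case True
        have "n - j \<le> l" using j assms(3) by simp
        then show ?thesis using a[rule_format, of "n - j"] True by simp
      next
        case False
        then show ?thesis using d by (simp add: coeff_eq_0)
      qed
    qed
  next
    assume a: "\<forall>j>h. coeff f j = coeff g j"
    show "\<forall>i\<le>l. coeff f (n - i) = coeff g (n - i)" using a assms(3) by auto
  qed
  also have "\<dots> \<longleftrightarrow> poly_class g = poly_class f"
    using d assms(3) by (auto simp: fps_eq_iff poly_class_nth)
  finally show ?thesis using d(3) by (simp add: short_interval_def)
qed

end

theorem theorem5p17:
  fixes q n h :: nat and f :: "('a::{field,finite}) poly"
  assumes "\<exists>p k. prime p \<and> k > 0 \<and> q = p ^ k"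
    and "card (UNIV :: 'a set) = q ^ 2"
    and "n \<ge> 1"
    and "h + 1 < n"
    and "monic f" and "degree f = n"
  shows "\<bar>real (card {M \<in> (unitary_group n q :: 'a mat set). char_poly M \<in> short_interval f h})
            / real (card (unitary_group n q :: 'a mat set))
          - real q ^ (2 * (h + 1)) / real q ^ (2 * n)\<bar>
     \<le> real q powr (- (real n ^ 2 / (4 * (real n - real h - 1)))) * real q powr (real n / 2)
        * (1 + 1 / (real q - 1)) ^ n * real ((3 * n - 2 * h - 3) choose n)"
proof -
  define l where "l = n - h - 1"
  have nl: "n = l + h + 1" "l > 0" using assms(4) by (auto simp: l_def)
  interpret short_classes q "TYPE('a)" l
    by unfold_locales (use assms(1,2) nl in auto)
  have fM: "f \<in> monics n" using assms by (simp add: monics_def)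
  have Q: "real q > 1" using q_ge_2 by simp
  have "{M \<in> unitary_group n q. char_poly M \<in> short_interval f h} = {M \<in> U n. poly_class (char_poly M) = poly_class f}"
    unfolding U_eq_unitary_group[symmetric] using poly_class_eq_iff[OF fM char_poly_monics nl(1)] by blast
  then have "real (card {M \<in> unitary_group n q. char_poly M \<in> short_interval f h}) / real (card (unitary_group n q :: 'a mat set)) = P n (poly_class f)"
    by (simp add: P_eq U_eq_unitary_group)
  moreover have "real q ^ (2 * (h + 1)) / real q ^ (2 * n) = 1 / real q ^ (2 * l)"
  proof -
    have "real q ^ (2 * n) = real q ^ (2 * (h + 1)) * real q ^ (2 * l)"
      unfolding power_add[symmetric] nl(1) by (simp add: algebra_simps)
    then show ?thesis using Q by simp
  qed
  ultimately have "\<bar>real (card {M \<in> unitary_group n q. char_poly M \<in> short_interval f h}) / real (card (unitary_group n q :: 'a mat set))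
      - real q ^ (2 * (h + 1)) / real q ^ (2 * n)\<bar> = \<bar>Y n (poly_class f)\<bar>"
    by (simp add: Y_def)
  also have "\<dots> \<le> fps_nth (euler_fps (real q) ^ (2 * l)) n"
    by (rule Y_bound[OF poly_class_unit_classes[OF assms(5)]])
  \<comment> \<open>With k = 2 l = 2 (n - h - 1) the exponent n^2/(2k) is n^2/(4(n - h - 1)), and n
    + k - 1 = 3n - 2h - 3.\<close>
  also have "\<dots> \<le> (1 + 1 / (real q - 1)) ^ n * real q powr (real n / 2 - real n ^ 2 / (2 * real (2 * l))) * real ((n + 2 * l - 1) choose n)"
    by (rule euler_power_le[OF Q]) (use nl in simp)
  also have "n + 2 * l - 1 = 3 * n - 2 * h - 3" using nl by simp
  also have "real n / 2 - real n ^ 2 / (2 * real (2 * l)) = - (real n ^ 2 / (4 * (real n - real h - 1))) + real n / 2"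
  proof -
    have "real n - real h - 1 = real l" using nl(1) by simp
    then show ?thesis by simp
  qed
  also have "(1 + 1 / (real q - 1)) ^ n * real q powr (- (real n ^ 2 / (4 * (real n - real h - 1))) + real n / 2) * real ((3 * n - 2 * h - 3) choose n)
    = real q powr (- (real n ^ 2 / (4 * (real n - real h - 1)))) * real q powr (real n / 2)
        * (1 + 1 / (real q - 1)) ^ n * real ((3 * n - 2 * h - 3) choose n)"
    unfolding powr_add by (simp only: mult_ac)
  finally show ?thesis .
qed

end
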